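(* Let $H$ be a separable infinite-dimensional Hilbert space, let $\mathcal{J}$ be a normed ideal of $\mathbb{B}(H)$, let $[a,b]\subset[0,\infty)$ be a finite closed interval, and let $\varphi=(\varphi_1,\varphi_2)$ be a pair of real-valued continuous functions on $[a,b]$ such that $\varphi_1,\varphi_2$ are increasing and $\varphi_1+\varphi_2$ is strictly increasing. Let $T\in\mathbb{B}(H)$. Assume: (1) if $a>0$: $\varphi_1$ and $\varphi_2$ are $\mathcal{J}$-Lipschitz functions on $[a,b]$ and $\sigma(|T|),\sigma(|T^*|)\subset(a,b)$; (2) if $a=0$: the even extensions $\tilde\varphi_1$ and $\tilde\varphi_2$ are $\mathcal{J}$-Lipschitz functions on $[-b,b]$ and $\sigma(|T|),\sigma(|T^*|)\subset[0,b)$. Assume moreover that $[\varphi(T),T]\in\mathcal{J}$. Then there exists a unique global solution $X(t)$ on $[0,\infty)$ of $$\frac{dX(t)}{dt}=[\varphi(X(t)),X(t)],\qquad X(0)=T,$$ such that $X(t)-T$ belongs to $C^1([0,\infty),\mathcal{J})$, where $\mathcal{J}$ is equipped with the norm $\|\cdot\|_{\mathcal{J}}$. The solution stays in the similarity orbit $\mathcal{O}(T)$ of $T$. If moreover $\varphi(T)\in\mathcal{J}$, it stays in $\mathcal{O}_{\mathcal{J}}(T)$.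
   Context: $\mathbb{B}(H)$ is the algebra of bounded operators on $H$ with operator norm $\|\cdot\|$; $|X|=(X^*X)^{1/2}$; $[A,B]=AB-BA$; "increasing" means non-decreasing. For $X\in\mathbb{B}(H)$ with $\sigma(|X|),\sigma(|X^*|)\subset[a,b]$, $\varphi(X):=\varphi_1(|X|)-\varphi_2(|X^*|)$; a solution is understood to satisfy $\sigma(|X(t)|),\sigma(|X(t)^*|)\subset[a,b]$ for all $t$. A normed ideal is a two-sided ideal $\mathcal{J}$ of $\mathbb{B}(H)$ with a norm $\|\cdot\|_{\mathcal{J}}$ making it a Banach space such that $\|X\|_{\mathcal{J}}=\|X\|$ for every rank one operator $X$, and $\|YXZ\|_{\mathcal{J}}\le\|Y\|\,\|X\|_{\mathcal{J}}\,\|Z\|$ for $X\in\mathcal{J}$, $Y,Z\in\mathbb{B}(H)$. The case $\mathcal{J}=\mathbb{B}(H)$ with the operator norm is included. A continuous function $f$ on a compact interval $[c,d]$ is $\mathcal{J}$-Lipschitz on $[c,d]$ if there is $C>0$ such that for all self-adjoint $A_1,A_2\in\mathbb{B}(H)$ with spectra in $[c,d]$ and $A_1-A_2\in\mathcal{J}$, one has $f(A_1)-f(A_2)\in\mathcal{J}$ and $\|f(A_1)-f(A_2)\|_{\mathcal{J}}\le C\|A_1-A_2\|_{\mathcal{J}}$. For $f\in C[0,b]$, $\tilde f(x)=f(|x|)$ on $[-b,b]$. $\mathcal{O}(T)=\{gTg^{-1}: g\in\mathbb{B}(H)\text{ invertible}\}$; $G_{\mathcal{J}}=\{g\in\mathbb{B}(H)\text{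 invertible}: g-I\in\mathcal{J}\}$; $\mathcal{O}_{\mathcal{J}}(T)=\{gTg^{-1}: g\in G_{\mathcal{J}}\}$. *)

theory Defs
  imports "HOL-Analysis.Analysis" "HOL-Computational_Algebra.Polynomial"
begin

section \<open>Complex Hilbert spaces\<close>

class complex_vector = real_vector +
  fixes scaleC :: "complex \<Rightarrow> 'a \<Rightarrow> 'a" (infixr \<open>*\<^sub>C\<close> 75)
  assumes scaleC_add_right: "c *\<^sub>C (x + y) = c *\<^sub>C x + c *\<^sub>C y"
    and scaleC_add_left: "(c + d) *\<^sub>C x = c *\<^sub>C x + d *\<^sub>C x"
    and scaleC_scaleC: "c *\<^sub>C d *\<^sub>C x = (c * d) *\<^sub>C x"
    and scaleC_of_real: "complex_of_real r *\<^sub>C x = r *\<^sub>R x"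

lemma scaleC_one [simp]: "1 *\<^sub>C x = (x::'a::complex_vector)"
  using scaleC_of_real[of 1 x] by simp

global_interpretation complex_vector: vector_space "scaleC :: complex \<Rightarrow> 'a \<Rightarrow> 'a::complex_vector"
  by standard (simp_all add: scaleC_add_right scaleC_add_left scaleC_scaleC)

text \<open>The inner product is conjugate-linear in its first argument.\<close>

class complex_inner = complex_vector + real_normed_vector +
  fixes cinner :: "'a \<Rightarrow> 'a \<Rightarrow> complex"
  assumes cinner_commute: "cinner x y = cnj (cinner y x)"
    and cinner_add_right: "cinner x (y + z) = cinner x y + cinner x z"
    and cinner_scaleC_right: "cinner x (c *\<^sub>C y) = c * cinner x y"
    and cinner_self_nonneg: "0 \<le> Re (cinner x x)"
    and norm_eq_sqrt_cinner: "norm x = sqrt (Re (cinner x x))"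

class chilbert_space = complex_inner + complete_space

text \<open>Separability and infinite dimension are part of a class, not premises of the theorem, so that
  the operators on such a space form an instance of \<^class>\<open>real_normed_algebra_1\<close>, which
  requires \<open>1 \<noteq> 0\<close>.\<close>

class separable_infinite_dim_chilbert_space = chilbert_space +
  assumes separable: "\<exists>D. countable D \<and> (\<forall>x. \<forall>e>0. \<exists>y\<in>D. dist y x < e)"
    and infinite_dim: "finite B \<Longrightarrow> \<exists>x. \<forall>c. x \<noteq> (\<Sum>b\<in>B. c b *\<^sub>C b)"


section \<open>The algebra of bounded operators\<close>

typedef (overloaded) 'a bop =
  "{A :: 'a::complex_inner \<Rightarrow>\<^sub>L 'a. \<forall>c x. blinfun_apply A (c *\<^sub>C x) = c *\<^sub>C blinfun_apply A x}"
  by (rule exI[of _ 0]) simp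

setup_lifting type_definition_bop

lemma scaleC_scaleR_commute: "c *\<^sub>C (r *\<^sub>R x) = r *\<^sub>R (c *\<^sub>C (x::'a::complex_vector))"
  by (simp add: scaleC_scaleC mult.commute flip: scaleC_of_real)

lemma norm_scaleC: "norm (c *\<^sub>C x) = cmod c * norm (x::'a::complex_inner)"
proof -
  have "cinner (c *\<^sub>C x) (c *\<^sub>C x) = c * cnj c * cinner x x"
    by (metis cinner_commute cinner_scaleC_right complex_cnj_mult mult.assoc)
  also have "c * cnj c = complex_of_real ((cmod c)\<^sup>2)"
    by (simp add: complex_mult_cnj cmod_power2)
  finally show ?thesis
    by (simp add: norm_eq_sqrt_cinner real_sqrt_mult)
qed

lemma bounded_linear_scaleC: "bounded_linear (\<lambda>x. c *\<^sub>C (x::'a::complex_inner))"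
  by (rule bounded_linear_intro[where K = "cmod c"])
    (simp_all add: scaleC_add_right scaleC_scaleR_commute norm_scaleC mult.commute)

lift_definition bop_apply :: "'a::complex_inner bop \<Rightarrow> 'a \<Rightarrow> 'a" is blinfun_apply .

instantiation bop :: (complex_inner) real_normed_vector
begin

lift_definition norm_bop :: "'a bop \<Rightarrow> real" is norm .
lift_definition zero_bop :: "'a bop" is 0 by simp
lift_definition plus_bop :: "'a bop \<Rightarrow> 'a bop \<Rightarrow> 'a bop" is plus
  by (simp add: blinfun.add_left scaleC_add_right)
lift_definition uminus_bop :: "'a bop \<Rightarrow> 'a bop" is uminus
  by (simp add: blinfun.minus_left complex_vector.scale_minus_right)
lift_definition minus_bop :: "'a bop \<Rightarrow> 'a bop \<Rightarrow> 'a bop" is minus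
  by (simp add: blinfun.diff_left complex_vector.scale_right_diff_distrib)
lift_definition scaleR_bop :: "real \<Rightarrow> 'a bop \<Rightarrow> 'a bop" is scaleR
  by (simp add: blinfun.scaleR_left scaleC_scaleR_commute)

definition "dist_bop (A::'a bop) B = norm (A - B)"
definition [code del]:
  "(uniformity :: ('a bop \<times> 'a bop) filter) = (INF e\<in>{0<..}. principal {(x, y). dist x y < e})"
definition "open_bop (S::'a bop set) =
  (\<forall>x\<in>S. \<forall>\<^sub>F (x', y) in uniformity. x' = x \<longrightarrow> y \<in> S)"
definition "sgn_bop (A::'a bop) = scaleR (inverse (norm A)) A"

instance
proof
  fix A B C :: "'a bop" and r s :: real and S :: "'a bop set"
  show "A + B + C = A + (B + C)" by transfer simp
  show "A + B = B + A" by transfer simp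
  show "0 + A = A" by transfer simp
  show "- A + A = 0" by transfer simp
  show "A - B = A + - B" by transfer simp
  show "r *\<^sub>R (A + B) = r *\<^sub>R A + r *\<^sub>R B" by transfer (rule scaleR_add_right)
  show "(r + s) *\<^sub>R A = r *\<^sub>R A + s *\<^sub>R A" by transfer (rule scaleR_add_left)
  show "r *\<^sub>R s *\<^sub>R A = (r * s) *\<^sub>R A" by transfer simp
  show "1 *\<^sub>R A = A" by transfer simp
  show "norm A = 0 \<longleftrightarrow> A = 0" by transfer simp
  show "norm (A + B) \<le> norm A + norm B" by transfer (rule norm_triangle_ineq)
  show "norm (r *\<^sub>R A) = \<bar>r\<bar> * norm A" by transfer simp
qed (simp_all add: dist_bop_def uniformity_bop_def open_bop_def sgn_bop_def)

end

lemma Blinfun_scaleC_apply: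
  "blinfun_apply (Blinfun (\<lambda>y. c *\<^sub>C blinfun_apply A y)) x =
    c *\<^sub>C blinfun_apply (A :: 'a::real_normed_vector \<Rightarrow>\<^sub>L 'b::complex_inner) x"
  by (subst bounded_linear_Blinfun_apply)
    (rule bounded_linear_compose[OF bounded_linear_scaleC blinfun.bounded_linear_right], simp)

instantiation bop :: (complex_inner) complex_vector
begin

lift_definition scaleC_bop :: "complex \<Rightarrow> 'a bop \<Rightarrow> 'a bop"
  is "\<lambda>c A. Blinfun (\<lambda>x. c *\<^sub>C blinfun_apply A x)"
  by (simp add: Blinfun_scaleC_apply scaleC_scaleC mult.commute)

lemma bop_apply_scaleC: "bop_apply (c *\<^sub>C A) x = c *\<^sub>C bop_apply A x"
  by transfer (rule Blinfun_scaleC_apply)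

lemma bop_eqI: "(\<And>x. bop_apply A x = bop_apply B x) \<Longrightarrow> A = B"
  by transfer (rule blinfun_eqI)

lemma bop_apply_plus: "bop_apply (A + B) x = bop_apply A x + bop_apply B x"
  by transfer (rule blinfun.add_left)

lemma bop_apply_scaleR: "bop_apply (r *\<^sub>R A) x = r *\<^sub>R bop_apply A x"
  by transfer (rule blinfun.scaleR_left)

instance
  by standard
    (auto intro!: bop_eqI simp: bop_apply_scaleC bop_apply_plus bop_apply_scaleR
      scaleC_add_right scaleC_add_left scaleC_scaleC scaleC_of_real)

end

instantiation bop :: (complex_inner) "{real_normed_algebra, monoid_mult}"
begin

lift_definition one_bop :: "'a bop" is id_blinfun by simp
lift_definition times_bop :: "'a bop \<Rightarrow> 'a bop \<Rightarrow> 'a bop" is blinfun_compose by simp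

instance
proof
  fix A B C :: "'a bop" and r :: real
  show "A * B * C = A * (B * C)" by transfer (simp add: blinfun_eqI)
  show "1 * A = A" by transfer (simp add: blinfun_eqI)
  show "A * 1 = A" by transfer (simp add: blinfun_eqI)
  show "(A + B) * C = A * C + B * C" by transfer (simp add: blinfun_eqI blinfun.bilinear_simps)
  show "A * (B + C) = A * B + A * C" by transfer (simp add: blinfun_eqI blinfun.bilinear_simps)
  show "r *\<^sub>R A * B = r *\<^sub>R (A * B)" by transfer (simp add: blinfun_eqI blinfun.bilinear_simps)
  show "A * r *\<^sub>R B = r *\<^sub>R (A * B)" by transfer (simp add: blinfun_eqI blinfun.bilinear_simps)
  show "norm (A * B) \<le> norm A * norm B" by transfer (rule norm_blinfun_compose)
qed

end

lemma ex_nonzero: "\<exists>x::'a::separable_infinite_dim_chilbert_space. x \<noteq> 0"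
  using infinite_dim[of "{}::'a set"] by auto

instance bop :: (separable_infinite_dim_chilbert_space) real_normed_algebra_1
proof
  obtain x :: 'a where x: "x \<noteq> 0" using ex_nonzero by blast
  show "(0::'a bop) \<noteq> 1"
  proof transfer
    show "(0::'a \<Rightarrow>\<^sub>L 'a) \<noteq> id_blinfun"
      using x by (metis blinfun_apply_id_blinfun id_apply zero_blinfun.rep_eq)
  qed
  show "norm (1::'a bop) = 1"
  proof transfer
    have "norm x = norm (blinfun_apply id_blinfun x)" by simp
    also have "\<dots> \<le> norm (id_blinfun :: 'a \<Rightarrow>\<^sub>L 'a) * norm x" by (rule norm_blinfun)
    finally have "1 \<le> norm (id_blinfun :: 'a \<Rightarrow>\<^sub>L 'a)" using x by simp
    moreover have "norm (id_blinfun :: 'a \<Rightarrow>\<^sub>L 'a) \<le> 1"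
      by (rule norm_blinfun_bound) simp_all
    ultimately show "norm (id_blinfun :: 'a \<Rightarrow>\<^sub>L 'a) = 1" by simp
  qed
qed


section \<open>Adjoints, spectra and the continuous functional calculus\<close>

definition adj :: "'a::chilbert_space bop \<Rightarrow> 'a bop" where
  "adj A = (THE B. \<forall>x y. cinner (bop_apply B x) y = cinner x (bop_apply A y))"

definition selfadjoint :: "'a::chilbert_space bop \<Rightarrow> bool" where
  "selfadjoint A \<longleftrightarrow> adj A = A"

definition invertible_bop :: "'a::complex_inner bop \<Rightarrow> bool" where
  "invertible_bop A \<longleftrightarrow> (\<exists>B. A * B = 1 \<and> B * A = 1)"

definition inverse_bop :: "'a::complex_inner bop \<Rightarrow> 'a bop" where
  "inverse_bop A = (THE B. A * B = 1 \<and> B * A = 1)"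

definition spectrum :: "'a::complex_inner bop \<Rightarrow> complex set" where
  "spectrum A = {z. \<not> invertible_bop (A - z *\<^sub>C 1)}"

definition poly_bop :: "real poly \<Rightarrow> 'a::complex_inner bop \<Rightarrow> 'a bop" where
  "poly_bop p A = (\<Sum>i\<le>degree p. coeff p i *\<^sub>R A ^ i)"

text \<open>The continuous functional calculus \<open>f(A)\<close>, for self-adjoint \<open>A\<close> and real-valued \<open>f\<close>
  continuous on the spectrum of \<open>A\<close>: the common norm limit of \<open>p\<^sub>n(A)\<close> over all sequences of
  polynomials \<open>p\<^sub>n\<close> converging to \<open>f\<close> uniformly on the spectrum.  Nothing is claimed outside this range
  of \<open>A\<close> and \<open>f\<close>.\<close>

definition cfc :: "(real \<Rightarrow> real) \<Rightarrow> 'a::complex_inner bop \<Rightarrow> 'a bop" where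
  "cfc f A = (THE B. \<forall>p :: nat \<Rightarrow> real poly.
     uniform_limit {x. complex_of_real x \<in> spectrum A} (\<lambda>n. poly (p n)) f sequentially \<longrightarrow>
     (\<lambda>n. poly_bop (p n) A) \<longlonglongrightarrow> B)"

definition abs_bop :: "'a::chilbert_space bop \<Rightarrow> 'a bop" where
  "abs_bop X = cfc sqrt (adj X * X)"

definition commutator :: "'a::complex_inner bop \<Rightarrow> 'a bop \<Rightarrow> 'a bop" where
  "commutator A B = A * B - B * A"

definition phi_bop :: "(real \<Rightarrow> real) \<Rightarrow> (real \<Rightarrow> real) \<Rightarrow> 'a::chilbert_space bop \<Rightarrow> 'a bop" where
  "phi_bop \<phi>1 \<phi>2 X = cfc \<phi>1 (abs_bop X) - cfc \<phi>2 (abs_bop (adj X))"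

definition moduli_spectra_in :: "'a::chilbert_space bop \<Rightarrow> real set \<Rightarrow> bool" where
  "moduli_spectra_in X S \<longleftrightarrow>
     spectrum (abs_bop X) \<subseteq> complex_of_real ` S \<and>
     spectrum (abs_bop (adj X)) \<subseteq> complex_of_real ` S"


section \<open>Normed ideals\<close>

definition rank_one :: "'a::complex_inner bop \<Rightarrow> bool" where
  "rank_one X \<longleftrightarrow> (\<exists>u. u \<noteq> 0 \<and> range (bop_apply X) = complex_vector.span {u})"

text \<open>The ideal is a set \<open>J\<close> of operators with a norm \<open>N\<close> whose values outside of \<open>J\<close> are
  irrelevant.  The distance is set to \<open>0\<close> outside of \<open>J\<close> because \<^locale>\<open>Metric_space\<close> asks for
  nonnegativity and symmetry on the whole type.\<close>

definition ideal_dist :: "'a::complex_inner bop set \<Rightarrow> ('a bop \<Rightarrow> real) \<Rightarrow> 'a bop \<Rightarrow> 'a bop \<Rightarrow> real" where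
  "ideal_dist J N X Y = (if X \<in> J \<and> Y \<in> J then N (X - Y) else 0)"

abbreviation ideal_topology :: "'a::complex_inner bop set \<Rightarrow> ('a bop \<Rightarrow> real) \<Rightarrow> 'a bop topology" where
  "ideal_topology J N \<equiv> Metric_space.mtopology J (ideal_dist J N)"

locale normed_ideal =
  fixes J :: "'a::chilbert_space bop set" and N :: "'a bop \<Rightarrow> real"
  assumes subspace: "complex_vector.subspace J"
    and ideal: "X \<in> J \<Longrightarrow> Y * X * Z \<in> J"
    and norm_eq_0_iff: "X \<in> J \<Longrightarrow> N X = 0 \<longleftrightarrow> X = 0"
    and norm_triangle: "X \<in> J \<Longrightarrow> Y \<in> J \<Longrightarrow> N (X + Y) \<le> N X + N Y"
    and norm_scaleC: "X \<in> J \<Longrightarrow> N (c *\<^sub>C X) = cmod c * N X"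
    and complete: "Metric_space.mcomplete J (ideal_dist J N)"
    and rank_one: "rank_one X \<Longrightarrow> X \<in> J \<and> N X = norm X"
    and norm_ideal: "X \<in> J \<Longrightarrow> N (Y * X * Z) \<le> norm Y * N X * norm Z"
begin

lemma norm_nonneg: "X \<in> J \<Longrightarrow> 0 \<le> N X"
  using norm_triangle[of X "(- 1) *\<^sub>C X"] norm_scaleC[of X "- 1"] norm_scaleC[of X 0]
    complex_vector.subspace_scale[OF subspace, of X "- 1"]
  by (simp add: complex_vector.scale_minus_left)

sublocale Metric_space J "ideal_dist J N"
proof
  fix X Y Z
  have diff: "A - B \<in> J" if "A \<in> J" "B \<in> J" for A B
    using complex_vector.subspace_diff[OF subspace that] .
  show "0 \<le> ideal_dist J N X Y"
    by (simp add: ideal_dist_def norm_nonneg diff)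
  show "ideal_dist J N X Y = ideal_dist J N Y X"
    using norm_scaleC[OF diff, of X Y "- 1"]
    by (simp add: ideal_dist_def complex_vector.scale_minus_left)
  show "ideal_dist J N X Y = 0 \<longleftrightarrow> X = Y" if "X \<in> J" "Y \<in> J"
    using norm_eq_0_iff[OF diff] that by (simp add: ideal_dist_def)
  show "ideal_dist J N X Z \<le> ideal_dist J N X Y + ideal_dist J N Y Z"
    if "X \<in> J" "Y \<in> J" "Z \<in> J"
    using norm_triangle[OF diff diff, of X Y Y Z] that by (simp add: ideal_dist_def)
qed

end

definition ideal_lipschitz_on ::
  "'a::chilbert_space bop set \<Rightarrow> ('a bop \<Rightarrow> real) \<Rightarrow> real set \<Rightarrow> (real \<Rightarrow> real) \<Rightarrow> bool" where
  "ideal_lipschitz_on J N S f \<longleftrightarrow> continuous_on S f \<and>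
     (\<exists>C>0. \<forall>A B. selfadjoint A \<and> selfadjoint B \<and>
        spectrum A \<subseteq> complex_of_real ` S \<and> spectrum B \<subseteq> complex_of_real ` S \<and> A - B \<in> J \<longrightarrow>
        cfc f A - cfc f B \<in> J \<and> N (cfc f A - cfc f B) \<le> C * N (A - B))"

text \<open>\<open>C\<^sup>1([0,\<infinity>), J)\<close> for the norm \<open>N\<close>, with the one-sided derivative at \<open>0\<close>.\<close>

definition C1_ideal :: "'a::chilbert_space bop set \<Rightarrow> ('a bop \<Rightarrow> real) \<Rightarrow> (real \<Rightarrow> 'a bop) \<Rightarrow> bool" where
  "C1_ideal J N Y \<longleftrightarrow> (\<forall>t\<ge>0. Y t \<in> J) \<and>
     (\<exists>Y'. (\<forall>t\<ge>0. limitin (ideal_topology J N) (\<lambda>s. (Y s - Y t) /\<^sub>R (s - t)) (Y' t)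
                    (at t within {0..})) \<and>
           continuous_map (top_of_set {0..}) (ideal_topology J N) Y')"


section \<open>Orbits and the flow\<close>

definition similarity_orbit :: "'a::complex_inner bop \<Rightarrow> 'a bop set" where
  "similarity_orbit T = {g * T * inverse_bop g | g. invertible_bop g}"

definition ideal_similarity_orbit :: "'a::complex_inner bop set \<Rightarrow> 'a bop \<Rightarrow> 'a bop set" where
  "ideal_similarity_orbit J T = {g * T * inverse_bop g | g. invertible_bop g \<and> g - 1 \<in> J}"

definition flow_solution ::
  "(real \<Rightarrow> real) \<Rightarrow> (real \<Rightarrow> real) \<Rightarrow> real \<Rightarrow> real \<Rightarrow> 'a::chilbert_space bop \<Rightarrow> (real \<Rightarrow> 'a bop) \<Rightarrow> bool" where
  "flow_solution \<phi>1 \<phi>2 a b T X \<longleftrightarrow> X 0 = T \<and>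
     (\<forall>t\<ge>0. moduli_spectra_in (X t) {a..b} \<and>
       (X has_vector_derivative commutator (phi_bop \<phi>1 \<phi>2 (X t)) (X t)) (at t within {0..}))"

end

theory Submission
  imports Defs "HOL-Computational_Algebra.Fundamental_Theorem_Algebra"
begin

text \<open>Picard iteration is obstructed by the domain: the Lipschitz hypotheses speak only of
  operators with spectra in \<open>[a, b]\<close>, and an iterate has no reason to respect that
  constraint. An Euler step does, because of a cancellation. Each factor of the approximating
  product is controlled by its values at the end points m and M: \<open>1 + h \<phi>1(x)\<close> and
  \<open>1 + h \<phi>2(x)\<close> increase, and so does \<open>x (1 - h \<psi>(x))\<close> for small
  h. The bounds multiply, and at either end point the terms of order h cancel, since
  \<open>\<psi> = \<phi>1 + \<phi>2\<close>. With \<tau> / h steps of defect O(h^2) the total drift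
  is O(h). It must fit between the spectra of the moduli of T and the end points, which is why T
  lies strictly inside; for a = 0 the lower bound 0 costs nothing. The adjoint follows the flow of
  the swapped pair, so the same estimate serves it. Since T and 1 need not belong to J, everything
  is phrased in differences, on the affine spaces T + J and 1 + J. The Euler scheme carries an
  explicit time argument so that it also solves the linear equation for g.\<close>

text \<open>
  With \<open>\<psi> = \<phi>\<^sub>1 + \<phi>\<^sub>2\<close> the vector field is \<open>F(X) = \<phi>\<^sub>1(\<bar>X\<bar>) X + X \<phi>\<^sub>2(\<bar>X\<^sup>*\<bar>) - X \<psi>(\<bar>X\<bar>)\<close>, so that an Euler step
  \<open>X + h F(X)\<close> agrees up to \<open>O(h\<^sup>2)\<close> with \<open>(1 + h \<phi>\<^sub>1(\<bar>X\<bar>)) X (1 - h \<psi>(\<bar>X\<bar>)) (1 + h \<phi>\<^sub>2(\<bar>X\<^sup>*\<bar>))\<close>. Since \<open>\<phi>\<^sub>1\<close> and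
  \<open>\<phi>\<^sub>2\<close> increase, bounds \<open>m \<le> \<bar>X\<bar>, \<bar>X\<^sup>*\<bar> \<le> M\<close> deteriorate by \<open>O(h\<^sup>2)\<close> only; over a bounded time interval the
  Euler polygons therefore stay in \<open>[a, b]\<close> once the step is small.
  On \<open>T + J\<close> the field is Lipschitz for the norm of \<open>J\<close>: for \<open>a > 0\<close> because \<open>\<bar>X\<bar>\<close> depends on \<open>X\<^sup>* X\<close> in a
  \<open>J\<close>-Lipschitz way (a Sylvester equation), for \<open>a = 0\<close> by applying the hypothesis on \<open>f(\<bar>x\<bar>)\<close> to the
  self-adjoint operator matrix with off-diagonal entries \<open>X\<close> and \<open>X\<^sup>*\<close>, which acts on \<open>H \<oplus> H\<close> inside \<open>H\<close>.
  Hence the Euler scheme converges in the norm of \<open>J\<close> to a global solution, which is unique by a Gronwall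
  argument. Finally \<open>X' = [A, X]\<close> with \<open>A = \<phi>(X)\<close> is a Lax pair: if \<open>g' = A g\<close> and \<open>g(0) = 1\<close>, then
  \<open>X = g T g\<^sup>-\<^sup>1\<close>, and \<open>g - 1\<close> lies in \<open>J\<close> when \<open>A\<close> does.
\<close>


section \<open>Complex inner product spaces\<close>

lemma cinner_add_left: "cinner (x + y) z = cinner x z + cinner y (z::'a::complex_inner)"
  by (subst (1 2 3) cinner_commute) (simp add: cinner_add_right)

lemma cinner_scaleC_left: "cinner (c *\<^sub>C x) y = cnj c * cinner x (y::'a::complex_inner)"
  by (subst (1 2) cinner_commute) (simp add: cinner_scaleC_right)

lemma cinner_self: "cinner x x = complex_of_real ((norm (x::'a::complex_inner))\<^sup>2)"
proof -
  have "Im (cinner x x) = 0"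
    using cinner_commute[of x x] by (metis cnj.simps(2) equal_neg_zero)
  then show ?thesis
    by (simp add: complex_eq_iff norm_eq_sqrt_cinner cinner_self_nonneg)
qed

lemma norm_add_sq:
  "(norm (x + y))\<^sup>2 = (norm x)\<^sup>2 + (norm y)\<^sup>2 + 2 * Re (cinner x (y::'a::complex_inner))"
proof -
  have "complex_of_real ((norm (x + y))\<^sup>2) =
      cinner x x + cinner y y + (cinner x y + cnj (cinner x y))"
    by (simp only: cinner_self[symmetric] cinner_add_left cinner_add_right
        cinner_commute[of y x, symmetric]) (simp add: cinner_commute[of y x])
  then have "Re (complex_of_real ((norm (x + y))\<^sup>2)) =
      Re (cinner x x + cinner y y + (cinner x y + cnj (cinner x y)))"
    by simp
  then show ?thesis by (simp add: cinner_self)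
qed

lemma norm_cinner_le: "cmod (cinner x y) \<le> norm x * norm (y::'a::complex_inner)"
proof (cases "y = 0")
  case True
  then show ?thesis using cinner_scaleC_right[of x 0 0] by simp
next
  case False
  \<comment> \<open>With this \<open>c\<close>, the vector \<open>x + c *\<^sub>C y\<close> is the
    component of x orthogonal to y.\<close>
  define c where "c = - cinner y x / (norm y)\<^sup>2"
  have sq: "cnj z * z = complex_of_real ((cmod z)\<^sup>2)" for z
    by (metis complex_norm_square mult.commute)
  have "0 \<le> (norm (x + c *\<^sub>C y))\<^sup>2" by simp
  also have "\<dots> = (norm x)\<^sup>2 + (cmod c * norm y)\<^sup>2 + 2 * Re (c * cinner x y)"
    by (simp add: norm_add_sq norm_scaleC cinner_scaleC_right)
  also have "c * cinner x y = - complex_of_real ((cmod (cinner x y))\<^sup>2 / (norm y)\<^sup>2)"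
    unfolding c_def cinner_commute[of y x] by (simp add: sq del: of_real_power)
  also have "cmod c * norm y = cmod (cinner x y) / norm y"
    unfolding c_def cinner_commute[of y x] using False
    by (simp add: norm_divide power2_eq_square norm_mult)
  finally have "(cmod (cinner x y))\<^sup>2 / (norm y)\<^sup>2 \<le> (norm x)\<^sup>2"
    by (simp add: power_divide)
  then have "(cmod (cinner x y))\<^sup>2 \<le> (norm x * norm y)\<^sup>2"
    using False by (simp add: field_simps power_mult_distrib)
  then show ?thesis by (rule power2_le_imp_le) simp
qed

global_interpretation cinner: bounded_bilinear "cinner :: 'a::complex_inner \<Rightarrow> 'a \<Rightarrow> complex"
proof
  fix x y z :: 'a and r :: real
  show "cinner (x + y) z = cinner x z + cinner y z" by (rule cinner_add_left)
  show "cinner x (y + z) = cinner x y + cinner x z" by (rule cinner_add_right)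
  show "cinner (r *\<^sub>R x) y = r *\<^sub>R cinner x y"
    by (metis cinner_scaleC_left complex_cnj_complex_of_real scaleC_of_real scaleR_conv_of_real)
  show "cinner x (r *\<^sub>R y) = r *\<^sub>R cinner x y"
    by (metis cinner_scaleC_right scaleC_of_real scaleR_conv_of_real)
  show "\<exists>K. \<forall>a b. norm (cinner (a::'a) b) \<le> norm a * norm b * K"
    by (rule exI[of _ 1]) (simp add: norm_cinner_le)
qed

lemma norm_diff_sq:
  "(norm (x - y))\<^sup>2 = (norm x)\<^sup>2 + (norm y)\<^sup>2 - 2 * Re (cinner x (y::'a::complex_inner))"
  using norm_add_sq[of x "- y"] by (simp add: cinner.minus_right)

lemma cinner_eqI:
  fixes x y :: "'a::complex_inner"
  assumes "\<And>z. cinner z x = cinner z y"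
  shows "x = y"
proof -
  have "cinner (x - y) (x - y) = 0"
    using assms[of "x - y"] by (simp add: cinner.diff_right)
  then show ?thesis by (simp add: cinner_self)
qed

lemma cinner_eqI_left:
  fixes x y :: "'a::complex_inner"
  assumes "\<And>z. cinner x z = cinner y z"
  shows "x = y"
proof (rule cinner_eqI)
  show "cinner z x = cinner z y" for z
    using assms[of z] by (simp add: cinner_commute[of z])
qed

text \<open>The representing vector minimises \<open>\<parallel>x\<parallel>\<^sup>2 - 2 Re (\<phi> x)\<close> on \<open>S\<close>.\<close>

lemma riesz_on_subspace:
  fixes S :: "'a::chilbert_space set" and \<phi> :: "'a \<Rightarrow> complex"
  assumes S: "complex_vector.subspace S" "closed S"
    and \<phi>: "bounded_linear \<phi>" and \<phi>c: "\<And>c x. \<phi> (c *\<^sub>C x) = c * \<phi> x"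
  shows "\<exists>y\<in>S. \<forall>v\<in>S. cinner y v = \<phi> v"
proof -
  interpret \<phi>: bounded_linear \<phi> by (rule \<phi>)
  obtain K where K: "\<And>x. cmod (\<phi> x) \<le> norm x * K" using \<phi>.bounded by blast
  define Q where "Q x = (norm x)\<^sup>2 - 2 * Re (\<phi> x)" for x
  have Q_bound: "- K\<^sup>2 \<le> Q x" for x
  proof -
    have "0 \<le> (norm x - K)\<^sup>2" by simp
    also have "\<dots> = (norm x)\<^sup>2 - 2 * (norm x * K) + K\<^sup>2"
      by (simp add: power2_eq_square algebra_simps)
    also have "\<dots> \<le> (norm x)\<^sup>2 - 2 * Re (\<phi> x) + K\<^sup>2"
      using K[of x] complex_Re_le_cmod[of "\<phi> x"] by linarith
    finally show ?thesis by (simp add: Q_def)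
  qed
  have sub_scaleR: "r *\<^sub>R x \<in> S" if "x \<in> S" for r x
    using complex_vector.subspace_scale[OF S(1) that, of "complex_of_real r"]
    by (simp add: scaleC_of_real)
  have sub_add: "x + y \<in> S" if "x \<in> S" "y \<in> S" for x y
    using complex_vector.subspace_add[OF S(1) that] .
  define I where "I = Inf (Q ` S)"
  have bdd: "bdd_below (Q ` S)" using Q_bound by (auto intro!: bdd_belowI)
  have ne: "S \<noteq> {}" using complex_vector.subspace_0[OF S(1)] by blast
  have I_le: "I \<le> Q x" if "x \<in> S" for x
    unfolding I_def using bdd that by (simp add: cInf_lower)
  have "\<exists>x\<in>S. Q x < I + inverse (Suc n)" for n
    using cInf_lessD[of "Q ` S" "I + inverse (Suc n)"] ne by (auto simp: I_def)
  then obtain x where xS: "\<And>n. x n \<in> S" and xQ: "\<And>n. Q (x n) < I + inverse (Suc n)"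
    by metis
  \<comment> \<open>The parallelogram identity, with the midpoint of u and v as competitor for the
    infimum \<open>I\<close>, makes every minimising sequence Cauchy.\<close>
  have par: "(norm (u - v))\<^sup>2 \<le> 2 * (Q u - I) + 2 * (Q v - I)" if "u \<in> S" "v \<in> S" for u v
  proof -
    have "I \<le> Q ((1/2) *\<^sub>R (u + v))" by (intro I_le sub_scaleR sub_add that)
    moreover have "4 * Q ((1/2) *\<^sub>R (u + v)) = (norm (u + v))\<^sup>2 - 4 * Re (\<phi> u) - 4 * Re (\<phi> v)"
      by (simp add: Q_def power_mult_distrib power_divide \<phi>.scaleR \<phi>.add algebra_simps
          del: scaleR_add_right)
    ultimately show ?thesis
      using norm_add_sq[of u v] norm_diff_sq[of u v] by (simp add: Q_def)
  qed
  have "Cauchy x"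
  proof (rule CauchyI)
    fix e :: real assume e: "0 < e"
    obtain M where M: "inverse (Suc M) < e\<^sup>2 / 4" using reals_Archimedean[of "e\<^sup>2/4"] e by auto
    define i where "i k = inverse (real (Suc k))" for k
    show "\<exists>M. \<forall>m\<ge>M. \<forall>n\<ge>M. norm (x m - x n) < e"
    proof (intro exI allI impI)
      fix m n assume mn: "M \<le> m" "M \<le> n"
      have inv: "inverse (real (Suc k)) \<le> inverse (Suc M)" if "M \<le> k" for k
        using that by (simp add: field_simps)
      have "(norm (x m - x n))\<^sup>2 < 4 * i M"
        using par[OF xS xS, of m n] xQ[of m] xQ[of n] inv[OF mn(1)] inv[OF mn(2)]
        unfolding i_def[symmetric] by (smt (verit))
      also have "\<dots> < e\<^sup>2" using M unfolding i_def by simp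
      finally have "(norm (x m - x n))\<^sup>2 < e\<^sup>2" .
      then show "norm (x m - x n) < e" using e by (simp add: power_less_imp_less_base)
    qed
  qed
  then obtain y where y: "x \<longlonglongrightarrow> y" unfolding Cauchy_convergent_iff convergent_def by blast
  have yS: "y \<in> S" using S(2) xS y closed_sequentially by blast
  have Qlim: "(\<lambda>n. Q (x n)) \<longlonglongrightarrow> Q y"
    unfolding Q_def by (intro tendsto_intros y \<phi>.tendsto)
  have lim2: "(\<lambda>n. I + inverse (real (Suc n))) \<longlonglongrightarrow> I + 0"
    by (intro tendsto_intros LIMSEQ_inverse_real_of_nat)
  have "Q y \<le> I"
    using LIMSEQ_le[OF Qlim lim2] xQ less_imp_le by auto
  then have Qmin: "Q y \<le> Q v" if "v \<in> S" for v using I_le[OF that] by linarith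
  have Re_eq: "Re (cinner y v) = Re (\<phi> v)" if v: "v \<in> S" for v
  proof -
    \<comment> \<open>\<open>2 * d\<close> is the derivative of \<open>Q\<close> at the minimiser y
      in the direction v, so it has to vanish.\<close>
    define d where "d = Re (cinner y v) - Re (\<phi> v)"
    have ineq: "0 \<le> 2 * t * d + t\<^sup>2 * (norm v)\<^sup>2" for t
    proof -
      have "Q y \<le> Q (y + t *\<^sub>R v)" by (intro Qmin sub_add sub_scaleR v yS)
      then show ?thesis
        by (simp add: Q_def norm_add_sq \<phi>.add \<phi>.scaleR cinner.scaleR_right d_def
            power_mult_distrib algebra_simps)
    qed
    show ?thesis
    proof (cases "v = 0")
      case True then show ?thesis by (simp add: cinner.zero_right \<phi>.zero)
    next
      case False
      have "0 \<le> - (d\<^sup>2 / (norm v)\<^sup>2)"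
        \<comment> \<open>This value of t minimises the quadratic and leaves
          \<open>- d^2 / (norm v)^2\<close>.\<close>
        using ineq[of "- d / (norm v)\<^sup>2"] False
        by (simp add: power2_eq_square field_simps)
      then have "d\<^sup>2 / (norm v)\<^sup>2 = 0"
        by (smt (verit) divide_nonneg_nonneg zero_le_power2)
      then have "d = 0" using False by simp
      then show ?thesis by (simp add: d_def)
    qed
  qed
  have "cinner y v = \<phi> v" if v: "v \<in> S" for v
  proof (rule complex_eqI)
    show "Re (cinner y v) = Re (\<phi> v)" by (rule Re_eq[OF v])
    \<comment> \<open>Multiplication by \<open>- \<i>\<close> turns imaginary parts into real
      parts.\<close>
    have "Re (cinner y ((- \<i>) *\<^sub>C v)) = Re (\<phi> ((- \<i>) *\<^sub>C v))"
      by (rule Re_eq) (rule complex_vector.subspace_scale[OF S(1) v])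
    then show "Im (cinner y v) = Im (\<phi> v)" unfolding cinner_scaleC_right \<phi>c by simp
  qed
  with yS show ?thesis by blast
qed


section \<open>Bounded operators and their adjoints\<close>

lemma bop_apply_add: "bop_apply A (x + y) = bop_apply A x + bop_apply A y"
  by transfer (rule blinfun.add_right)

lemma bop_apply_scaleC_right: "bop_apply A (c *\<^sub>C x) = c *\<^sub>C bop_apply A x"
  by transfer simp

lemma bop_apply_scaleR_right: "bop_apply A (r *\<^sub>R x) = r *\<^sub>R bop_apply A x"
  by transfer (rule blinfun.scaleR_right)

lemma norm_bop_apply: "norm (bop_apply A x) \<le> norm A * norm x"
  by transfer (rule norm_blinfun)

lemma norm_bop_le: "0 \<le> K \<Longrightarrow> (\<And>x. norm (bop_apply A x) \<le> K * norm x) \<Longrightarrow> norm A \<le> K"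
  by transfer (rule norm_blinfun_bound)

lemma bop_apply_mult: "bop_apply (A * B) x = bop_apply A (bop_apply B x)"
  by transfer simp

lemma bop_apply_one: "bop_apply 1 x = x"
  by transfer simp

global_interpretation bop_apply: bounded_bilinear "bop_apply :: 'a::complex_inner bop \<Rightarrow> 'a \<Rightarrow> 'a"
  by standard (simp_all add: bop_apply_plus bop_apply_scaleR bop_apply_add bop_apply_scaleR_right,
      rule exI[of _ 1], simp add: norm_bop_apply)

lemmas bop_apply_simps = bop_apply_mult bop_apply_one bop_apply.zero_left bop_apply.zero_right
  bop_apply.add_left bop_apply.add_right bop_apply.diff_left bop_apply.diff_right
  bop_apply.minus_left bop_apply.minus_right bop_apply.scaleR_left bop_apply.scaleR_right
  bop_apply_scaleC bop_apply_scaleC_right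

lemma bop_exists:
  fixes f :: "'a::complex_inner \<Rightarrow> 'a"
  assumes "\<And>x y. f (x + y) = f x + f y" "\<And>c x. f (c *\<^sub>C x) = c *\<^sub>C f x"
    and "\<And>x. norm (f x) \<le> K * norm x"
  obtains A :: "'a bop" where "\<And>x. bop_apply A x = f x"
proof -
  have "bounded_linear f"
    by (rule bounded_linear_intro[where K = K])
      (use assms in \<open>auto simp: mult.commute simp flip: scaleC_of_real\<close>)
  then have *: "blinfun_apply (Blinfun f) = f" by (rule bounded_linear_Blinfun_apply)
  show thesis
    by (rule that[of "Abs_bop (Blinfun f)"])
      (subst bop_apply.rep_eq, subst Abs_bop_inverse, auto simp: * assms(2))
qed

lemma scaleC_mult_left: "(c *\<^sub>C A) * B = c *\<^sub>C (A * (B::'a::complex_inner bop))"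
  by (rule bop_eqI) (simp add: bop_apply_simps)

lemma scaleC_mult_right: "A * (c *\<^sub>C B) = c *\<^sub>C (A * (B::'a::complex_inner bop))"
  by (rule bop_eqI) (simp add: bop_apply_simps)

lemma norm_bop_scaleC: "norm (c *\<^sub>C A) = cmod c * norm (A::'a::complex_inner bop)"
proof -
  have *: "norm (c *\<^sub>C A) \<le> cmod c * norm A" for c :: complex and A :: "'a bop"
    by (rule norm_bop_le)
      (simp_all add: bop_apply_simps norm_scaleC norm_bop_apply mult.assoc mult_left_mono)
  show ?thesis
  proof (cases "c = 0")
    case True then show ?thesis by simp
  next
    case False
    have "norm A = norm (inverse c *\<^sub>C c *\<^sub>C A)" using False by (simp add: scaleC_scaleC)
    also have "\<dots> \<le> inverse (cmod c) * norm (c *\<^sub>C A)"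
      using *[of "inverse c" "c *\<^sub>C A"] by (simp add: norm_inverse)
    finally show ?thesis using *[of c A] False by (simp add: field_simps)
  qed
qed

text \<open>Riesz representation on the whole space, applied to the functional y \<mapsto>
  \<open>cinner x (bop_apply A y)\<close> for each x. The norm bound comes for free here and later
  yields that \<open>adj\<close> is isometric.\<close>

lemma adj_exists:
  fixes A :: "'a::chilbert_space bop"
  shows "\<exists>B :: 'a bop. (\<forall>x y. cinner (bop_apply B x) y = cinner x (bop_apply A y)) \<and> norm B \<le> norm A"
proof -
  have "\<exists>z. \<forall>y. cinner z y = cinner x (bop_apply A y)" for x
  proof -
    have "bounded_linear (\<lambda>y. cinner x (bop_apply A y))"
      by (rule bounded_linear_compose[OF cinner.bounded_linear_right bop_apply.bounded_linear_right])
    from riesz_on_subspace[OF complex_vector.subspace_UNIV closed_UNIV this]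
    show ?thesis by (simp add: bop_apply_scaleC_right cinner_scaleC_right)
  qed
  then obtain f where f: "\<And>x y. cinner (f x) y = cinner x (bop_apply A y)" by metis
  have bound: "norm (f x) \<le> norm A * norm x" for x
  proof -
    have "(norm (f x))\<^sup>2 = cmod (cinner x (bop_apply A (f x)))"
      by (simp add: cinner_self norm_power flip: f)
    also have "\<dots> \<le> norm x * (norm A * norm (f x))"
      by (meson norm_cinner_le norm_bop_apply mult_left_mono norm_ge_zero order_trans)
    finally show ?thesis
      by (cases "f x = 0") (simp_all add: power2_eq_square mult.assoc mult.left_commute mult.commute)
  qed
  have "f (x + y) = f x + f y" "f (c *\<^sub>C x) = c *\<^sub>C f x" for x y c
    by (rule cinner_eqI_left, simp add: f cinner.add_left cinner_scaleC_left)+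
  then obtain B where B: "\<And>x. bop_apply B x = f x"
    using bop_exists[of f] bound by blast
  show ?thesis
    by (rule exI[of _ B]) (simp add: B f norm_bop_le bound)
qed

lemma cinner_adj_left: "cinner (bop_apply (adj A) x) y = cinner x (bop_apply A y)"
proof -
  obtain B where B: "\<And>x y. cinner (bop_apply B x) y = cinner x (bop_apply A y)"
    using adj_exists[of A] by metis
  have "adj A = B" unfolding adj_def
  proof (rule the_equality)
    show "C = B" if "\<forall>x y. cinner (bop_apply C x) y = cinner x (bop_apply A y)" for C
      using that B by (intro bop_eqI cinner_eqI_left) simp
  qed (simp add: B)
  then show ?thesis by (simp add: B)
qed

lemma cinner_adj_right: "cinner x (bop_apply (adj A) y) = cinner (bop_apply A x) y"
  by (metis cinner_adj_left cinner_commute)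

lemma adj_eqI: "(\<And>x y. cinner (bop_apply B x) y = cinner x (bop_apply A y)) \<Longrightarrow> adj A = B"
  by (intro bop_eqI cinner_eqI_left) (simp add: cinner_adj_left)

lemma norm_adj_le: "norm (adj A) \<le> norm A"
proof -
  obtain B where "\<And>x y. cinner (bop_apply B x) y = cinner x (bop_apply A y)" "norm B \<le> norm A"
    using adj_exists[of A] by metis
  then show ?thesis using adj_eqI[of B A] by simp
qed

lemma adj_adj [simp]: "adj (adj A) = A"
  by (rule adj_eqI) (simp add: cinner_adj_right)

lemma norm_adj [simp]: "norm (adj A) = norm A"
  by (metis adj_adj norm_adj_le order_antisym)

lemma adj_mult: "adj (A * B) = adj B * adj A"
  by (rule adj_eqI) (simp add: bop_apply_mult cinner_adj_left)

lemma adj_add: "adj (A + B) = adj A + adj B"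
  by (rule adj_eqI) (simp add: bop_apply_simps cinner_adj_left cinner.add_left cinner.add_right)

lemma adj_diff: "adj (A - B) = adj A - adj B"
  by (rule adj_eqI) (simp add: bop_apply_simps cinner_adj_left cinner.diff_left cinner.diff_right)

lemma adj_minus: "adj (- A) = - adj A"
  by (rule adj_eqI) (simp add: bop_apply_simps cinner_adj_left cinner.minus_left cinner.minus_right)

lemma adj_scaleR: "adj (r *\<^sub>R A) = r *\<^sub>R adj A"
  by (rule adj_eqI) (simp add: bop_apply_simps cinner_adj_left cinner.scaleR_left cinner.scaleR_right)

lemma adj_scaleC: "adj (c *\<^sub>C A) = cnj c *\<^sub>C adj A"
  by (rule adj_eqI) (simp add: bop_apply_simps cinner_adj_left cinner_scaleC_left cinner_scaleC_right)

lemma adj_one [simp]: "adj 1 = 1"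
  by (rule adj_eqI) (simp add: bop_apply_one)

lemma adj_zero [simp]: "adj 0 = 0"
  by (rule adj_eqI) (simp add: bop_apply_simps cinner.zero_left cinner.zero_right)

lemma bounded_linear_adj: "bounded_linear (adj :: 'a::chilbert_space bop \<Rightarrow> 'a bop)"
  by (rule bounded_linear_intro[where K = 1]) (simp_all add: adj_add adj_scaleR)

section \<open>Completeness of the operator algebra\<close>

instance chilbert_space \<subseteq> banach ..

text \<open>The limit is taken among real-linear bounded maps, where completeness is known; complex
  linearity is a pointwise condition and survives it.\<close>

lemma bop_Cauchy_convergent:
  fixes X :: "nat \<Rightarrow> 'a::chilbert_space bop"
  assumes X: "Cauchy X"
  shows "convergent X"
proof -
  have "dist (Rep_bop (X m)) (Rep_bop (X n)) = dist (X m) (X n)" for m n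
    by (simp only: dist_norm norm_bop.rep_eq minus_bop.rep_eq)
  then have "Cauchy (\<lambda>n. Rep_bop (X n))"
    using X by (simp only: Cauchy_def)
  then obtain L where L: "(\<lambda>n. Rep_bop (X n)) \<longlonglongrightarrow> L"
    by (meson Cauchy_convergent convergent_def)
  have lim: "(\<lambda>n. blinfun_apply (Rep_bop (X n)) x) \<longlonglongrightarrow> blinfun_apply L x" for x
    by (rule blinfun.tendsto[OF L tendsto_const])
  have "blinfun_apply L (c *\<^sub>C x) = c *\<^sub>C blinfun_apply L x" for c x
  proof (rule LIMSEQ_unique)
    show "(\<lambda>n. blinfun_apply (Rep_bop (X n)) (c *\<^sub>C x)) \<longlonglongrightarrow> blinfun_apply L (c *\<^sub>C x)"
      by (rule lim)
    have "(\<lambda>n. c *\<^sub>C blinfun_apply (Rep_bop (X n)) x) \<longlonglongrightarrow> c *\<^sub>C blinfun_apply L x"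
      by (rule bounded_linear.tendsto[OF bounded_linear_scaleC lim])
    moreover have "blinfun_apply (Rep_bop (X n)) (c *\<^sub>C x) = c *\<^sub>C blinfun_apply (Rep_bop (X n)) x" for n
      using Rep_bop[of "X n"] by blast
    ultimately show "(\<lambda>n. blinfun_apply (Rep_bop (X n)) (c *\<^sub>C x)) \<longlonglongrightarrow> c *\<^sub>C blinfun_apply L x"
      by simp
  qed
  then have rep: "Rep_bop (Abs_bop L) = L" by (simp add: Abs_bop_inverse)
  have "dist (X n) (Abs_bop L) = dist (Rep_bop (X n)) L" for n
    by (simp only: dist_norm norm_bop.rep_eq minus_bop.rep_eq rep)
  then have "X \<longlonglongrightarrow> Abs_bop L"
    using L by (simp only: tendsto_iff)
  then show ?thesis by (auto simp: convergent_def)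
qed

instance bop :: (chilbert_space) complete_space
  by standard (rule bop_Cauchy_convergent)

instance bop :: (chilbert_space) banach ..


section \<open>Invertibility and the spectrum of self-adjoint operators\<close>

lemma invertible_bop_inverse:
  assumes "invertible_bop A"
  shows "A * inverse_bop A = 1" "inverse_bop A * A = 1"
proof -
  obtain B where B: "A * B = 1" "B * A = 1" using assms by (auto simp: invertible_bop_def)
  have "inverse_bop A = B" unfolding inverse_bop_def
  proof (rule the_equality)
    show "C = B" if "A * C = 1 \<and> C * A = 1" for C
      by (metis B that mult.assoc mult_1_left mult_1_right)
  qed (simp add: B)
  then show "A * inverse_bop A = 1" "inverse_bop A * A = 1" using B by auto
qed

lemma inverse_bop_eqI: "A * B = 1 \<Longrightarrow> B * A = 1 \<Longrightarrow> inverse_bop A = B"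
  by (metis invertible_bop_inverse(1) invertible_bop_def mult.assoc mult_1_left mult_1_right)

lemma invertible_bopI: "A * B = 1 \<Longrightarrow> C * A = 1 \<Longrightarrow> invertible_bop A"
  unfolding invertible_bop_def by (metis mult.assoc mult_1_left mult_1_right)

lemma invertible_bop_mult: "invertible_bop A \<Longrightarrow> invertible_bop B \<Longrightarrow> invertible_bop (A * B)"
  unfolding invertible_bop_def by (metis mult.assoc mult_1_left)

lemma invertible_bop_scaleC:
  assumes "invertible_bop A" "c \<noteq> 0"
  shows "invertible_bop (c *\<^sub>C A)"
  by (rule invertible_bopI[of _ "inverse c *\<^sub>C inverse_bop A" "inverse c *\<^sub>C inverse_bop A"])
    (use assms in \<open>simp_all add: scaleC_mult_left scaleC_mult_right scaleC_scaleC invertible_bop_inverse\<close>)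

text \<open>Neumann series: the inverse is the geometric series in \<open>1 - A\<close>.\<close>

lemma invertible_bop_Neumann:
  fixes A :: "'h::separable_infinite_dim_chilbert_space bop"
  assumes "norm (1 - A) < 1"
  shows "invertible_bop A"
proof -
  define X where "X = 1 - A"
  have sum: "summable (\<lambda>n. X ^ n)"
    using assms by (intro complete_algebra_summable_geometric) (simp add: X_def)
  let ?S = "\<Sum>n. X ^ n"
  have split: "(\<Sum>n. X ^ Suc n) = ?S - 1"
    using suminf_split_head[OF sum] by simp
  have 1: "X * ?S = ?S - 1"
    unfolding split[symmetric] power_Suc by (rule suminf_mult[OF sum, symmetric])
  have 2: "?S * X = ?S - 1"
    unfolding split[symmetric] power_Suc2 by (rule suminf_mult2[OF sum])
  have A: "A = 1 - X" by (simp add: X_def)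
  show ?thesis
    by (rule invertible_bopI[of _ ?S ?S]) (simp_all add: A left_diff_distrib right_diff_distrib 1 2)
qed

lemma spectrum_norm:
  fixes A :: "'h::separable_infinite_dim_chilbert_space bop"
  assumes "z \<in> spectrum A"
  shows "cmod z \<le> norm A"
proof (rule ccontr)
  assume "\<not> ?thesis"
  then have lt: "norm A < cmod z" by simp
  then have z: "z \<noteq> 0" by (metis norm_ge_zero norm_zero not_le)
  have eq: "A - z *\<^sub>C 1 = (- z) *\<^sub>C (1 - inverse z *\<^sub>C A)"
    using z by (simp add: complex_vector.scale_right_diff_distrib scaleC_scaleC
        complex_vector.scale_minus_left)
  have "norm (1 - (1 - inverse z *\<^sub>C A)) < 1"
    using lt z by (simp add: norm_bop_scaleC norm_inverse inverse_eq_divide norm_divide)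
  then have "invertible_bop (A - z *\<^sub>C 1)"
    unfolding eq using z by (intro invertible_bop_scaleC invertible_bop_Neumann) auto
  then show False using assms by (simp add: spectrum_def)
qed

lemma spectrum_shift: "z \<in> spectrum (A - r *\<^sub>R 1) \<longleftrightarrow> z + of_real r \<in> spectrum A"
  by (simp add: spectrum_def scaleC_add_left scaleC_of_real algebra_simps)

text \<open>Expanding the square shows that \<open>1 - s *\<^sub>R (adj B * B)\<close> is a strict
  contraction for small s > 0, so the Neumann series inverts a positive multiple of
  \<open>adj B * B\<close>.\<close>

lemma invertible_adj_mult_self:
  fixes B :: "'h::separable_infinite_dim_chilbert_space bop"
  assumes c: "0 < c" "\<And>x. c * norm x \<le> norm (bop_apply B x)"
  shows "invertible_bop (adj B * B)"
proof -
  \<comment> \<open>With \<open>s * (norm B)^2 \<le> 1\<close>, half of the cross term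
    \<open>- 2 * s * ?b\<close> absorbs the quadratic term. The summand 1 avoids a zero
    denominator.\<close>
  define s where "s = 1 / ((norm B)\<^sup>2 + 1)"
  have s: "0 < s" "s * (norm B)\<^sup>2 \<le> 1"
    by (auto simp: s_def field_simps add_pos_nonneg intro: add_nonneg_pos)
  let ?P = "adj B * B"
  have "norm (1 - s *\<^sub>R ?P) \<le> sqrt (max 0 (1 - s * c\<^sup>2))"
  proof (rule norm_bop_le)
    fix x
    let ?b = "(norm (bop_apply B x))\<^sup>2"
    have "norm (bop_apply ?P x) \<le> norm B * norm (bop_apply B x)"
      using norm_bop_apply[of "adj B" "bop_apply B x"] by (simp add: bop_apply_mult)
    then have P: "(norm (bop_apply ?P x))\<^sup>2 \<le> (norm B)\<^sup>2 * ?b"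
      by (metis norm_ge_zero power_mono power_mult_distrib)
    have "(norm (bop_apply (1 - s *\<^sub>R ?P) x))\<^sup>2 =
        (norm x)\<^sup>2 + s\<^sup>2 * (norm (bop_apply ?P x))\<^sup>2 - 2 * s * ?b"
      by (simp add: bop_apply_simps norm_diff_sq cinner.scaleR_right cinner_adj_right cinner_self
          power_mult_distrib del: of_real_power)
    also have "s\<^sup>2 * (norm (bop_apply ?P x))\<^sup>2 \<le> s\<^sup>2 * ((norm B)\<^sup>2 * ?b)"
      by (rule mult_left_mono[OF P]) simp
    also have "\<dots> = (s * (norm B)\<^sup>2) * (s * ?b)" by (simp add: power2_eq_square)
    also have "\<dots> \<le> 1 * (s * ?b)" using s by (intro mult_right_mono) auto
    finally have 1: "(norm (bop_apply (1 - s *\<^sub>R ?P) x))\<^sup>2 \<le> (norm x)\<^sup>2 - s * ?b" by simp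
    have "s * (c * norm x)\<^sup>2 \<le> s * ?b"
      using c s by (intro mult_left_mono power_mono) auto
    with 1 have "(norm (bop_apply (1 - s *\<^sub>R ?P) x))\<^sup>2 \<le> (1 - s * c\<^sup>2) * (norm x)\<^sup>2"
      by (simp add: power_mult_distrib algebra_simps)
    also have "\<dots> \<le> max 0 (1 - s * c\<^sup>2) * (norm x)\<^sup>2"
      by (intro mult_right_mono) auto
    finally have "(norm (bop_apply (1 - s *\<^sub>R ?P) x))\<^sup>2 \<le> (sqrt (max 0 (1 - s * c\<^sup>2)) * norm x)\<^sup>2"
      by (simp add: power_mult_distrib)
    then show "norm (bop_apply (1 - s *\<^sub>R ?P) x) \<le> sqrt (max 0 (1 - s * c\<^sup>2)) * norm x"
      by (rule power2_le_imp_le) simp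
  qed simp
  also have "\<dots> < 1" using c s by simp
  finally have "invertible_bop (s *\<^sub>R ?P)" by (rule invertible_bop_Neumann)
  then have "invertible_bop (of_real (inverse s) *\<^sub>C (s *\<^sub>R ?P))"
    using s by (intro invertible_bop_scaleC) auto
  then show ?thesis using s by (simp only: scaleC_of_real) simp
qed

text \<open>Invertibility of \<open>adj B * B\<close> gives a left inverse of B, that of
  \<open>B * adj B\<close> a right inverse.\<close>

lemma invertible_bop_bounded_below:
  fixes B :: "'h::separable_infinite_dim_chilbert_space bop"
  assumes c: "0 < c" "\<And>x. c * norm x \<le> norm (bop_apply B x)"
    and "\<And>x. c * norm x \<le> norm (bop_apply (adj B) x)"
  shows "invertible_bop B"
proof -
  have "invertible_bop (adj B * B)" "invertible_bop (adj (adj B) * adj B)"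
    using assms by (intro invertible_adj_mult_self[of c]; simp)+
  then obtain P Q where "P * (adj B * B) = 1" "(B * adj B) * Q = 1"
    unfolding invertible_bop_def by auto
  then show ?thesis by (intro invertible_bopI[of _ "adj B * Q" "P * adj B"]) (simp_all add: mult.assoc)
qed

lemma selfadjoint_cinner: "selfadjoint A \<Longrightarrow> cinner (bop_apply A x) y = cinner x (bop_apply A y)"
  by (metis cinner_adj_left selfadjoint_def)

lemma selfadjoint_simps:
  "selfadjoint 1" "selfadjoint 0" "selfadjoint A \<Longrightarrow> selfadjoint (r *\<^sub>R A)"
  "selfadjoint A \<Longrightarrow> selfadjoint B \<Longrightarrow> selfadjoint (A + B)"
  "selfadjoint A \<Longrightarrow> selfadjoint B \<Longrightarrow> selfadjoint (A - B)"
  "selfadjoint (adj X * X)"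
  by (simp_all add: selfadjoint_def adj_scaleR adj_add adj_diff adj_mult)

text \<open>For w = u + i v the cross term in the square of \<open>norm ((A - u) x - i v x)\<close>
  vanishes because A is self-adjoint. Hence A - z and its adjoint are both bounded below by
  \<open>\<bar>Im z\<bar>\<close>.\<close>

lemma selfadjoint_spectrum_real:
  fixes A :: "'h::separable_infinite_dim_chilbert_space bop"
  assumes A: "selfadjoint A" and z: "z \<in> spectrum A"
  shows "z = of_real (Re z)"
proof (rule ccontr)
  assume "\<not> ?thesis"
  then have im: "Im z \<noteq> 0" by (simp add: complex_eq_iff)
  have below: "\<bar>Im w\<bar> * norm x \<le> norm (bop_apply (A - w *\<^sub>C 1) x)" for w x
  proof -
    let ?y = "bop_apply (A - Re w *\<^sub>R 1) x"
    have "selfadjoint (A - Re w *\<^sub>R 1)" using A by (intro selfadjoint_simps)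
    then have "cinner x ?y = cinner ?y x" by (simp add: selfadjoint_cinner)
    then have "Im (cinner ?y x) = 0"
      using cinner_commute[of x ?y] by (metis cnj.simps(2) equal_neg_zero)
    then have orth: "Re (cinner ?y ((\<i> * Im w) *\<^sub>C x)) = 0"
      by (simp add: cinner_scaleC_right)
    have "w *\<^sub>C x = Re w *\<^sub>R x + (\<i> * Im w) *\<^sub>C x"
      by (subst complex_eq[of w]) (simp only: scaleC_add_left scaleC_of_real)
    then have "bop_apply (A - w *\<^sub>C 1) x = ?y - (\<i> * Im w) *\<^sub>C x"
      by (simp add: bop_apply_simps)
    then have "(norm (bop_apply (A - w *\<^sub>C 1) x))\<^sup>2 = (norm ?y)\<^sup>2 + (\<bar>Im w\<bar> * norm x)\<^sup>2"
      using orth by (simp add: norm_diff_sq norm_scaleC norm_mult)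
    then have "(\<bar>Im w\<bar> * norm x)\<^sup>2 \<le> (norm (bop_apply (A - w *\<^sub>C 1) x))\<^sup>2"
      by (simp only: le_add_same_cancel2) simp
    then show ?thesis by (rule power2_le_imp_le) simp
  qed
  have "adj (A - z *\<^sub>C 1) = A - cnj z *\<^sub>C 1"
    using A by (simp add: adj_diff adj_scaleC selfadjoint_def)
  then have "invertible_bop (A - z *\<^sub>C 1)"
    using im below[of z] below[of "cnj z"]
    by (intro invertible_bop_bounded_below[of "\<bar>Im z\<bar>"]) simp_all
  then show False using z by (simp add: spectrum_def)
qed

text \<open>With \<open>k = \<parallel>A\<parallel>\<close>, the product \<open>(A - k) (A + k) = A\<^sup>2 - k\<^sup>2\<close> is not bounded below.\<close>

lemma selfadjoint_norm_in_spectrum: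
  fixes A :: "'h::separable_infinite_dim_chilbert_space bop"
  assumes A: "selfadjoint A"
  obtains r where "\<bar>r\<bar> = norm A" "of_real r \<in> spectrum A"
proof (cases "A = 0")
  case True
  have "of_real 0 \<in> spectrum A"
    using True by (auto simp: spectrum_def invertible_bop_def)
  then show thesis using that[of 0] True by simp
next
  case False
  define k where "k = norm A"
  have k: "k > 0" using False by (simp add: k_def)
  show thesis
  proof (rule ccontr)
    assume "\<not> thesis"
    then have "of_real k \<notin> spectrum A" "of_real (- k) \<notin> spectrum A"
      using that[of k] that[of "- k"] k k_def by force+
    then have "invertible_bop (A - of_real k *\<^sub>C 1)" "invertible_bop (A - of_real (- k) *\<^sub>C 1)"
      by (auto simp: spectrum_def)
    then have "invertible_bop ((A - k *\<^sub>R 1) * (A + k *\<^sub>R 1))"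
      unfolding scaleC_of_real by (intro invertible_bop_mult) auto
    then obtain R where R: "R * ((A - k *\<^sub>R 1) * (A + k *\<^sub>R 1)) = 1"
      by (auto simp: invertible_bop_def)
    \<comment> \<open>If R inverts the product, the norm of x is at most \<open>norm R\<close> times
      that of \<open>?q\<close>. Together with the bound \<open>nq\<close> this lowers the square of
      the norm of A from \<open>k^2\<close> to \<open>k^2 - 1 / M\<close>, contradicting
      \<open>k = norm A\<close>; the summand 1 makes M positive.\<close>
    define M where "M = (norm R)\<^sup>2 * k\<^sup>2 + 1"
    have M: "M > 0" by (simp add: M_def add_nonneg_pos)
    have main: "(norm (bop_apply A x))\<^sup>2 \<le> (k\<^sup>2 - 1 / M) * (norm x)\<^sup>2" for x
    proof -
      let ?q = "bop_apply ((A - k *\<^sub>R 1) * (A + k *\<^sub>R 1)) x" and ?a = "bop_apply A x"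
      have q: "?q = bop_apply A ?a - (k\<^sup>2) *\<^sub>R x"
        by (simp add: bop_apply_simps algebra_simps power2_eq_square)
      have "(norm ?q)\<^sup>2 = (norm (bop_apply A ?a))\<^sup>2 + (k\<^sup>2 * norm x)\<^sup>2 - 2 * k\<^sup>2 * (norm ?a)\<^sup>2"
        unfolding q norm_diff_sq
        by (simp add: cinner.scaleR_right selfadjoint_cinner[OF A] cinner_self power_mult_distrib
            del: of_real_power)
      moreover have "(norm (bop_apply A ?a))\<^sup>2 \<le> (k * norm ?a)\<^sup>2"
        unfolding k_def by (intro power_mono norm_bop_apply) auto
      ultimately have nq: "(norm ?q)\<^sup>2 \<le> k\<^sup>2 * (k\<^sup>2 * (norm x)\<^sup>2 - (norm ?a)\<^sup>2)"
        by (simp add: power_mult_distrib algebra_simps power2_eq_square)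
      have nn: "0 \<le> k\<^sup>2 * (norm x)\<^sup>2 - (norm ?a)\<^sup>2"
        using power_mono[OF norm_bop_apply[of A x], of 2] by (simp add: k_def power_mult_distrib)
      have "x = bop_apply R ?q" using R by (metis bop_apply_mult bop_apply_one)
      then have "norm x \<le> norm R * norm ?q" using norm_bop_apply by metis
      then have "(norm x)\<^sup>2 \<le> (norm R)\<^sup>2 * (norm ?q)\<^sup>2"
        by (metis norm_ge_zero power_mono power_mult_distrib)
      also have "\<dots> \<le> (norm R)\<^sup>2 * (k\<^sup>2 * (k\<^sup>2 * (norm x)\<^sup>2 - (norm ?a)\<^sup>2))"
        by (rule mult_left_mono[OF nq]) simp
      also have "\<dots> \<le> M * (k\<^sup>2 * (norm x)\<^sup>2 - (norm ?a)\<^sup>2)"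
        using nn by (simp add: M_def algebra_simps)
      finally show ?thesis using M by (simp add: field_simps)
    qed
    have "norm A \<le> sqrt (max 0 (k\<^sup>2 - 1 / M))"
    proof (rule norm_bop_le)
      fix x
      have "(norm (bop_apply A x))\<^sup>2 \<le> max 0 (k\<^sup>2 - 1 / M) * (norm x)\<^sup>2"
        by (rule order_trans[OF main]) (intro mult_right_mono, auto)
      then have "(norm (bop_apply A x))\<^sup>2 \<le> (sqrt (max 0 (k\<^sup>2 - 1 / M)) * norm x)\<^sup>2"
        by (simp add: power_mult_distrib)
      then show "norm (bop_apply A x) \<le> sqrt (max 0 (k\<^sup>2 - 1 / M)) * norm x"
        by (rule power2_le_imp_le) simp
    qed simp
    then have "k\<^sup>2 \<le> (sqrt (max 0 (k\<^sup>2 - 1 / M)))\<^sup>2"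
      using k by (intro power_mono) (auto simp: k_def)
    then have "k\<^sup>2 \<le> max 0 (k\<^sup>2 - 1 / M)" by simp
    moreover have "max 0 (k\<^sup>2 - 1 / M) < k\<^sup>2" using k M by simp
    ultimately show False by simp
  qed
qed

definition spectrum_within :: "'a::chilbert_space bop \<Rightarrow> real \<Rightarrow> real \<Rightarrow> bool" where
  "spectrum_within A c d \<longleftrightarrow> selfadjoint A \<and> spectrum A \<subseteq> complex_of_real ` {c..d}"

text \<open>After centring at the midpoint, the norm of a self-adjoint operator is attained by a
  spectral point and bounds all of them. Spectral inclusions thus become norm inequalities, which
  suit estimates better.\<close>

lemma spectrum_within_iff_norm:
  fixes A :: "'h::separable_infinite_dim_chilbert_space bop"
  shows "spectrum_within A c d \<longleftrightarrow>
    selfadjoint A \<and> norm (A - ((c + d) / 2) *\<^sub>R 1) \<le> (d - c) / 2"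
proof (cases "selfadjoint A")
  case True
  let ?m = "(c + d) / 2"
  have sa: "selfadjoint (A - ?m *\<^sub>R 1)" using True by (intro selfadjoint_simps)
  have "norm (A - ?m *\<^sub>R 1) \<le> (d - c) / 2" if sub: "spectrum A \<subseteq> complex_of_real ` {c..d}"
  proof -
    obtain r where r: "\<bar>r\<bar> = norm (A - ?m *\<^sub>R 1)" "of_real r \<in> spectrum (A - ?m *\<^sub>R 1)"
      using selfadjoint_norm_in_spectrum[OF sa] by metis
    then have "of_real (r + ?m) \<in> spectrum A" by (simp add: spectrum_shift)
    then have "r + ?m \<in> {c..d}" using sub by (metis image_iff of_real_eq_iff subsetD)
    then have "\<bar>r\<bar> \<le> (d - c) / 2" by (simp add: abs_if field_simps)
    then show ?thesis using r by simp
  qed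
  moreover have "spectrum A \<subseteq> complex_of_real ` {c..d}" if n: "norm (A - ?m *\<^sub>R 1) \<le> (d - c) / 2"
  proof
    fix z assume z: "z \<in> spectrum A"
    define r where "r = Re z"
    have zr: "z = of_real r" using selfadjoint_spectrum_real[OF True z] by (simp add: r_def)
    have "of_real (r - ?m) \<in> spectrum (A - ?m *\<^sub>R 1)"
      using z zr by (simp add: spectrum_shift)
    then have "\<bar>r - ?m\<bar> \<le> (d - c) / 2" 
      using spectrum_norm[of "of_real (r - ?m)" "A - ?m *\<^sub>R 1"] n
      unfolding norm_of_real by linarith
    then have "r \<in> {c..d}" by (auto simp: abs_if field_simps split: if_splits)
    then show "z \<in> complex_of_real ` {c..d}" using zr by blast
  qed
  ultimately show ?thesis using True by (auto simp: spectrum_within_def)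
qed (simp add: spectrum_within_def)

lemma spectrum_within_mono:
  "spectrum_within A c d \<Longrightarrow> c' \<le> c \<Longrightarrow> d \<le> d' \<Longrightarrow> spectrum_within A c' d'"
  unfolding spectrum_within_def
  by (meson atLeastatMost_subset_iff image_mono order_trans)

lemma spectrum_within_le:
  fixes A :: "'h::separable_infinite_dim_chilbert_space bop"
  assumes "spectrum_within A c d"
  shows "c \<le> d"
proof -
  have "0 \<le> (d - c) / 2"
    using assms norm_ge_zero order_trans unfolding spectrum_within_iff_norm by blast
  then show ?thesis by simp
qed

section \<open>The continuous functional calculus\<close>

text \<open>Complex coefficients are needed only to split a polynomial into linear factors, as
  \<open>invertible_cpoly_bop\<close> does.\<close>

definition cpoly_bop :: "complex poly \<Rightarrow> 'a::complex_inner bop \<Rightarrow> 'a bop" where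
  "cpoly_bop p A = (\<Sum>i\<le>degree p. coeff p i *\<^sub>C A ^ i)"

lemma cpoly_bop_pCons: "cpoly_bop (pCons c p) A = c *\<^sub>C 1 + A * cpoly_bop p A"
  by (cases "p = 0")
    (simp_all add: cpoly_bop_def sum.atMost_Suc_shift sum_distrib_left scaleC_mult_right del: sum.atMost_Suc)

lemma cpoly_bop_0: "cpoly_bop 0 A = 0"
  by (simp add: cpoly_bop_def)

lemma cpoly_bop_add: "cpoly_bop (p + q) A = cpoly_bop p A + cpoly_bop q A"
  by (induction p q rule: poly_induct2)
    (simp_all add: cpoly_bop_0 cpoly_bop_pCons scaleC_add_left distrib_left)

lemma cpoly_bop_smult: "cpoly_bop (smult c p) A = c *\<^sub>C cpoly_bop p A"
  by (induction p) (simp_all add: cpoly_bop_0 cpoly_bop_pCons scaleC_add_right scaleC_mult_right scaleC_scaleC)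

lemma cpoly_bop_mult: "cpoly_bop (p * q) A = cpoly_bop p A * cpoly_bop q A"
  by (induction p)
    (simp_all add: cpoly_bop_0 cpoly_bop_pCons cpoly_bop_add cpoly_bop_smult distrib_right
      scaleC_mult_left mult.assoc)

lemma poly_bop_pCons: "poly_bop (pCons c p) A = c *\<^sub>R 1 + A * poly_bop p A"
  by (cases "p = 0") (simp_all add: poly_bop_def sum.atMost_Suc_shift sum_distrib_left del: sum.atMost_Suc)

lemma poly_bop_0: "poly_bop 0 A = 0"
  by (simp add: poly_bop_def)

lemma poly_bop_add: "poly_bop (p + q) A = poly_bop p A + poly_bop q A"
  by (induction p q rule: poly_induct2)
    (simp_all add: poly_bop_0 poly_bop_pCons scaleR_add_left distrib_left)

lemma poly_bop_smult: "poly_bop (smult c p) A = c *\<^sub>R poly_bop p A"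
  by (induction p) (simp_all add: poly_bop_0 poly_bop_pCons scaleR_add_right)

lemma poly_bop_diff: "poly_bop (p - q) A = poly_bop p A - poly_bop q A"
  using poly_bop_add[of "p - q" q A] by simp

lemma poly_bop_mult: "poly_bop (p * q) A = poly_bop p A * poly_bop q A"
  by (induction p)
    (simp_all add: poly_bop_0 poly_bop_pCons poly_bop_add poly_bop_smult distrib_right mult.assoc)

lemma poly_bop_intertwine:
  assumes "X * A = B * X"
  shows "X * poly_bop p A = poly_bop p B * X"
proof (induction p)
  case (pCons c p)
  have "X * (A * poly_bop p A) = B * poly_bop p B * X"
    by (metis assms pCons.IH mult.assoc)
  then show ?case by (simp add: poly_bop_pCons distrib_left distrib_right)
qed (simp add: poly_bop_0)

lemma selfadjoint_poly_bop:
  assumes "selfadjoint A"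
  shows "selfadjoint (poly_bop p A)"
proof (induction p)
  case (pCons c p)
  have "A * poly_bop p A = poly_bop p A * A" by (rule poly_bop_intertwine) simp
  then show ?case
    using assms pCons.IH by (simp add: poly_bop_pCons selfadjoint_def adj_add adj_scaleR adj_mult)
qed (simp add: poly_bop_0 selfadjoint_simps)

lemma cpoly_bop_of_real: "cpoly_bop (map_poly complex_of_real p) A = poly_bop p A"
  by (induction p) (simp_all add: cpoly_bop_0 poly_bop_0 cpoly_bop_pCons poly_bop_pCons
      map_poly_pCons scaleC_of_real)

lemma poly_map_poly_of_real: "poly (map_poly complex_of_real p) (of_real x) = of_real (poly p x)"
  by (induction p) (simp_all add: map_poly_pCons)

text \<open>Induction on the degree: the fundamental theorem of algebra splits off a root z, and z
  is outside the spectrum, so the factor A - z is invertible.\<close>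

lemma invertible_cpoly_bop:
  assumes "q \<noteq> 0" "\<And>z. poly q z = 0 \<Longrightarrow> z \<notin> spectrum A"
  shows "invertible_bop (cpoly_bop q A)"
  using assms
proof (induction "degree q" arbitrary: q)
  case 0
  then obtain c where c: "q = [:c:]" "c \<noteq> 0" by (metis degree_eq_zeroE pCons_0_0)
  then have "cpoly_bop q A = c *\<^sub>C 1" by (simp add: cpoly_bop_pCons cpoly_bop_0)
  then show ?case
    using c by (simp add: invertible_bop_scaleC invertible_bopI[of 1 1 1])
next
  case (Suc n)
  then have "\<not> constant (poly q)" by (metis constant_degree nat.distinct(1))
  then obtain z where z: "poly q z = 0" using fundamental_theorem_of_algebra by blast
  then obtain r where r: "q = [:- z, 1:] * r" by (metis dvdE poly_eq_0_iff_dvd)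
  then have r0: "r \<noteq> 0" using Suc.prems by auto
  have "degree q = Suc (degree r)" unfolding r using r0 by (subst degree_mult_eq) auto
  then have "invertible_bop (cpoly_bop r A)"
    using Suc r0 r by (intro Suc.hyps(1)) auto
  moreover have "invertible_bop (cpoly_bop [:- z, 1:] A)"
    using Suc.prems(2)[OF z]
    by (simp add: cpoly_bop_pCons cpoly_bop_0 spectrum_def complex_vector.scale_minus_left)
  ultimately show ?case unfolding r cpoly_bop_mult by (intro invertible_bop_mult)
qed

text \<open>One half of the spectral mapping theorem. If p - r had no root in the spectrum, p(A) - r
  would be invertible.\<close>

lemma spectrum_poly_bop:
  fixes A :: "'h::separable_infinite_dim_chilbert_space bop"
  assumes A: "selfadjoint A" and r: "of_real r \<in> spectrum (poly_bop p A)"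
  obtains x where "of_real x \<in> spectrum A" "poly p x = r"
proof -
  define q where "q = p - [:r:]"
  have eq: "cpoly_bop (map_poly complex_of_real q) A = poly_bop p A - of_real r *\<^sub>C 1"
    by (simp add: cpoly_bop_of_real q_def poly_bop_diff poly_bop_pCons poly_bop_0 scaleC_of_real)
  have not_inv: "\<not> invertible_bop (cpoly_bop (map_poly complex_of_real q) A)"
    using r unfolding eq by (simp add: spectrum_def)
  obtain z where z: "poly (map_poly complex_of_real q) z = 0" "z \<in> spectrum A"
  proof (cases "q = 0")
    case True
    \<comment> \<open>Here p is the constant r, so any point of the nonempty spectrum
      serves.\<close>
    obtain x where "of_real x \<in> spectrum A" using selfadjoint_norm_in_spectrum[OF A] by metis
    then show thesis using that True by simp
  next
    case False
    then have "map_poly complex_of_real q \<noteq> 0" by (simp add: map_poly_eq_0_iff)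
    then show thesis using invertible_cpoly_bop not_inv that by blast
  qed
  define x where "x = Re z"
  have zx: "z = of_real x" using selfadjoint_spectrum_real[OF A z(2)] by (simp add: x_def)
  have "poly q x = 0" using z(1) unfolding zx poly_map_poly_of_real by simp
  then show thesis using that[of x] z(2) zx by (simp add: q_def)
qed

text \<open>p(A) is self-adjoint, so its norm is attained on its own spectrum, which consists of
  values of p on the spectrum of A. This bound is what makes the functional calculus well
  defined.\<close>

lemma norm_poly_bop_le:
  fixes A :: "'h::separable_infinite_dim_chilbert_space bop"
  assumes A: "selfadjoint A" and K: "\<And>x. of_real x \<in> spectrum A \<Longrightarrow> \<bar>poly p x\<bar> \<le> K"
  shows "norm (poly_bop p A) \<le> K"
proof -
  obtain r where r: "\<bar>r\<bar> = norm (poly_bop p A)" "of_real r \<in> spectrum (poly_bop p A)"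
    using selfadjoint_norm_in_spectrum[OF selfadjoint_poly_bop[OF A]] by metis
  then show ?thesis using K spectrum_poly_bop[OF A r(2)] by metis
qed

lemma poly_bop_Cauchy:
  fixes A :: "'h::separable_infinite_dim_chilbert_space bop"
  assumes A: "selfadjoint A"
    and p: "uniform_limit {x. complex_of_real x \<in> spectrum A} (\<lambda>n. poly (p n)) f sequentially"
  shows "Cauchy (\<lambda>n. poly_bop (p n) A)"
proof (rule CauchyI)
  fix e :: real assume "0 < e"
  then obtain M where M: "\<And>n x. n \<ge> M \<Longrightarrow> complex_of_real x \<in> spectrum A \<Longrightarrow> \<bar>poly (p n) x - f x\<bar> < e / 3"
    using uniform_limitD[OF p, of "e / 3"] by (auto simp: eventually_sequentially dist_real_def)
  show "\<exists>M. \<forall>m\<ge>M. \<forall>n\<ge>M. norm (poly_bop (p m) A - poly_bop (p n) A) < e"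
  proof (intro exI allI impI)
    fix m n assume mn: "M \<le> m" "M \<le> n"
    have "norm (poly_bop (p m - p n) A) \<le> 2 * e / 3"
    proof (rule norm_poly_bop_le[OF A])
      fix x assume "complex_of_real x \<in> spectrum A"
      then show "\<bar>poly (p m - p n) x\<bar> \<le> 2 * e / 3"
        using M[OF mn(1), of x] M[OF mn(2), of x] unfolding poly_diff by linarith
    qed
    then show "norm (poly_bop (p m) A - poly_bop (p n) A) < e"
      using \<open>0 < e\<close> by (simp add: poly_bop_diff)
  qed
qed

text \<open>Discharges the definite description in \<open>cfc\<close>. Two approximating sequences
  differ by polynomials tending to 0 uniformly on the spectrum, so they share their limit; that one
  such sequence exists, here p, makes the limit unique.\<close>

lemma cfc_tendsto:
  fixes A :: "'h::separable_infinite_dim_chilbert_space bop"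
  assumes A: "selfadjoint A"
    and p: "uniform_limit {x. complex_of_real x \<in> spectrum A} (\<lambda>n. poly (p n)) f sequentially"
  shows "(\<lambda>n. poly_bop (p n) A) \<longlonglongrightarrow> cfc f A"
proof -
  let ?S = "{x. complex_of_real x \<in> spectrum A}"
  obtain L where L: "(\<lambda>n. poly_bop (p n) A) \<longlonglongrightarrow> L"
    using poly_bop_Cauchy[OF A p] by (meson Cauchy_convergent convergent_def)
  have all: "(\<lambda>n. poly_bop (q n) A) \<longlonglongrightarrow> L"
    if q: "uniform_limit ?S (\<lambda>n. poly (q n)) f sequentially" for q
  proof -
    have "uniform_limit ?S (\<lambda>n x. poly (q n) x - poly (p n) x) (\<lambda>x. f x - f x) sequentially"
      by (intro uniform_limit_minus p q)
    then have d: "uniform_limit ?S (\<lambda>n. poly (q n - p n)) (\<lambda>x. 0) sequentially"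
      by (simp flip: poly_diff)
    have "(\<lambda>n. poly_bop (q n - p n) A) \<longlonglongrightarrow> 0"
    proof (rule tendstoI)
      fix e :: real assume e: "0 < e"
      have "\<forall>\<^sub>F n in sequentially. \<forall>x\<in>?S. dist (poly (q n - p n) x) 0 < e / 2"
        using uniform_limitD[OF d, of "e / 2"] e by simp
      then show "\<forall>\<^sub>F n in sequentially. dist (poly_bop (q n - p n) A) 0 < e"
      proof eventually_elim
        case (elim n)
        have "norm (poly_bop (q n - p n) A) \<le> e / 2"
          using elim by (intro norm_poly_bop_le[OF A]) (auto simp: dist_real_def intro: less_imp_le)
        then show ?case using e by simp
      qed
    qed
    from tendsto_add[OF this L] show ?thesis by (simp add: poly_bop_diff)
  qed
  have "cfc f A = L" unfolding cfc_def
  proof (rule the_equality)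
    show "\<forall>q. uniform_limit ?S (\<lambda>n. poly (q n)) f sequentially \<longrightarrow> (\<lambda>n. poly_bop (q n) A) \<longlonglongrightarrow> L"
      using all by blast
    show "B = L" if "\<forall>q. uniform_limit ?S (\<lambda>n. poly (q n)) f sequentially \<longrightarrow> (\<lambda>n. poly_bop (q n) A) \<longlonglongrightarrow> B"
      for B using that p LIMSEQ_unique L by blast
  qed
  then show ?thesis using L by simp
qed

section \<open>Functions continuous on an interval containing the spectrum\<close>

lemma spectrum_within_subset: "spectrum_within A c d \<Longrightarrow> {x. complex_of_real x \<in> spectrum A} \<subseteq> {c..d}"
  unfolding spectrum_within_def by (auto dest: subsetD)

lemma cfc_tendsto_interval:
  fixes A :: "'h::separable_infinite_dim_chilbert_space bop"
  assumes A: "spectrum_within A c d" and p: "uniform_limit {c..d} (\<lambda>n. poly (p n)) f sequentially"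
  shows "(\<lambda>n. poly_bop (p n) A) \<longlonglongrightarrow> cfc f A"
  using A by (intro cfc_tendsto uniform_limit_on_subset[OF p] spectrum_within_subset)
    (auto simp: spectrum_within_def)

lemma polynomial_approximation:
  fixes f :: "real \<Rightarrow> real"
  assumes "continuous_on {c..d} f"
  obtains p :: "nat \<Rightarrow> real poly" where "uniform_limit {c..d} (\<lambda>n. poly (p n)) f sequentially"
proof -
  have "\<exists>p :: real poly. \<forall>x\<in>{c..d}. \<bar>f x - poly p x\<bar> < inverse (Suc n)" for n
  proof -
    obtain g where g: "real_polynomial_function g" "\<And>x. x \<in> {c..d} \<Longrightarrow> \<bar>f x - g x\<bar> < inverse (Suc n)"
      by (rule Stone_Weierstrass_real_polynomial_function[OF compact_Icc assms, of "inverse (Suc n)"])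
        auto
    then obtain a k where "g = (\<lambda>x. \<Sum>i\<le>k. a i * x ^ i)"
      unfolding real_polynomial_function_iff_sum by blast
    then have "g = poly (\<Sum>i\<le>k. monom (a i) i)" by (auto simp: poly_sum poly_monom)
    then show ?thesis using g by blast
  qed
  then obtain p :: "nat \<Rightarrow> real poly"
    where p: "\<And>n x. x \<in> {c..d} \<Longrightarrow> \<bar>f x - poly (p n) x\<bar> < inverse (Suc n)" by metis
  have "uniform_limit {c..d} (\<lambda>n. poly (p n)) f sequentially"
  proof (rule uniform_limitI)
    fix e :: real assume "0 < e"
    then have "\<forall>\<^sub>F n in sequentially. inverse (real (Suc n)) < e"
      using LIMSEQ_inverse_real_of_nat by (rule order_tendstoD(2)[rotated])
    then show "\<forall>\<^sub>F n in sequentially. \<forall>x\<in>{c..d}. dist (poly (p n) x) (f x) < e"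
    proof eventually_elim
      case (elim n)
      then show ?case using p[of _ n] by (force simp: dist_real_def abs_minus_commute)
    qed
  qed
  then show thesis by (rule that)
qed

lemma cfc_poly:
  fixes A :: "'h::separable_infinite_dim_chilbert_space bop"
  assumes "selfadjoint A"
  shows "cfc (poly p) A = poly_bop p A"
  by (rule LIMSEQ_unique[OF cfc_tendsto[OF assms, of "\<lambda>n. p" "poly p"] tendsto_const])
    (rule uniform_limit_const)

lemma cfc_cong:
  assumes "spectrum_within A c d" "\<And>x. x \<in> {c..d} \<Longrightarrow> f x = g x"
  shows "cfc f A = cfc g A"
proof -
  let ?S = "{x. complex_of_real x \<in> spectrum A}"
  have "uniform_limit ?S h f sequentially \<longleftrightarrow> uniform_limit ?S h g sequentially" for h :: "nat \<Rightarrow> real \<Rightarrow> real"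
    using assms(2) spectrum_within_subset[OF assms(1)] by (intro uniform_limit_cong') auto
  then show ?thesis unfolding cfc_def by simp
qed

text \<open>The interval may exceed the spectrum. This lets two operators share their approximating
  polynomials, as \<open>cfc_intertwine\<close> requires.\<close>

locale functional_calculus =
  fixes A :: "'h::separable_infinite_dim_chilbert_space bop" and c d :: real
  assumes within: "spectrum_within A c d"
begin

lemma sa: "selfadjoint A"
  using within by (simp add: spectrum_within_def)

lemma cfc_const: "cfc (\<lambda>x. r) A = r *\<^sub>R 1"
  using cfc_poly[OF sa, of "[:r:]"]
  by (simp add: poly_bop_pCons poly_bop_0 poly_pCons[abs_def])

lemma cfc_id: "cfc (\<lambda>x. x) A = A"
  using cfc_poly[OF sa, of "[:0, 1:]"]
  by (simp add: poly_bop_pCons poly_bop_0 poly_pCons[abs_def])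

lemma cfc_add:
  assumes f: "continuous_on {c..d} f" and g: "continuous_on {c..d} g"
  shows "cfc (\<lambda>x. f x + g x) A = cfc f A + cfc g A"
proof -
  obtain p where p: "uniform_limit {c..d} (\<lambda>n. poly (p n)) f sequentially"
    by (rule polynomial_approximation[OF f])
  obtain q where q: "uniform_limit {c..d} (\<lambda>n. poly (q n)) g sequentially"
    by (rule polynomial_approximation[OF g])
  have "uniform_limit {c..d} (\<lambda>n. poly (p n + q n)) (\<lambda>x. f x + g x) sequentially"
    using uniform_limit_add[OF p q] by (simp flip: poly_add)
  from cfc_tendsto_interval[OF within this] show ?thesis
    using tendsto_add[OF cfc_tendsto_interval[OF within p] cfc_tendsto_interval[OF within q]]
    by (auto simp: poly_bop_add intro: LIMSEQ_unique)
qed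

lemma cfc_mult:
  assumes f: "continuous_on {c..d} f" and g: "continuous_on {c..d} g"
  shows "cfc (\<lambda>x. f x * g x) A = cfc f A * cfc g A"
proof -
  obtain p where p: "uniform_limit {c..d} (\<lambda>n. poly (p n)) f sequentially"
    by (rule polynomial_approximation[OF f])
  obtain q where q: "uniform_limit {c..d} (\<lambda>n. poly (q n)) g sequentially"
    by (rule polynomial_approximation[OF g])
  have "bounded (f ` {c..d})" "bounded (g ` {c..d})"
    using f g by (auto intro!: compact_imp_bounded compact_continuous_image)
  from uniform_lim_mult[OF p q this]
  have "uniform_limit {c..d} (\<lambda>n. poly (p n * q n)) (\<lambda>x. f x * g x) sequentially"
    by (simp flip: poly_mult)
  from cfc_tendsto_interval[OF within this] show ?thesis
    using tendsto_mult[OF cfc_tendsto_interval[OF within p] cfc_tendsto_interval[OF within q]]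
    by (auto simp: poly_bop_mult intro: LIMSEQ_unique)
qed

lemma cfc_scaleR:
  assumes "continuous_on {c..d} f"
  shows "cfc (\<lambda>x. r * f x) A = r *\<^sub>R cfc f A"
  using cfc_mult[OF continuous_on_const assms] by (simp add: cfc_const)

lemma cfc_diff:
  assumes f: "continuous_on {c..d} f" and g: "continuous_on {c..d} g"
  shows "cfc (\<lambda>x. f x - g x) A = cfc f A - cfc g A"
  using cfc_add[OF f, of "\<lambda>x. -1 * g x"] cfc_scaleR[OF g, of "-1"] g
  by (simp add: continuous_on_minus)

lemma selfadjoint_cfc:
  assumes "continuous_on {c..d} f"
  shows "selfadjoint (cfc f A)"
proof -
  obtain p where p: "uniform_limit {c..d} (\<lambda>n. poly (p n)) f sequentially"
    by (rule polynomial_approximation[OF assms])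
  note lim = cfc_tendsto_interval[OF within p]
  have "(\<lambda>n. adj (poly_bop (p n) A)) \<longlonglongrightarrow> adj (cfc f A)"
    by (rule bounded_linear.tendsto[OF bounded_linear_adj lim])
  then have "(\<lambda>n. poly_bop (p n) A) \<longlonglongrightarrow> adj (cfc f A)"
    using selfadjoint_poly_bop[OF sa] by (simp add: selfadjoint_def)
  then show ?thesis using LIMSEQ_unique lim by (auto simp: selfadjoint_def)
qed

lemma norm_cfc_le:
  assumes f: "continuous_on {c..d} f" and K: "\<And>x. x \<in> {c..d} \<Longrightarrow> \<bar>f x\<bar> \<le> K"
  shows "norm (cfc f A) \<le> K"
proof (rule field_le_epsilon)
  fix e :: real assume e: "0 < e"
  obtain p where p: "uniform_limit {c..d} (\<lambda>n. poly (p n)) f sequentially"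
    by (rule polynomial_approximation[OF f])
  have "\<forall>\<^sub>F n in sequentially. norm (poly_bop (p n) A) \<le> K + e"
    using uniform_limitD[OF p e]
  proof eventually_elim
    case (elim n)
    show ?case
    proof (rule norm_poly_bop_le[OF sa])
      fix x assume "complex_of_real x \<in> spectrum A"
      then have "x \<in> {c..d}" using spectrum_within_subset[OF within] by blast
      then show "\<bar>poly (p n) x\<bar> \<le> K + e" using elim K[of x] by (force simp: dist_real_def)
    qed
  qed
  then show "norm (cfc f A) \<le> K + e"
    using tendsto_upperbound[OF tendsto_norm[OF cfc_tendsto_interval[OF within p]]] by simp
qed

lemma spectrum_within_cfc:
  assumes f: "continuous_on {c..d} f" and K: "\<And>x. x \<in> {c..d} \<Longrightarrow> f x \<in> {c'..d'}"
  shows "spectrum_within (cfc f A) c' d'"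
proof -
  \<comment> \<open>Centring f at the midpoint of the target interval reduces the inclusion to a
    sup-norm bound.\<close>
  have "norm (cfc (\<lambda>x. f x - (c' + d') / 2) A) \<le> (d' - c') / 2"
    using K by (intro norm_cfc_le continuous_intros f) (force simp: abs_le_iff field_simps)
  then show ?thesis
    by (simp add: spectrum_within_iff_norm selfadjoint_cfc f cfc_diff cfc_const)
qed

lemma cfc_compose:
  assumes g: "continuous_on {c..d} g" "\<And>x. x \<in> {c..d} \<Longrightarrow> g x \<in> {c'..d'}"
    and f: "continuous_on {c'..d'} f"
  shows "cfc f (cfc g A) = cfc (\<lambda>x. f (g x)) A"
proof -
  obtain p where p: "uniform_limit {c'..d'} (\<lambda>n. poly (p n)) f sequentially"
    by (rule polynomial_approximation[OF f])
  have poly: "poly_bop q (cfc g A) = cfc (\<lambda>x. poly q (g x)) A" for q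
    using g(1) by (induction q)
      (simp_all add: poly_bop_0 poly_bop_pCons cfc_const cfc_add cfc_mult continuous_intros
        continuous_on_mult continuous_on_poly)
  have cont: "continuous_on {c..d} (\<lambda>x. f (g x))"
    using continuous_on_compose2[OF f g(1)] g(2) by blast
  have "(\<lambda>n. poly_bop (p n) (cfc g A)) \<longlonglongrightarrow> cfc (\<lambda>x. f (g x)) A"
  proof (rule tendstoI)
    fix e :: real assume e: "0 < e"
    have "\<forall>\<^sub>F n in sequentially. \<forall>x\<in>{c'..d'}. dist (poly (p n) x) (f x) < e / 2"
      using uniform_limitD[OF p, of "e / 2"] e by simp
    then show "\<forall>\<^sub>F n in sequentially. dist (poly_bop (p n) (cfc g A)) (cfc (\<lambda>x. f (g x)) A) < e"
    proof eventually_elim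
      case (elim n)
      have cp: "continuous_on {c..d} (\<lambda>x. poly (p n) (g x))" by (intro continuous_on_poly g)
      have "norm (cfc (\<lambda>x. poly (p n) (g x) - f (g x)) A) \<le> e / 2"
        using elim g(2) by (intro norm_cfc_le continuous_on_diff cp cont)
          (auto simp: dist_real_def intro: less_imp_le)
      then show ?case using e by (simp add: dist_norm poly cfc_diff[OF cp cont])
    qed
  qed
  moreover have "(\<lambda>n. poly_bop (p n) (cfc g A)) \<longlonglongrightarrow> cfc f (cfc g A)"
    by (rule cfc_tendsto_interval[OF spectrum_within_cfc[OF g] p])
  ultimately show ?thesis by (rule LIMSEQ_unique[symmetric])
qed

text \<open>The relation passes to polynomials, and to the limit because one sequence approximates f
  for both operators. For \<open>adj X * X\<close> and \<open>X * adj X\<close> it moves functions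
  of the moduli past X.\<close>

lemma cfc_intertwine:
  assumes f: "continuous_on {c..d} f" and B: "spectrum_within B c d" and X: "X * A = B * X"
  shows "X * cfc f A = cfc f B * X"
proof -
  obtain p where p: "uniform_limit {c..d} (\<lambda>n. poly (p n)) f sequentially"
    by (rule polynomial_approximation[OF f])
  have "(\<lambda>n. X * poly_bop (p n) A) \<longlonglongrightarrow> X * cfc f A"
    by (intro tendsto_intros cfc_tendsto_interval[OF within p])
  moreover have "(\<lambda>n. poly_bop (p n) B * X) \<longlonglongrightarrow> cfc f B * X"
    by (intro tendsto_intros cfc_tendsto_interval[OF B p])
  ultimately show ?thesis
    unfolding poly_bop_intertwine[OF X] by (rule LIMSEQ_unique)
qed

end

section \<open>The modulus of an operator\<close>

text \<open>For r < 0 the quadratic form of \<open>adj X * X - r\<close> is at least - r, so by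
  Cauchy-Schwarz this self-adjoint operator is bounded below and hence invertible.\<close>

lemma spectrum_within_adj_mult:
  fixes X :: "'h::separable_infinite_dim_chilbert_space bop"
  assumes b: "norm X \<le> b"
  shows "spectrum_within (adj X * X) 0 (b\<^sup>2)"
proof -
  have sa: "selfadjoint (adj X * X)" by (rule selfadjoint_simps)
  have "spectrum (adj X * X) \<subseteq> complex_of_real ` {0..b\<^sup>2}"
  proof
    fix z assume z: "z \<in> spectrum (adj X * X)"
    define r where "r = Re z"
    have zr: "z = of_real r" using selfadjoint_spectrum_real[OF sa z] by (simp add: r_def)
    have "\<bar>r\<bar> \<le> norm (adj X * X)" using spectrum_norm[OF z] zr by simp
    also have "\<dots> \<le> norm (adj X) * norm X" by (rule norm_mult_ineq)
    also have "\<dots> \<le> b\<^sup>2" using b by (simp add: power2_eq_square mult_mono')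
    finally have "r \<le> b\<^sup>2" by simp
    moreover have "0 \<le> r"
    proof (rule ccontr)
      assume r: "\<not> 0 \<le> r"
      let ?B = "adj X * X - r *\<^sub>R 1"
      have below: "- r * norm x \<le> norm (bop_apply ?B x)" for x
      proof -
        have "- r * (norm x)\<^sup>2 \<le> (norm (bop_apply X x))\<^sup>2 - r * (norm x)\<^sup>2" by simp
        also have "\<dots> = Re (cinner x (bop_apply ?B x))"
          by (simp add: bop_apply_simps cinner.diff_right cinner.scaleR_right cinner_adj_right
              cinner_self del: of_real_power)
        also have "\<dots> \<le> norm x * norm (bop_apply ?B x)"
          by (rule order_trans[OF complex_Re_le_cmod norm_cinner_le])
        finally have *: "norm x * (- r * norm x) \<le> norm x * norm (bop_apply ?B x)"
          by (simp add: power2_eq_square mult_ac)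
        show ?thesis
        proof (cases "x = 0")
          case False
          show ?thesis by (rule mult_left_le_imp_le[OF *]) (simp add: False)
        qed simp
      qed
      have "adj ?B = ?B"
        using selfadjoint_simps(5)[OF sa selfadjoint_simps(3)[OF selfadjoint_simps(1)]]
        by (simp add: selfadjoint_def)
      then have "invertible_bop ?B"
        using r below by (intro invertible_bop_bounded_below[of "- r"]) simp_all
      then show False using z zr by (simp add: spectrum_def scaleC_of_real)
    qed
    ultimately show "z \<in> complex_of_real ` {0..b\<^sup>2}" using zr by simp
  qed
  then show ?thesis using sa by (simp add: spectrum_within_def)
qed

lemma functional_calculus_adj_mult: 
  "functional_calculus (adj X * X) 0 ((norm X)\<^sup>2)"
  for X :: "'h::separable_infinite_dim_chilbert_space bop"
  by standard (rule spectrum_within_adj_mult, simp)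

lemma spectrum_within_abs: "spectrum_within (abs_bop X) 0 (norm X)"
  for X :: "'h::separable_infinite_dim_chilbert_space bop"
  unfolding abs_bop_def
  by (rule functional_calculus.spectrum_within_cfc[OF functional_calculus_adj_mult])
    (auto intro!: continuous_intros real_le_lsqrt)

lemma selfadjoint_abs: "selfadjoint (abs_bop X)"
  for X :: "'h::separable_infinite_dim_chilbert_space bop"
  using spectrum_within_abs[of X] by (simp add: spectrum_within_def)

lemma abs_mult_self: "abs_bop X * abs_bop X = adj X * X"
  for X :: "'h::separable_infinite_dim_chilbert_space bop"
proof -
  interpret functional_calculus "adj X * X" 0 "(norm X)\<^sup>2" by (rule functional_calculus_adj_mult)
  have "abs_bop X * abs_bop X = cfc (\<lambda>x. sqrt x * sqrt x) (adj X * X)"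
    unfolding abs_bop_def by (subst cfc_mult) (auto intro!: continuous_intros)
  also have "\<dots> = cfc (\<lambda>x. x) (adj X * X)" by (rule cfc_cong[OF within]) simp
  finally show ?thesis by (simp add: cfc_id)
qed

lemma norm_abs_apply: "norm (bop_apply (abs_bop X) x) = norm (bop_apply X x)"
  for X :: "'h::separable_infinite_dim_chilbert_space bop"
proof -
  have "cinner (bop_apply (abs_bop X) x) (bop_apply (abs_bop X) x) =
      cinner x (bop_apply (abs_bop X * abs_bop X) x)"
    by (simp add: selfadjoint_cinner[OF selfadjoint_abs] bop_apply_mult)
  also have "\<dots> = cinner (bop_apply X x) (bop_apply X x)"
    by (simp add: abs_mult_self bop_apply_mult cinner_adj_right)
  finally show ?thesis by (simp add: norm_eq_sqrt_cinner)
qed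

text \<open>Square roots are taken in \<open>X * (adj X * X) = (X * adj X) * X\<close>.\<close>

lemma abs_intertwine: "X * abs_bop X = abs_bop (adj X) * X"
  for X :: "'h::separable_infinite_dim_chilbert_space bop"
  unfolding abs_bop_def
  by (rule functional_calculus.cfc_intertwine[OF functional_calculus_adj_mult])
    (use spectrum_within_adj_mult[of "adj X" "norm X"] in
      \<open>auto simp: mult.assoc intro!: continuous_intros\<close>)

lemma cfc_abs_intertwine:
  fixes X :: "'h::separable_infinite_dim_chilbert_space bop"
  assumes "spectrum_within (abs_bop X) a b" "spectrum_within (abs_bop (adj X)) a b"
    and "continuous_on {a..b} f"
  shows "X * cfc f (abs_bop X) = cfc f (abs_bop (adj X)) * X"
  using assms abs_intertwine
  by (intro functional_calculus.cfc_intertwine[OF functional_calculus.intro])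

lemma spectrum_within_lower:
  fixes A :: "'h::separable_infinite_dim_chilbert_space bop"
  assumes "spectrum_within A c d"
  shows "c * norm x \<le> norm (bop_apply A x)"
proof -
  let ?m = "(c + d) / 2"
  have "norm (A - ?m *\<^sub>R 1) \<le> (d - c) / 2" using assms by (simp add: spectrum_within_iff_norm)
  then have "norm (bop_apply (A - ?m *\<^sub>R 1) x) \<le> (d - c) / 2 * norm x"
    by (meson mult_right_mono norm_bop_apply norm_ge_zero order_trans)
  moreover have "norm (?m *\<^sub>R x) - norm (bop_apply A x) \<le> norm (bop_apply (A - ?m *\<^sub>R 1) x)"
    using norm_triangle_ineq2[of "?m *\<^sub>R x" "bop_apply A x"]
    by (simp only: bop_apply_simps norm_minus_commute)
  moreover have "?m * norm x \<le> norm (?m *\<^sub>R x)" by (simp add: mult_right_mono)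
  ultimately show ?thesis by (simp add: field_simps)
qed

lemma spectrum_within_upper:
  fixes A :: "'h::separable_infinite_dim_chilbert_space bop"
  assumes A: "spectrum_within A c d" and c: "0 \<le> c"
  shows "norm A \<le> d"
proof -
  let ?m = "(c + d) / 2"
  have "c \<le> d" by (rule spectrum_within_le[OF A])
  have "norm (A - ?m *\<^sub>R 1) \<le> (d - c) / 2" using A by (simp add: spectrum_within_iff_norm)
  moreover have "norm A \<le> norm (A - ?m *\<^sub>R 1) + norm (?m *\<^sub>R 1 :: 'h bop)"
    using norm_triangle_ineq[of "A - ?m *\<^sub>R 1" "?m *\<^sub>R 1"] by simp
  ultimately show ?thesis using c \<open>c \<le> d\<close> by (simp add: field_simps)
qed

text \<open>For m \<ge> 0 this is the inclusion of the spectrum of the modulus in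
  \<open>{m..M}\<close>, by \<open>spectrum_within_abs_iff\<close>. It speaks of X and not of its
  modulus, so it can be followed through products, perturbations and limits.\<close>

definition norm_between :: "real \<Rightarrow> real \<Rightarrow> 'a::complex_inner bop \<Rightarrow> bool" where
  "norm_between m M X \<longleftrightarrow> (\<forall>x. m * norm x \<le> norm (bop_apply X x) \<and> norm (bop_apply X x) \<le> M * norm x)"

lemma norm_between_upper:
  fixes X :: "'h::separable_infinite_dim_chilbert_space bop"
  assumes "norm_between m M X"
  shows "norm X \<le> M" "0 \<le> M" "m \<le> M"
proof -
  obtain x :: 'h where x: "x \<noteq> 0" using ex_nonzero by blast
  have b: "m * norm x \<le> norm (bop_apply X x)" "norm (bop_apply X x) \<le> M * norm x"
    using assms by (auto simp: norm_between_def)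
  have "0 \<le> M * norm x" using b(2) norm_ge_zero order_trans by blast
  then show M: "0 \<le> M" using x by (simp add: zero_le_mult_iff)
  have "m * norm x \<le> M * norm x" using b by linarith
  then show "m \<le> M" using x by simp
  show "norm X \<le> M" using assms M by (intro norm_bop_le) (auto simp: norm_between_def)
qed

lemma spectrum_within_abs_iff:
  fixes X :: "'h::separable_infinite_dim_chilbert_space bop"
  assumes m: "0 \<le> m"
  shows "spectrum_within (abs_bop X) m M \<longleftrightarrow> norm_between m M X"
proof
  assume A: "spectrum_within (abs_bop X) m M"
  have "norm (bop_apply X x) \<le> M * norm x" for x
    using order_trans[OF norm_bop_apply mult_right_mono[OF spectrum_within_upper[OF A m]]]
    by (metis norm_abs_apply norm_ge_zero)
  then show "norm_between m M X"
    using spectrum_within_lower[OF A] by (simp add: norm_between_def norm_abs_apply)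
next
  assume X: "norm_between m M X"
  have "spectrum (abs_bop X) \<subseteq> complex_of_real ` {m..M}"
  proof
    fix z assume z: "z \<in> spectrum (abs_bop X)"
    then obtain r where r: "z = of_real r" "0 \<le> r" "r \<le> norm X"
      using spectrum_within_abs[of X] unfolding spectrum_within_def by auto
    \<comment> \<open>A spectral point r < m is impossible: the modulus minus r would be bounded
      below by m - r.\<close>
    have "m \<le> r"
    proof (rule ccontr)
      assume rm: "\<not> m \<le> r"
      let ?B = "abs_bop X - r *\<^sub>R 1"
      have below: "(m - r) * norm x \<le> norm (bop_apply ?B x)" for x
      proof -
        have "m * norm x \<le> norm (bop_apply (abs_bop X) x)"
          using X by (simp add: norm_between_def norm_abs_apply)
        also have "\<dots> \<le> norm (bop_apply ?B x) + norm (r *\<^sub>R x)"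
          using norm_triangle_ineq[of "bop_apply ?B x" "r *\<^sub>R x"] by (simp add: bop_apply_simps)
        finally show ?thesis using r by (simp add: algebra_simps)
      qed
      have "adj ?B = ?B"
        using selfadjoint_abs[of X] by (simp add: selfadjoint_def adj_diff adj_scaleR)
      then have "invertible_bop ?B"
        using rm below by (intro invertible_bop_bounded_below[of "m - r"]) simp_all
      then show False using z r by (simp add: spectrum_def scaleC_of_real)
    qed
    then show "z \<in> complex_of_real ` {m..M}" using r norm_between_upper(1)[OF X] by simp
  qed
  then show "spectrum_within (abs_bop X) m M" by (simp add: spectrum_within_def selfadjoint_abs)
qed

lemma moduli_spectra_in_iff:
  fixes X :: "'h::separable_infinite_dim_chilbert_space bop"
  assumes "0 \<le> m"
  shows "moduli_spectra_in X {m..M} \<longleftrightarrow> norm_between m M X \<and> norm_between m M (adj X)"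
  unfolding moduli_spectra_in_def spectrum_within_abs_iff[OF assms, symmetric] spectrum_within_def
  by (simp add: selfadjoint_abs)

lemma moduli_spectra_in_adj: "moduli_spectra_in (adj X) S \<longleftrightarrow> moduli_spectra_in X S"
  by (auto simp: moduli_spectra_in_def)

lemma norm_between_mono:
  assumes "norm_between m M X" "m' \<le> m" "M \<le> M'"
  shows "norm_between m' M' X"
  using assms unfolding norm_between_def
  by (meson mult_right_mono norm_ge_zero order_trans)


section \<open>Strong limits and the polar decomposition\<close>

text \<open>Contractivity makes the error of replacing y by a nearby point of D uniform in n, so the
  Cauchy property spreads from D to its closure.\<close>

lemma strong_limit_exists:
  fixes C :: "nat \<Rightarrow> 'a::chilbert_space bop"
  assumes bound: "\<And>n x. norm (bop_apply (C n) x) \<le> norm x"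
    and Cauchy: "\<And>x. x \<in> D \<Longrightarrow> Cauchy (\<lambda>n. bop_apply (C n) x)"
    and dense: "closure D = UNIV"
  shows "\<exists>U. \<forall>x. (\<lambda>n. bop_apply (C n) x) \<longlonglongrightarrow> bop_apply U x"
proof -
  have "Cauchy (\<lambda>n. bop_apply (C n) y)" for y
  proof (rule CauchyI)
    fix e :: real assume e: "0 < e"
    have "y \<in> closure D" using dense by simp
    then obtain x where x: "x \<in> D" "dist x y < e / 4"
      using e by (auto simp: closure_approachable dest: spec[of _ "e/4"])
    obtain M where M: "\<And>m n. M \<le> m \<Longrightarrow> M \<le> n \<Longrightarrow> norm (bop_apply (C m) x - bop_apply (C n) x) < e / 4"
      using CauchyD[OF Cauchy[OF x(1)], of "e / 4"] e by auto
    have xy: "norm (bop_apply (C k) (y - x)) \<le> e / 4" for k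
      using bound[of k "y - x"] x(2) by (simp add: dist_norm norm_minus_commute)
    show "\<exists>M. \<forall>m\<ge>M. \<forall>n\<ge>M. norm (bop_apply (C m) y - bop_apply (C n) y) < e"
    proof (intro exI allI impI)
      fix m n assume mn: "M \<le> m" "M \<le> n"
      have "bop_apply (C m) y - bop_apply (C n) y = (bop_apply (C m) (y - x) -
          bop_apply (C n) (y - x)) + (bop_apply (C m) x - bop_apply (C n) x)"
        by (simp add: bop_apply_simps)
      then have "norm (bop_apply (C m) y - bop_apply (C n) y) \<le>
          norm (bop_apply (C m) (y - x) - bop_apply (C n) (y - x)) +
          norm (bop_apply (C m) x - bop_apply (C n) x)"
        by (metis norm_triangle_ineq)
      moreover have "norm (bop_apply (C m) (y - x) - bop_apply (C n) (y - x)) \<le> e / 4 + e / 4"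
        by (rule order_trans[OF norm_triangle_ineq4 add_mono[OF xy xy]])
      ultimately show "norm (bop_apply (C m) y - bop_apply (C n) y) < e"
        using M[OF mn] e by simp
    qed
  qed
  then have "\<exists>l. (\<lambda>n. bop_apply (C n) y) \<longlonglongrightarrow> l" for y
    by (meson Cauchy_convergent convergent_def)
  then obtain f where f: "\<And>y. (\<lambda>n. bop_apply (C n) y) \<longlonglongrightarrow> f y" by metis
  have "f (x + y) = f x + f y" for x y
    using tendsto_add[OF f[of x] f[of y]] f[of "x + y"]
    by (auto simp: bop_apply_simps intro: LIMSEQ_unique)
  moreover have "f (c *\<^sub>C x) = c *\<^sub>C f x" for c x
    using bounded_linear.tendsto[OF bounded_linear_scaleC f[of x], of c] f[of "c *\<^sub>C x"]
    by (auto simp: bop_apply_simps intro: LIMSEQ_unique)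
  moreover have "norm (f x) \<le> 1 * norm x" for x
    using tendsto_upperbound[OF tendsto_norm[OF f]] bound by simp
  ultimately obtain U where "\<And>x. bop_apply U x = f x" using bop_exists by metis
  then show ?thesis using f by metis
qed

text \<open>The orthogonal projection of x is the vector of S that represents the functional
  \<open>cinner x\<close> on S.\<close>

lemma orthogonal_decomposition:
  fixes S :: "'a::chilbert_space set"
  assumes S: "complex_vector.subspace S" "closed S"
  shows "\<exists>y\<in>S. \<forall>v\<in>S. cinner (x - y) v = 0"
proof -
  obtain y where "y \<in> S" "\<forall>v\<in>S. cinner y v = cinner x v"
    using riesz_on_subspace[OF S cinner.bounded_linear_right[of x] cinner_scaleC_right] by blast
  then show ?thesis by (intro bexI[of _ y]) (simp_all add: cinner.diff_left)
qed

text \<open>The equality case of Cauchy-Schwarz: with \<open>?z\<close> of norm at most that of y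
  and \<open>Re (cinner ?z y) = (norm y)^2\<close>, the square of \<open>norm (?z - y)\<close>
  cannot be positive.\<close>

lemma norm_preserving_adj:
  assumes U: "norm U \<le> 1" and eq: "norm (bop_apply U y) = norm y"
  shows "bop_apply (adj U) (bop_apply U y) = y"
proof -
  let ?z = "bop_apply (adj U) (bop_apply U y)"
  have "norm ?z \<le> norm (adj U) * norm y" using norm_bop_apply[of "adj U" "bop_apply U y"] eq by simp
  also have "\<dots> \<le> norm y" using U by (simp add: mult_left_le_one_le)
  finally have "(norm ?z)\<^sup>2 \<le> (norm y)\<^sup>2" by (simp add: power_mono)
  moreover have "Re (cinner ?z y) = (norm y)\<^sup>2"
    by (simp add: cinner_adj_left cinner_self eq)
  ultimately have "(norm (?z - y))\<^sup>2 \<le> 0" by (simp add: norm_diff_sq)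
  then show ?thesis by simp
qed

text \<open>The partial isometry is the strong limit of \<open>X (\<bar>X\<bar> + \<epsilon>)\<^sup>-\<^sup>1\<close> as \<open>\<epsilon>\<close> tends to \<open>0\<close>.\<close>

lemma polar_decomposition:
  fixes X :: "'h::separable_infinite_dim_chilbert_space bop"
  shows "\<exists>U. norm U \<le> 1 \<and> U * abs_bop X = X \<and> adj U * X = abs_bop X"
proof -
  let ?P = "abs_bop X"
  interpret functional_calculus ?P 0 "norm X"
    by standard (rule spectrum_within_abs)
  define e where "e n = inverse (real (Suc n))" for n
  have e: "0 < e n" for n by (simp add: e_def)
  \<comment> \<open>\<open>c n\<close> is the inverse of the modulus shifted by \<open>e n\<close>;
    the shift is what replaces the possibly missing inverse of the modulus.\<close>
  define c where "c n = cfc (\<lambda>x. 1 / (x + e n)) ?P" for n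
  define C where "C n = X * c n" for n
  have cont: "continuous_on {0..norm X} (\<lambda>x. 1 / (x + e n))" for n
    using e[of n] by (intro continuous_intros ballI) (metis add_nonneg_pos atLeastAtMost_iff less_irrefl)
  have cfc_cP: "c n * ?P = cfc (\<lambda>x. 1 / (x + e n) * x) ?P" for n
    using cfc_mult[OF cont continuous_on_id] by (simp add: c_def cfc_id)
  have cP: "c n * ?P = 1 - e n *\<^sub>R c n" for n
  proof -
    have "cfc (\<lambda>x. 1 / (x + e n) * x) ?P = cfc (\<lambda>x. 1 - e n * (1 / (x + e n))) ?P"
    proof (rule cfc_cong[OF within])
      fix x assume "x \<in> {0..norm X}"
      then have "x + e n \<noteq> 0" using e[of n] by (metis add_nonneg_pos atLeastAtMost_iff less_irrefl)
      then show "1 / (x + e n) * x = 1 - e n * (1 / (x + e n))" by (simp add: field_simps)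
    qed
    also have "\<dots> = cfc (\<lambda>x. 1) ?P - cfc (\<lambda>x. e n * (1 / (x + e n))) ?P"
      by (intro cfc_diff continuous_on_const continuous_on_mult cont)
    also have "\<dots> = 1 - e n *\<^sub>R c n" unfolding c_def cfc_scaleR[OF cont] by (simp add: cfc_const)
    finally show ?thesis unfolding cfc_cP .
  qed
  have comm: "?P * c n = c n * ?P" for n
    unfolding c_def by (rule cfc_intertwine[OF cont within]) simp
  \<comment> \<open>X and its modulus have equal norms on every vector, so \<open>C n\<close> is as
    contractive as the function x / (x + e n).\<close>
  have bound: "norm (bop_apply (C n) x) \<le> norm x" for n x
  proof -
    have "norm (bop_apply (C n) x) = norm (bop_apply (?P * c n) x)"
      by (simp add: C_def bop_apply_mult norm_abs_apply)
    also have "?P * c n = cfc (\<lambda>x. 1 / (x + e n) * x) ?P"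
      by (simp only: comm cfc_cP)
    also have "norm (bop_apply \<dots> x) \<le> norm (cfc (\<lambda>x. 1 / (x + e n) * x) ?P) * norm x"
      by (rule norm_bop_apply)
    also have "\<dots> \<le> 1 * norm x"
    proof (intro mult_right_mono norm_cfc_le continuous_on_mult cont continuous_on_id norm_ge_zero)
      fix x assume "x \<in> {0..norm X}"
      then show "\<bar>1 / (x + e n) * x\<bar> \<le> 1"
        using e[of n] by (auto simp: abs_if divide_simps)
    qed
    finally show ?thesis by simp
  qed
  have on_range: "(\<lambda>n. bop_apply (C n) (bop_apply ?P x)) \<longlonglongrightarrow> bop_apply X x" for x
  proof -
    have CP: "C n * ?P = X - e n *\<^sub>R C n" for n
      by (simp add: C_def mult.assoc cP right_diff_distrib)
    have "bop_apply (C n) (bop_apply ?P x) = bop_apply X x - e n *\<^sub>R bop_apply (C n) x" for n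
      unfolding bop_apply_mult[symmetric] CP by (simp only: bop_apply_simps)
    moreover have "(\<lambda>n. e n *\<^sub>R bop_apply (C n) x) \<longlonglongrightarrow> 0"
    proof (rule Lim_null_comparison)
      show "\<forall>\<^sub>F n in sequentially. norm (e n *\<^sub>R bop_apply (C n) x) \<le> e n * norm x"
        using e bound by (intro always_eventually allI) (simp add: mult_left_mono less_imp_le)
      show "(\<lambda>n. e n * norm x) \<longlonglongrightarrow> 0"
        unfolding e_def by (rule tendsto_mult_left_zero[OF LIMSEQ_inverse_real_of_nat])
    qed
    then have "(\<lambda>n. bop_apply X x - e n *\<^sub>R bop_apply (C n) x) \<longlonglongrightarrow> bop_apply X x - 0"
      by (intro tendsto_diff tendsto_const)
    ultimately show ?thesis by simp
  qed
  define R where "R = range (bop_apply ?P)"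
  \<comment> \<open>The range of the modulus plus its orthogonal complement is dense. On the range
    \<open>C n\<close> converges to the wanted values, and on the complement it vanishes.\<close>
  define D where "D = {y + z |y z. y \<in> R \<and> (\<forall>v\<in>R. cinner z v = 0)}"
  have on_orth: "bop_apply (C n) z = 0" if z: "\<forall>v\<in>R. cinner z v = 0" for z n
  proof -
    have "cinner (bop_apply ?P z) y = cinner 0 y" for y
      using z by (simp add: selfadjoint_cinner[OF selfadjoint_abs] R_def cinner.zero_left)
    then have "bop_apply ?P z = 0" by (rule cinner_eqI_left)
    then have "bop_apply (?P * c n) z = 0" by (simp add: comm bop_apply_simps)
    then show ?thesis
      using norm_abs_apply[of X "bop_apply (c n) z"] by (simp add: C_def bop_apply_mult)
  qed
  have Cauchy: "Cauchy (\<lambda>n. bop_apply (C n) x)" if xD: "x \<in> D" for x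
  proof -
    obtain w z where x: "x = bop_apply ?P w + z" "\<forall>v\<in>R. cinner z v = 0"
      using xD by (auto simp: D_def R_def)
    have "(\<lambda>n. bop_apply (C n) x) \<longlonglongrightarrow> bop_apply X w"
      using on_range[of w] on_orth[OF x(2)] by (simp add: x(1) bop_apply_simps)
    then show ?thesis by (rule LIMSEQ_imp_Cauchy)
  qed
  have subR: "complex_vector.subspace (closure R)"
  proof (rule complex_vector.subspaceI)
    have "0 \<in> R" unfolding R_def by (rule range_eqI[of _ _ 0]) (simp only: bop_apply.zero_right)
    then show "0 \<in> closure R" by (rule subsetD[OF closure_subset])
    show "x + y \<in> closure R" if xy: "x \<in> closure R" "y \<in> closure R" for x y
    proof -
      obtain f where f: "\<forall>n. f n \<in> R" "f \<longlonglongrightarrow> x" using xy(1) unfolding closure_sequential by blast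
      obtain g where g: "\<forall>n. g n \<in> R" "g \<longlonglongrightarrow> y" using xy(2) unfolding closure_sequential by blast
      have "a + b \<in> R" if "a \<in> R" "b \<in> R" for a b
        using that unfolding R_def by (auto simp flip: bop_apply_add)
      then show ?thesis unfolding closure_sequential
        using f g by (intro exI[of _ "\<lambda>n. f n + g n"]) (simp add: tendsto_add)
    qed
    show "k *\<^sub>C x \<in> closure R" if x: "x \<in> closure R" for k x
    proof -
      obtain f where f: "\<forall>n. f n \<in> R" "f \<longlonglongrightarrow> x" using x unfolding closure_sequential by blast
      have "k *\<^sub>C a \<in> R" if "a \<in> R" for a
        using that unfolding R_def by (auto simp flip: bop_apply_scaleC_right)
      then show ?thesis unfolding closure_sequential
        using f bounded_linear.tendsto[OF bounded_linear_scaleC f(2)]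
        by (intro exI[of _ "\<lambda>n. k *\<^sub>C f n"]) simp
    qed
  qed
  have dense: "closure D = UNIV"
  proof -
    have "x \<in> closure D" for x
    proof -
      obtain y where y: "y \<in> closure R" "\<forall>v\<in>closure R. cinner (x - y) v = 0"
        using orthogonal_decomposition[OF subR closed_closure] by blast
      obtain f where f: "\<forall>n. f n \<in> R" "f \<longlonglongrightarrow> y" using y(1) unfolding closure_sequential by blast
      have "f n + (x - y) \<in> D" for n
        using f(1) y(2) closure_subset unfolding D_def by blast
      moreover have "(\<lambda>n. f n + (x - y)) \<longlonglongrightarrow> y + (x - y)" by (intro tendsto_intros f)
      ultimately show ?thesis unfolding closure_sequential
        by (intro exI[of _ "\<lambda>n. f n + (x - y)"]) simp
    qed
    then show ?thesis by blast
  qed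
  obtain U where U: "\<And>x. (\<lambda>n. bop_apply (C n) x) \<longlonglongrightarrow> bop_apply U x"
    using strong_limit_exists[OF bound Cauchy dense] by blast
  have UP: "U * ?P = X"
    by (rule bop_eqI) (metis LIMSEQ_unique U bop_apply_mult on_range)
  have U1: "norm U \<le> 1"
  proof (rule norm_bop_le)
    show "norm (bop_apply U x) \<le> 1 * norm x" for x
      using tendsto_upperbound[OF tendsto_norm[OF U]] bound by simp
  qed simp
  have "adj U * X = ?P"
  proof (rule bop_eqI)
    fix x
    have "norm (bop_apply U (bop_apply ?P x)) = norm (bop_apply ?P x)"
      by (metis UP bop_apply_mult norm_abs_apply)
    then have "bop_apply (adj U) (bop_apply U (bop_apply ?P x)) = bop_apply ?P x"
      by (rule norm_preserving_adj[OF U1])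
    then show "bop_apply (adj U * X) x = bop_apply ?P x" by (metis UP bop_apply_mult)
  qed
  then show ?thesis using U1 UP by blast
qed

section \<open>Normed ideals\<close>

locale operator_ideal = normed_ideal J N
  for J :: "'h::separable_infinite_dim_chilbert_space bop set" and N :: "'h bop \<Rightarrow> real"
begin

lemma J_zero: "0 \<in> J"
  and J_add: "X \<in> J \<Longrightarrow> Y \<in> J \<Longrightarrow> X + Y \<in> J"
  and J_diff: "X \<in> J \<Longrightarrow> Y \<in> J \<Longrightarrow> X - Y \<in> J"
  and J_scaleC: "X \<in> J \<Longrightarrow> c *\<^sub>C X \<in> J"
  using complex_vector.subspace_0[OF subspace] complex_vector.subspace_add[OF subspace]
    complex_vector.subspace_diff[OF subspace] complex_vector.subspace_scale[OF subspace] by auto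

lemma J_scaleR: "X \<in> J \<Longrightarrow> r *\<^sub>R X \<in> J"
  using J_scaleC[of X "complex_of_real r"] by (simp add: scaleC_of_real)

lemma N_scaleR: "X \<in> J \<Longrightarrow> N (r *\<^sub>R X) = \<bar>r\<bar> * N X"
  using norm_scaleC[of X "complex_of_real r"] by (simp add: scaleC_of_real)

lemma N_zero: "N 0 = 0"
  using norm_eq_0_iff[OF J_zero] by simp

lemma N_minus: "X \<in> J \<Longrightarrow> N (- X) = N X"
  using N_scaleR[of X "- 1"] by simp

lemma N_diff_commute: "X - Y \<in> J \<Longrightarrow> N (Y - X) = N (X - Y)"
  using N_minus[of "X - Y"] by simp

lemma N_diff_triangle: "X - Y \<in> J \<Longrightarrow> Y - Z \<in> J \<Longrightarrow> N (X - Z) \<le> N (X - Y) + N (Y - Z)"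
  using norm_triangle[of "X - Y" "Y - Z"] by simp

lemma N_diff_le: "X \<in> J \<Longrightarrow> Y \<in> J \<Longrightarrow> N (X - Y) \<le> N X + N Y"
  using norm_triangle[of X "- Y"] N_minus[of Y] J_scaleR[of Y "- 1"] by simp

lemma J_mult_left: "X \<in> J \<Longrightarrow> Y * X \<in> J"
  using ideal[of X Y 1] by simp

lemma J_mult_right: "X \<in> J \<Longrightarrow> X * Y \<in> J"
  using ideal[of X 1 Y] by simp

lemma N_mult_left: "X \<in> J \<Longrightarrow> N (Y * X) \<le> norm Y * N X"
  using norm_ideal[of X Y 1] by simp

lemma N_mult_right: "X \<in> J \<Longrightarrow> N (X * Y) \<le> N X * norm Y"
  using norm_ideal[of X 1 Y] by simp

text \<open>A test operator of known ideal norm: it serves to compare N with the operator norm, and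
  to read off values of a function from operators.\<close>

lemma rank_one_projection:
  fixes u :: 'h
  assumes u: "norm u = 1"
  obtains P where "rank_one P" "\<And>x. bop_apply P x = cinner u x *\<^sub>C u" "norm P = 1"
proof -
  have bound: "norm (cinner u x *\<^sub>C u) \<le> 1 * norm x" for x
    using norm_cinner_le[of u x] u by (simp add: Defs.norm_scaleC)
  obtain P where P: "\<And>x. bop_apply P x = cinner u x *\<^sub>C u"
    by (rule bop_exists[OF _ _ bound])
      (auto simp: cinner.add_right scaleC_add_left cinner_scaleC_right scaleC_scaleC)
  have self: "bop_apply P u = u" using u by (simp add: P cinner_self)
  have "range (bop_apply P) = complex_vector.span {u}"
  proof
    show "range (bop_apply P) \<subseteq> complex_vector.span {u}"
      by (auto simp: P complex_vector.span_singleton)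
    have "k *\<^sub>C u = bop_apply P (k *\<^sub>C u)" for k by (simp add: self bop_apply_scaleC_right)
    then show "complex_vector.span {u} \<subseteq> range (bop_apply P)"
      unfolding complex_vector.span_singleton by blast
  qed
  moreover have "u \<noteq> 0" using u by auto
  ultimately have "rank_one P" by (auto simp: rank_one_def)
  moreover have "norm P = 1"
  proof (rule antisym)
    show "norm P \<le> 1"
      by (rule norm_bop_le) (use norm_cinner_le[of u] u in \<open>simp_all add: P Defs.norm_scaleC\<close>)
    show "1 \<le> norm P" using norm_bop_apply[of P u] by (simp add: self u)
  qed
  ultimately show thesis using that P by blast
qed

lemma unit_vector_exists: "\<exists>u::'h. norm u = 1"
proof -
  obtain x :: 'h where "x \<noteq> 0" using ex_nonzero by blast
  then show ?thesis by (intro exI[of _ "x /\<^sub>R norm x"]) simp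
qed

text \<open>For a unit vector u with projection P, the operator \<open>X * P\<close> has rank one,
  where both norms agree. So the norm of X u is at most \<open>N (X * P)\<close>, hence at most
  \<open>N X\<close>.\<close>

lemma norm_le_N:
  assumes X: "X \<in> J"
  shows "norm X \<le> N X"
proof (rule norm_bop_le)
  show N0: "0 \<le> N X" by (rule norm_nonneg[OF X])
  show "norm (bop_apply X x) \<le> N X * norm x" for x
  proof (cases "bop_apply X x = 0")
    case True
    then show ?thesis using N0 by simp
  next
    case False
    then have "x \<noteq> 0" by (auto simp: bop_apply.zero_right)
    define u where "u = x /\<^sub>R norm x"
    have u: "norm u = 1" "x = norm x *\<^sub>R u" using \<open>x \<noteq> 0\<close> by (simp_all add: u_def)
    have Xu: "bop_apply X u \<noteq> 0" using False \<open>x \<noteq> 0\<close> by (simp add: u_def bop_apply_simps)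
    obtain P where P: "\<And>x. bop_apply P x = cinner u x *\<^sub>C u" "norm P = 1"
      using rank_one_projection[OF u(1)] by metis
    have XP: "bop_apply (X * P) y = cinner u y *\<^sub>C bop_apply X u" for y
      by (simp add: bop_apply_simps P)
    have XPu: "bop_apply (X * P) u = bop_apply X u" using u by (simp add: XP cinner_self)
    have "range (bop_apply (X * P)) = complex_vector.span {bop_apply X u}"
    proof
      show "range (bop_apply (X * P)) \<subseteq> complex_vector.span {bop_apply X u}"
        by (auto simp: XP complex_vector.span_singleton)
      have "k *\<^sub>C bop_apply X u = bop_apply (X * P) (k *\<^sub>C u)" for k
        by (simp only: XPu bop_apply_scaleC_right)
      then show "complex_vector.span {bop_apply X u} \<subseteq> range (bop_apply (X * P))"
        unfolding complex_vector.span_singleton by blast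
    qed
    then have "rank_one (X * P)" using Xu by (auto simp: rank_one_def)
    then have "norm (X * P) = N (X * P)" using rank_one by simp
    also have "\<dots> \<le> N X" using N_mult_right[OF X, of P] P by simp
    finally have "norm (bop_apply (X * P) u) \<le> N X"
      using norm_bop_apply[of "X * P" u] u by simp
    then have "norm x * norm (bop_apply X u) \<le> norm x * N X"
      by (simp add: XPu mult_left_mono)
    moreover have "norm (bop_apply X x) = norm x * norm (bop_apply X u)"
      by (subst u(2)) (simp add: bop_apply_simps)
    ultimately show ?thesis by (simp add: mult.commute)
  qed
qed

text \<open>With \<open>X = U \<bar>X\<bar>\<close> one has \<open>X\<^sup>* = \<bar>X\<bar> U\<^sup>* = U\<^sup>* X U\<^sup>*\<close>.\<close>

lemma adj_in_J:
  assumes X: "X \<in> J"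
  shows "adj X \<in> J" and "N (adj X) = N X"
proof -
  have *: "adj X \<in> J \<and> N (adj X) \<le> N X" if X: "X \<in> J" for X
  proof -
    obtain U where U: "norm U \<le> 1" "U * abs_bop X = X" "adj U * X = abs_bop X"
      using polar_decomposition[of X] by blast
    have "adj X = adj (U * abs_bop X)" by (simp only: U(2))
    also have "\<dots> = abs_bop X * adj U"
      using selfadjoint_abs[of X] by (simp add: adj_mult selfadjoint_def)
    finally have eq: "adj X = adj U * X * adj U" using U(3) by simp
    have "N (adj U * X * adj U) \<le> norm (adj U) * N X * norm (adj U)" by (rule norm_ideal[OF X])
    also have "\<dots> \<le> 1 * N X * 1"
      using U(1) norm_nonneg[OF X] by (intro mult_mono) auto
    finally show ?thesis using ideal[OF X, of "adj U" "adj U"] eq by simp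
  qed
  show "adj X \<in> J" using *[OF X] by simp
  show "N (adj X) = N X" using *[OF X] *[of "adj X"] by simp
qed

lemma adj_diff_in_J: "X - Y \<in> J \<Longrightarrow> adj X - adj Y \<in> J"
  and N_adj_diff: "X - Y \<in> J \<Longrightarrow> N (adj X - adj Y) = N (X - Y)"
  using adj_in_J[of "X - Y"] by (simp_all add: adj_diff)

lemma J_Cauchy_converges:
  assumes x: "\<And>n. x n \<in> J"
    and Cauchy: "\<And>e. 0 < e \<Longrightarrow> \<exists>M. \<forall>m\<ge>M. \<forall>n\<ge>M. N (x m - x n) < e"
  shows "\<exists>l\<in>J. (\<lambda>n. N (x n - l)) \<longlonglongrightarrow> 0"
proof -
  have "MCauchy x"
    unfolding MCauchy_def using x Cauchy by (auto simp: ideal_dist_def)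
  then obtain l where "limitin mtopology x l sequentially" using complete unfolding mcomplete_def by blast
  then have l: "l \<in> J" "\<And>e. 0 < e \<Longrightarrow> \<forall>\<^sub>F n in sequentially. ideal_dist J N (x n) l < e"
    by (auto simp: limitin_metric elim: eventually_mono)
  have "(\<lambda>n. N (x n - l)) \<longlonglongrightarrow> 0"
  proof (rule tendstoI)
    fix e :: real assume "0 < e"
    from l(2)[OF this] show "\<forall>\<^sub>F n in sequentially. dist (N (x n - l)) 0 < e"
      by eventually_elim (use x l(1) norm_nonneg J_diff in \<open>simp add: ideal_dist_def\<close>)
  qed
  then show ?thesis using l by blast
qed

text \<open>Summing the geometric tail bounds all later increments by a multiple of
  \<open>q ^ n\<close>.\<close>

lemma J_geometric_converges:
  assumes x: "\<And>n. x n \<in> J" and step: "\<And>n. N (x (Suc n) - x n) \<le> c * q ^ n" and q: "0 \<le> q" "q < 1"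
  shows "\<exists>l\<in>J. (\<lambda>n. N (x n - l)) \<longlonglongrightarrow> 0"
proof -
  have c: "0 \<le> c" using step[of 0] norm_nonneg[OF J_diff[OF x x], of "Suc 0" 0] by simp
  have tri: "N (x i - x k) \<le> N (x i - x j) + N (x j - x k)" for i j k
    by (rule N_diff_triangle[OF J_diff[OF x x] J_diff[OF x x]])
  have bound: "N (x (n + k) - x n) \<le> c / (1 - q) * q ^ n" for n k
  proof -
    have "N (x (n + k) - x n) \<le> (\<Sum>i<k. c * q ^ (n + i))"
    proof (induction k)
      case (Suc k)
      then show ?case
        using tri[of "n + Suc k" n "n + k"] step[of "n + k"] by simp
    qed (simp add: N_zero)
    also have "\<dots> = c * q ^ n * (\<Sum>i<k. q ^ i)" by (simp add: sum_distrib_left power_add mult_ac)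
    also have "\<dots> \<le> c * q ^ n * (1 / (1 - q))"
      using c q by (intro mult_left_mono) (simp_all add: sum_gp_strict divide_simps)
    finally show ?thesis by simp
  qed
  have lim: "(\<lambda>n. c / (1 - q) * q ^ n) \<longlonglongrightarrow> 0"
    using q by (intro tendsto_mult_right_zero LIMSEQ_realpow_zero) auto
  show ?thesis
  proof (rule J_Cauchy_converges[OF x])
    fix e :: real assume "0 < e"
    then obtain M where M: "c / (1 - q) * q ^ M < e / 2"
      using order_tendstoD(2)[OF lim, of "e / 2"] by (auto simp: eventually_sequentially)
    show "\<exists>M. \<forall>m\<ge>M. \<forall>n\<ge>M. N (x m - x n) < e"
    proof (intro exI allI impI)
      fix m n assume mn: "M \<le> m" "M \<le> n"
      have "N (x k - x M) < e / 2" if k: "M \<le> k" for k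
        using bound[of M "k - M"] M unfolding le_add_diff_inverse[OF k] by linarith
      then show "N (x m - x n) < e"
        using tri[of m n M] mn N_diff_commute[OF J_diff[OF x x], of M n]
        by (smt (verit) field_sum_of_halves)
    qed
  qed
qed

end

text \<open>Makes the ideal-norm results available for the operator norm; the conjugating family is
  obtained this way when \<phi>(T) is not in J.\<close>

lemma operator_ideal_UNIV:
  "operator_ideal (UNIV :: 'h::separable_infinite_dim_chilbert_space bop set) norm"
proof -
  have M: "Metric_space (UNIV :: 'h bop set) (ideal_dist UNIV norm)"
    by unfold_locales (auto simp: ideal_dist_def norm_minus_commute intro: norm_triangle_sub
        order_trans[OF _ norm_triangle_ineq])
  have "Metric_space.mcomplete (UNIV :: 'h bop set) (ideal_dist UNIV norm)"
    unfolding Metric_space.mcomplete_def[OF M]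
  proof (intro allI impI)
    fix \<sigma> :: "nat \<Rightarrow> 'h bop"
    assume "Metric_space.MCauchy UNIV (ideal_dist UNIV norm) \<sigma>"
    then have "Cauchy \<sigma>"
      unfolding Metric_space.MCauchy_def[OF M] by (auto simp: ideal_dist_def Cauchy_def dist_norm)
    then obtain l where "\<sigma> \<longlonglongrightarrow> l" by (meson Cauchy_convergent convergent_def)
    then show "\<exists>x. limitin (Metric_space.mtopology UNIV (ideal_dist UNIV norm)) \<sigma> x sequentially"
      unfolding Metric_space.limitin_metric[OF M]
      by (auto simp: ideal_dist_def tendsto_iff dist_norm)
  qed
  moreover have "norm (Y * X * Z) \<le> norm Y * norm X * norm Z" for X Y Z :: "'h bop"
    by (rule order_trans[OF norm_mult_ineq mult_right_mono[OF norm_mult_ineq]]) simp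
  ultimately show ?thesis
    by unfold_locales (auto simp: norm_triangle_ineq norm_bop_scaleC)
qed

section \<open>Isometries with orthogonal ranges\<close>

text \<open>\<open>sgn\<close> normalises the residual and sends 0 to 0, so a linearly dependent
  entry produces a zero vector, to be discarded later.\<close>

fun gram_schmidt :: "(nat \<Rightarrow> 'a::complex_inner) \<Rightarrow> nat \<Rightarrow> 'a" where
  "gram_schmidt d n = sgn (d n - (\<Sum>i<n. cinner (gram_schmidt d i) (d n) *\<^sub>C gram_schmidt d i))"

declare gram_schmidt.simps [simp del]

lemma bounded_linear_scaleC_left: "bounded_linear (\<lambda>c. c *\<^sub>C (x::'a::complex_inner))"
proof (rule bounded_linear_intro[where K = "norm x"])
  show "(r *\<^sub>R c) *\<^sub>C x = r *\<^sub>R c *\<^sub>C x" for r c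
    by (simp only: scaleR_conv_of_real scaleC_scaleC[symmetric] scaleC_of_real)
qed (simp_all add: scaleC_add_left norm_scaleC)

lemma norm_gram_schmidt: "gram_schmidt d n = 0 \<or> norm (gram_schmidt d n) = 1"
  by (subst (1 2) gram_schmidt.simps) (simp add: norm_sgn sgn_zero_iff)

lemma gram_schmidt_orthogonal: "i < j \<Longrightarrow> cinner (gram_schmidt d i) (gram_schmidt d j) = 0"
proof (induction j arbitrary: i rule: less_induct)
  case (less j)
  let ?u = "gram_schmidt d" and ?r = "d j - (\<Sum>k<j. cinner (gram_schmidt d k) (d j) *\<^sub>C gram_schmidt d k)"
  have orth: "cinner (?u i) (?u k) = 0" if "k < j" "k \<noteq> i" for k
  proof (cases "i < k")
    case True
    then show ?thesis using less.IH[OF \<open>k < j\<close>] by simp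
  next
    case False
    then have "cinner (?u k) (?u i) = 0" using that less.IH[OF less.prems, of k] by simp
    then show ?thesis by (metis cinner_commute complex_cnj_zero)
  qed
  have "(\<Sum>k<j. cinner (?u k) (d j) * cinner (?u i) (?u k)) =
      (\<Sum>k\<in>{i}. cinner (?u k) (d j) * cinner (?u i) (?u k))"
    using less.prems orth by (intro sum.mono_neutral_right) auto
  then have "cinner (?u i) ?r = cinner (?u i) (d j) - cinner (?u i) (d j) * cinner (?u i) (?u i)"
    by (simp add: cinner.diff_right cinner.sum_right cinner_scaleC_right)
  also have "\<dots> = 0"
    using norm_gram_schmidt[of d i] by (auto simp: cinner_self cinner.zero_left)
  finally have "cinner (?u i) ?r = 0" .
  then show ?case
    by (subst (2) gram_schmidt.simps) (simp add: sgn_div_norm cinner.scaleR_right)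
qed

lemma span_gram_schmidt: "d n \<in> complex_vector.span (range (gram_schmidt d))"
proof -
  let ?u = "gram_schmidt d" and ?r = "d n - (\<Sum>k<n. cinner (gram_schmidt d k) (d n) *\<^sub>C gram_schmidt d k)"
  have in_span: "?u k \<in> complex_vector.span (range ?u)" for k by (rule complex_vector.span_base) simp
  have sgn: "x = complex_of_real (norm x) *\<^sub>C sgn x" for x :: 'a
    by (cases "x = 0") (simp_all add: scaleC_of_real sgn_div_norm)
  have "?r = complex_of_real (norm ?r) *\<^sub>C ?u n"
    by (subst gram_schmidt.simps) (rule sgn)
  moreover have "complex_of_real (norm ?r) *\<^sub>C ?u n \<in> complex_vector.span (range ?u)"
    by (rule complex_vector.span_scale[OF in_span])
  ultimately have "?r \<in> complex_vector.span (range ?u)" by (rule ssubst)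
  moreover have "(\<Sum>k<n. cinner (?u k) (d n) *\<^sub>C ?u k) \<in> complex_vector.span (range ?u)"
    by (intro complex_vector.span_sum complex_vector.span_scale in_span)
  ultimately have "?r + (\<Sum>k<n. cinner (?u k) (d n) *\<^sub>C ?u k) \<in> complex_vector.span (range ?u)"
    by (rule complex_vector.span_add)
  then show ?thesis by simp
qed

section \<open>Total sequences and orthonormal bases\<close>

lemma total_induct:
  assumes "closure (complex_vector.span (range e)) = UNIV"
    and "complex_vector.subspace S" "closed S" "\<And>k. e k \<in> S"
  shows "x \<in> S"
proof -
  have "complex_vector.span (range e) \<subseteq> S"
    by (rule complex_vector.span_minimal[OF _ assms(2)]) (use assms(4) in blast)
  then have "closure (complex_vector.span (range e)) \<subseteq> S"
    using assms(3) by (rule closure_minimal)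
  then show ?thesis using assms(1) by blast
qed

lemma closed_subspace_bop_eq:
  fixes A B :: "'a::complex_inner bop"
  shows "complex_vector.subspace {x. bop_apply A x = bop_apply B x}"
    and "closed {x. bop_apply A x = bop_apply B x}"
proof -
  show "complex_vector.subspace {x. bop_apply A x = bop_apply B x}"
    by (rule complex_vector.subspaceI)
      (simp_all add: bop_apply.zero_right bop_apply_add bop_apply_scaleC_right)
  show "closed {x. bop_apply A x = bop_apply B x}"
    by (rule closed_Collect_eq; rule linear_continuous_on[OF bop_apply.bounded_linear_right])
qed

lemma bop_eq_on_total:
  assumes "closure (complex_vector.span (range e)) = UNIV" "\<And>k. bop_apply A (e k) = bop_apply B (e k)"
  shows "A = B"
proof (rule bop_eqI)
  have "e k \<in> {x. bop_apply A x = bop_apply B x}" for k using assms(2) by simp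
  then have "x \<in> {x. bop_apply A x = bop_apply B x}" for x
    by (rule total_induct[OF assms(1) closed_subspace_bop_eq])
  then show "bop_apply A x = bop_apply B x" for x by simp
qed

lemma orthogonal_to_total:
  fixes z :: "'a::complex_inner"
  assumes "closure (complex_vector.span (range e)) = UNIV" "\<And>k. cinner (e k) z = 0"
  shows "z = 0"
proof -
  let ?S = "{x. cinner x z = 0}"
  have sub: "complex_vector.subspace ?S"
    by (rule complex_vector.subspaceI)
      (simp_all add: cinner.zero_left cinner.add_left cinner_scaleC_left)
  have "continuous_on UNIV (\<lambda>x. cinner x z)"
    by (rule linear_continuous_on) (rule cinner.bounded_linear_left)
  then have cl: "closed ?S" by (rule closed_Collect_eq) (rule continuous_on_const)
  have "e k \<in> ?S" for k using assms(2) by simp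
  then have "z \<in> ?S" by (rule total_induct[OF assms(1) sub cl])
  then have "cinner z z = 0" by simp
  then show ?thesis by (simp add: cinner_self)
qed

text \<open>Gram-Schmidt is run on a dense sequence, the zero vectors are deleted and the rest is
  renumbered. Infinite dimension guarantees that infinitely many remain.\<close>

lemma orthonormal_basis_exists:
  "\<exists>e :: nat \<Rightarrow> 'h::separable_infinite_dim_chilbert_space.
    (\<forall>i j. cinner (e i) (e j) = (if i = j then 1 else 0)) \<and>
    closure (complex_vector.span (range e)) = UNIV"
proof -
  obtain D :: "'h set" where D: "countable D" "\<And>x e. 0 < e \<Longrightarrow> \<exists>y\<in>D. dist y x < e"
    using separable by blast
  have clD: "closure D = UNIV" using D(2) by (auto simp: closure_approachable)
  have "D \<noteq> {}" using D(2)[of 1] by auto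
  define d where "d = from_nat_into D"
  have ranged: "range d = D" unfolding d_def by (rule range_from_nat_into[OF \<open>D \<noteq> {}\<close> D(1)])
  define u where "u = gram_schmidt d"
  define I where "I = {n. u n \<noteq> 0}"
  have unit: "cinner (u i) (u i) = 1" if "i \<in> I" for i
    using norm_gram_schmidt[of d i] that by (simp add: I_def u_def cinner_self)
  have orth: "cinner (u i) (u j) = 0" if "i \<noteq> j" for i j
  proof (cases "i < j")
    case False
    then have "cinner (u j) (u i) = 0" using that gram_schmidt_orthogonal[of j i d] by (simp add: u_def)
    then show ?thesis by (subst cinner_commute) simp
  qed (simp add: u_def gram_schmidt_orthogonal)
  have "range u \<subseteq> insert 0 (u ` I)" by (auto simp: I_def)
  then have spanI: "complex_vector.span (range u) \<subseteq> complex_vector.span (u ` I)"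
    by (metis complex_vector.span_insert_0 complex_vector.span_mono)
  have d_span: "d n \<in> complex_vector.span (u ` I)" for n
    using span_gram_schmidt[of d n] spanI by (auto simp: u_def)
  \<comment> \<open>Otherwise the finite-rank map \<open>?p\<close> would fix a dense set and hence,
    by continuity, every vector.\<close>
  have "infinite I"
  proof
    assume fin: "finite I"
    let ?p = "\<lambda>x. \<Sum>i\<in>I. cinner (u i) x *\<^sub>C u i"
    let ?S = "{x. ?p x = x}"
    have sub: "complex_vector.subspace ?S"
    proof (rule complex_vector.subspaceI)
      show "c *\<^sub>C x \<in> ?S" if "x \<in> ?S" for c x
      proof -
        have "?p (c *\<^sub>C x) = c *\<^sub>C ?p x"
          by (simp add: cinner_scaleC_right complex_vector.scale_sum_right scaleC_scaleC)
        then show ?thesis using that by simp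
      qed
    qed (auto simp: cinner.zero_right cinner.add_right scaleC_add_left sum.distrib)
    have "u k \<in> ?S" if "k \<in> I" for k
    proof -
      have "?p (u k) = (\<Sum>i\<in>{k}. cinner (u i) (u k) *\<^sub>C u i)"
        using that fin orth by (intro sum.mono_neutral_right) auto
      then show ?thesis using unit[OF that] by simp
    qed
    then have "complex_vector.span (u ` I) \<subseteq> ?S"
      using sub by (intro complex_vector.span_minimal) auto
    then have "D \<subseteq> ?S" using d_span ranged by blast
    moreover have "closed ?S"
    proof (intro closed_Collect_eq continuous_on_sum continuous_on_id)
      have "bounded_linear (\<lambda>x. cinner (u i) x *\<^sub>C u i)" for i
        by (rule bounded_linear_compose[OF bounded_linear_scaleC_left cinner.bounded_linear_right])
      then show "continuous_on UNIV (\<lambda>x. cinner (u i) x *\<^sub>C u i)" for i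
        by (rule linear_continuous_on)
    qed
    ultimately have "closure D \<subseteq> ?S" by (rule closure_minimal)
    then have all: "?p x = x" for x using clD by blast
    have "\<exists>x. \<forall>c. x \<noteq> (\<Sum>b\<in>u ` I. c b *\<^sub>C b)"
      using fin by (intro infinite_dim) simp
    then obtain x where x: "\<forall>c. x \<noteq> (\<Sum>b\<in>u ` I. c b *\<^sub>C b)" ..
    \<comment> \<open>\<open>infinite_dim\<close> speaks of sums over a set of vectors; injectivity
      converts them into sums over indices.\<close>
    have "inj_on u I"
    proof (rule inj_onI, rule ccontr)
      fix i j assume "i \<in> I" "j \<in> I" "u i = u j" "i \<noteq> j"
      then show False using orth[of i j] unit[of j] by simp
    qed
    then have "(\<Sum>b\<in>u ` I. cinner b x *\<^sub>C b) = ?p x" by (simp add: sum.reindex)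
    then show False using x[rule_format, of "\<lambda>b. cinner b x"] all by simp
  qed
  define e where "e = u \<circ> enumerate I"
  have mem: "enumerate I k \<in> I" for k by (rule enumerate_in_set[OF \<open>infinite I\<close>])
  have "cinner (e i) (e j) = (if i = j then 1 else 0)" for i j
    using unit[OF mem] orth inj_enumerate[OF \<open>infinite I\<close>] by (simp add: e_def inj_eq)
  moreover have "closure (complex_vector.span (range e)) = UNIV"
  proof -
    have "range (enumerate I) = I"
      using bij_enumerate[OF \<open>infinite I\<close>] by (rule bij_betw_imp_surj_on)
    then have "range e = u ` I" unfolding e_def image_comp[symmetric] by simp
    then have "D \<subseteq> complex_vector.span (range e)" using d_span ranged by auto
    then show ?thesis using clD closure_mono by blast
  qed
  ultimately show ?thesis by blast
qed

section \<open>Isometries given by orthonormal sequences\<close>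

lemma norm_sum_orthonormal:
  fixes f :: "nat \<Rightarrow> 'a::complex_inner"
  assumes f: "\<And>i j. cinner (f i) (f j) = (if i = j then 1 else 0)"
  shows "(norm (\<Sum>i<n. c i *\<^sub>C f i))\<^sup>2 = (\<Sum>i<n. (cmod (c i))\<^sup>2)"
proof (induction n)
  case (Suc n)
  have "cinner (\<Sum>i<n. c i *\<^sub>C f i) (c n *\<^sub>C f n) = 0"
    by (simp add: cinner.sum_left cinner_scaleC_left cinner_scaleC_right f)
  moreover have "norm (f n) = 1"
    using f[of n n] by (simp add: norm_eq_sqrt_cinner)
  ultimately show ?case using Suc by (simp add: norm_add_sq norm_scaleC)
qed simp

lemma bessel_inequality:
  fixes e :: "nat \<Rightarrow> 'a::complex_inner"
  assumes e: "\<And>i j. cinner (e i) (e j) = (if i = j then 1 else 0)"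
  shows "(\<Sum>i<n. (cmod (cinner (e i) x))\<^sup>2) \<le> (norm x)\<^sup>2"
proof -
  let ?s = "\<Sum>i<n. cinner (e i) x *\<^sub>C e i"
  have "cinner x ?s = (\<Sum>i<n. complex_of_real ((cmod (cinner (e i) x))\<^sup>2))"
    by (simp add: cinner.sum_right cinner_scaleC_right cinner_commute[of x] complex_norm_square
        del: of_real_power)
  then have "Re (cinner x ?s) = (\<Sum>i<n. (cmod (cinner (e i) x))\<^sup>2)" by (simp del: of_real_power)
  moreover have "0 \<le> (norm (x - ?s))\<^sup>2" by simp
  ultimately show ?thesis
    unfolding norm_diff_sq norm_sum_orthonormal[OF e] by simp
qed

text \<open>V is the strong limit of the partial sums of
  \<open>cinner (e i) x *\<^sub>C f i\<close>, which are contractions by Bessel's inequality. It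
  preserves the norm of each \<open>e k\<close>, so \<open>adj V * V\<close> fixes a total
  sequence.\<close>

lemma isometry_exists:
  fixes e f :: "nat \<Rightarrow> 'a::chilbert_space"
  assumes e: "\<And>i j. cinner (e i) (e j) = (if i = j then 1 else 0)"
    and total: "closure (complex_vector.span (range e)) = UNIV"
    and f: "\<And>i j. cinner (f i) (f j) = (if i = j then 1 else 0)"
  shows "\<exists>V. norm V \<le> 1 \<and> adj V * V = 1 \<and> (\<forall>k. bop_apply V (e k) = f k)"
proof -
  let ?g = "\<lambda>(n::nat) x. \<Sum>i<n. cinner (e i) x *\<^sub>C f i"
  have bound: "norm (?g n x) \<le> 1 * norm x" for n x
    by (rule power2_le_imp_le) (simp_all add: norm_sum_orthonormal[OF f] bessel_inequality[OF e])
  have "\<exists>C. \<forall>x. bop_apply C x = ?g n x" for n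
  proof -
    obtain C where "\<And>x. bop_apply C x = ?g n x"
      by (rule bop_exists[OF _ _ bound[where n = n]])
        (auto simp: cinner.add_right scaleC_add_left sum.distrib cinner_scaleC_right
          scaleC_scaleC complex_vector.scale_sum_right)
    then show ?thesis by blast
  qed
  then obtain C where C: "\<And>n x. bop_apply (C n) x = ?g n x" by metis
  have Ce: "(\<lambda>n. bop_apply (C n) (e k)) \<longlonglongrightarrow> f k" for k
  proof (rule tendsto_eventually)
    have "bop_apply (C n) (e k) = f k" if "k < n" for n
    proof -
      have "?g n (e k) = (\<Sum>i\<in>{k}. cinner (e i) (e k) *\<^sub>C f i)"
        using that e by (intro sum.mono_neutral_right) auto
      then show ?thesis by (simp add: C e)
    qed
    then show "\<forall>\<^sub>F n in sequentially. bop_apply (C n) (e k) = f k"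
      by (auto simp: eventually_sequentially intro!: exI[of _ "Suc k"])
  qed
  let ?S = "{x. convergent (\<lambda>n. bop_apply (C n) x)}"
  have "complex_vector.subspace ?S"
  proof (rule complex_vector.subspaceI)
    show "c *\<^sub>C x \<in> ?S" if x: "x \<in> ?S" for c x
    proof -
      obtain l where "(\<lambda>n. bop_apply (C n) x) \<longlonglongrightarrow> l" using x by (auto simp: convergent_def)
      from bounded_linear.tendsto[OF bounded_linear_scaleC this, of c]
      show ?thesis by (auto simp: convergent_def bop_apply_scaleC_right)
    qed
  qed (simp_all add: bop_apply.zero_right bop_apply_add convergent_const convergent_add)
  then have "complex_vector.span (range e) \<subseteq> ?S"
    using Ce by (intro complex_vector.span_minimal) (auto simp: convergent_def)
  then have "Cauchy (\<lambda>n. bop_apply (C n) x)" if "x \<in> complex_vector.span (range e)" for x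
    using that by (intro convergent_Cauchy) blast
  then have "\<exists>V. \<forall>x. (\<lambda>n. bop_apply (C n) x) \<longlonglongrightarrow> bop_apply V x"
    using bound by (intro strong_limit_exists[OF _ _ total]) (simp_all add: C)
  then obtain V where V: "\<And>x. (\<lambda>n. bop_apply (C n) x) \<longlonglongrightarrow> bop_apply V x" by metis
  have V1: "norm V \<le> 1"
  proof (rule norm_bop_le)
    show "norm (bop_apply V x) \<le> 1 * norm x" for x
      using tendsto_upperbound[OF tendsto_norm[OF V]] bound by (simp add: C)
  qed simp
  have Ve: "bop_apply V (e k) = f k" for k by (rule LIMSEQ_unique[OF V Ce])
  have "norm (e k) = 1" "norm (f k) = 1" for k
    using e[of k k] f[of k k] by (simp_all add: norm_eq_sqrt_cinner)
  then have "bop_apply (adj V) (bop_apply V (e k)) = e k" for k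
    by (intro norm_preserving_adj[OF V1]) (simp add: Ve)
  then have "adj V * V = 1"
    by (intro bop_eq_on_total[OF total]) (simp add: bop_apply_simps)
  then show ?thesis using V1 Ve by blast
qed

text \<open>V and W send an orthonormal basis to its members of even and of odd index. They embed
  two orthogonal copies of H into H, which is how 2 by 2 operator matrices are realised without
  leaving the space on which J lives.\<close>

lemma orthogonal_isometries_exist:
  "\<exists>V W :: 'h::separable_infinite_dim_chilbert_space bop.
    norm V \<le> 1 \<and> norm W \<le> 1 \<and> adj V * V = 1 \<and> adj W * W = 1 \<and> adj V * W = 0 \<and> adj W * V = 0"
proof -
  obtain e :: "nat \<Rightarrow> 'h" where e: "\<And>i j. cinner (e i) (e j) = (if i = j then 1 else 0)"
    and total: "closure (complex_vector.span (range e)) = UNIV"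
    using orthonormal_basis_exists by blast
  have "cinner (e (2 * i)) (e (2 * j)) = (if i = j then 1 else 0)"
    "cinner (e (2 * i + 1)) (e (2 * j + 1)) = (if i = j then 1 else 0)" for i j
    using e by simp_all
  note ex = isometry_exists[OF e total this(1)] isometry_exists[OF e total this(2)]
  obtain V where V: "norm V \<le> 1" "adj V * V = 1" "\<forall>k. bop_apply V (e k) = e (2 * k)"
    using ex(1) by blast
  obtain W where W: "norm W \<le> 1" "adj W * W = 1" "\<forall>k. bop_apply W (e k) = e (2 * k + 1)"
    using ex(2) by blast
  have "bop_apply (adj V * W) (e k) = 0" for k
  proof (rule orthogonal_to_total[OF total])
    fix j
    have "2 * j \<noteq> 2 * k + 1" by presburger
    then show "cinner (e j) (bop_apply (adj V * W) (e k)) = 0"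
      by (simp add: bop_apply_mult cinner_adj_right V W e)
  qed
  then have VW: "adj V * W = 0"
    by (intro bop_eq_on_total[OF total]) (simp add: bop_apply.zero_left)
  then have "adj (adj V * W) = 0" by simp
  then have "adj W * V = 0" by (simp add: adj_mult)
  then show ?thesis using V W VW by blast
qed

section \<open>Lipschitz estimates in the ideal norm\<close>

context operator_ideal
begin

text \<open>With \<open>s = (a + b) / 2\<close> and \<open>A' = s - A\<close>, \<open>B' = s - B\<close>, the difference \<open>\<Delta> = A - B\<close> is the fixed
  point of the contraction \<open>\<Delta> \<mapsto> (A\<^sup>2 - B\<^sup>2 + A' \<Delta> + \<Delta> B') / 2 s\<close>, which maps \<open>J\<close> to itself.\<close>

lemma square_diff_in_J:
  assumes a: "0 < a" and A: "spectrum_within A a b" and B: "spectrum_within B a b"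
    and D: "A * A - B * B \<in> J"
  shows "A - B \<in> J" and "2 * a * N (A - B) \<le> N (A * A - B * B)"
proof -
  define s where "s = (a + b) / 2"
  define h where "h = (b - a) / 2"
  define A' B' D where "A' = s *\<^sub>R 1 - A" and "B' = s *\<^sub>R 1 - B" and "D = A * A - B * B"
  have DJ: "D \<in> J" using assms by (simp add: D_def)
  have ab: "a \<le> b" by (rule spectrum_within_le[OF A])
  \<comment> \<open>The identity \<open>s - h = a\<close> is the source of the constant
    \<open>2 * a\<close>; h < s, which needs a > 0, makes the map a contraction.\<close>
  have s: "0 < s" "0 \<le> h" "h < s" "s - h = a" using a ab by (auto simp: s_def h_def field_simps)
  have nA: "norm A' \<le> h" "norm B' \<le> h"
    using A B by (simp_all add: spectrum_within_iff_norm A'_def B'_def s_def h_def norm_minus_commute)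
  define \<Delta> where "\<Delta> = A - B"
  define F where "F x = (1 / (2 * s)) *\<^sub>R (D + A' * x + x * B')" for x
  have fix_D: "(2 * s) *\<^sub>R \<Delta> = D + A' * \<Delta> + \<Delta> * B'"
    by (simp add: \<Delta>_def D_def A'_def B'_def algebra_simps flip: scaleR_2)
  then have fix_F: "F \<Delta> = \<Delta>"
    unfolding F_def fix_D[symmetric] using s by simp
  have F_diff: "F x - F y = (1 / (2 * s)) *\<^sub>R (A' * (x - y) + (x - y) * B')" for x y
    unfolding F_def scaleR_diff_right[symmetric] by (simp add: algebra_simps)
  have FJ: "F x \<in> J" if "x \<in> J" for x
    unfolding F_def by (intro J_scaleR J_add J_mult_left J_mult_right DJ that)
  have contract: "N (F x - F y) \<le> h / s * N (x - y)" if xy: "x - y \<in> J" for x y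
  proof -
    have "N (A' * (x - y) + (x - y) * B') \<le> N (A' * (x - y)) + N ((x - y) * B')"
      by (intro norm_triangle J_mult_left J_mult_right xy)
    also have "\<dots> \<le> h * N (x - y) + N (x - y) * h"
      using nA s(2) norm_nonneg[OF xy]
      by (intro add_mono order_trans[OF N_mult_left[OF xy]] order_trans[OF N_mult_right[OF xy]]
          mult_mono) auto
    finally have "N (A' * (x - y) + (x - y) * B') / (2 * s) \<le> (h * N (x - y) + N (x - y) * h) / (2 * s)"
      using s by (intro divide_right_mono) auto
    moreover have "N (F x - F y) = N (A' * (x - y) + (x - y) * B') / (2 * s)"
      unfolding F_diff N_scaleR[OF J_add[OF J_mult_left[OF xy] J_mult_right[OF xy]]] using s by simp
    moreover have "(h * N (x - y) + N (x - y) * h) / (2 * s) = h / s * N (x - y)"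
      using s by (simp add: field_simps)
    ultimately show ?thesis by simp
  qed
  \<comment> \<open>\<open>\<Delta>\<close> is not yet known to lie in J, so the contraction is also
    needed in the operator norm. The iterates from 0 converge to \<open>\<Delta>\<close> there and
    to some element of J in the norm N, and both limits agree.\<close>
  have contract': "norm (F x - F y) \<le> h / s * norm (x - y)" for x y
  proof -
    have "norm (A' * (x - y) + (x - y) * B') \<le> norm A' * norm (x - y) + norm (x - y) * norm B'"
      by (rule order_trans[OF norm_triangle_ineq]) (intro add_mono norm_mult_ineq)
    also have "\<dots> \<le> h * norm (x - y) + norm (x - y) * h"
      using nA s(2) by (intro add_mono mult_mono) auto
    finally have "norm (A' * (x - y) + (x - y) * B') / (2 * s) \<le>
        (h * norm (x - y) + norm (x - y) * h) / (2 * s)"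
      using s by (intro divide_right_mono) auto
    moreover have "norm (F x - F y) = norm (A' * (x - y) + (x - y) * B') / (2 * s)"
      unfolding F_diff norm_scaleR using s by simp
    moreover have "(h * norm (x - y) + norm (x - y) * h) / (2 * s) = h / s * norm (x - y)"
      using s by (simp add: field_simps)
    ultimately show ?thesis by simp
  qed
  define q where "q = h / s"
  have q: "0 \<le> q" "q < 1" using s by (auto simp: q_def)
  define x where "x n = (F ^^ n) 0" for n
  have xS: "x (Suc n) = F (x n)" for n by (simp add: x_def)
  have xJ: "x n \<in> J" for n by (induction n) (simp_all add: x_def J_zero FJ)
  have "N (x (Suc n) - x n) \<le> N (x 1 - x 0) * q ^ n" for n
  proof (induction n)
    case (Suc n)
    have "N (x (Suc (Suc n)) - x (Suc n)) \<le> q * N (x (Suc n) - x n)"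
      using contract[OF J_diff[OF xJ xJ], of "Suc n" n] by (simp only: xS q_def)
    also have "\<dots> \<le> q * (N (x 1 - x 0) * q ^ n)" by (intro mult_left_mono Suc q)
    finally show ?case by (simp add: mult_ac)
  qed simp
  from J_geometric_converges[OF xJ this q]
  obtain l where l: "l \<in> J" "(\<lambda>n. N (x n - l)) \<longlonglongrightarrow> 0" by blast
  have "(\<lambda>n. x n - l) \<longlonglongrightarrow> 0"
    by (rule Lim_null_comparison[OF _ l(2)]) (use norm_le_N J_diff xJ l(1) in simp)
  then have xl: "x \<longlonglongrightarrow> l" by (simp add: LIM_zero_iff)
  have x_bound: "norm (x n - \<Delta>) \<le> norm \<Delta> * q ^ n" for n
  proof (induction n)
    case (Suc n)
    have "norm (x (Suc n) - \<Delta>) \<le> q * norm (x n - \<Delta>)"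
      using contract'[of "x n" \<Delta>] by (simp only: xS fix_F q_def)
    also have "\<dots> \<le> q * (norm \<Delta> * q ^ n)" by (rule mult_left_mono[OF Suc.IH q(1)])
    also have "\<dots> = norm \<Delta> * q ^ Suc n" by simp
    finally show ?case .
  next
    case 0
    show ?case by (simp add: x_def)
  qed
  have "(\<lambda>n. norm \<Delta> * q ^ n) \<longlonglongrightarrow> 0"
    by (rule tendsto_mult_right_zero[OF LIMSEQ_realpow_zero[OF q]])
  then have "(\<lambda>n. x n - \<Delta>) \<longlonglongrightarrow> 0"
    by (rule Lim_null_comparison[rotated]) (rule always_eventually, rule allI, rule x_bound)
  then have "x \<longlonglongrightarrow> \<Delta>" by (simp add: LIM_zero_iff)
  then have "l = \<Delta>" using xl LIMSEQ_unique by blast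
  then have \<Delta>J: "\<Delta> \<in> J" using l by simp
  then show "A - B \<in> J" by (simp add: \<Delta>_def)
  \<comment> \<open>Once \<open>\<Delta>\<close> lies in J, its norm is estimated directly from the
    fixed-point equation and the terms with h are moved to the left.\<close>
  have "2 * s * N \<Delta> = N ((2 * s) *\<^sub>R \<Delta>)" using s by (simp add: N_scaleR[OF \<Delta>J])
  also have "\<dots> \<le> N D + N (A' * \<Delta>) + N (\<Delta> * B')"
    unfolding fix_D
    by (rule order_trans[OF norm_triangle add_right_mono[OF norm_triangle]])
      (intro J_add J_mult_left J_mult_right \<Delta>J DJ)+
  also have "\<dots> \<le> N D + h * N \<Delta> + N \<Delta> * h"
    using nA s(2) norm_nonneg[OF \<Delta>J]
    by (intro add_mono order_refl order_trans[OF N_mult_left[OF \<Delta>J]]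
        order_trans[OF N_mult_right[OF \<Delta>J]] mult_mono) auto
  finally have "2 * (s - h) * N \<Delta> \<le> N D" by (simp add: algebra_simps)
  then show "2 * a * N (A - B) \<le> N (A * A - B * B)" by (simp add: s \<Delta>_def D_def)
qed

lemma adj_mult_diff_in_J:
  assumes XY: "X - Y \<in> J" and b: "norm X \<le> b" "norm Y \<le> b"
  shows "adj X * X - adj Y * Y \<in> J" and "N (adj X * X - adj Y * Y) \<le> 2 * b * N (X - Y)"
proof -
  note adjXY = adj_diff_in_J[OF XY]
  have eq: "adj X * X - adj Y * Y = adj X * (X - Y) + (adj X - adj Y) * Y"
    by (simp add: algebra_simps)
  show "adj X * X - adj Y * Y \<in> J"
    unfolding eq by (intro J_add J_mult_left J_mult_right XY adjXY)
  have "N (adj X * X - adj Y * Y) \<le> N (adj X * (X - Y)) + N ((adj X - adj Y) * Y)"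
    unfolding eq by (intro norm_triangle J_mult_left J_mult_right XY adjXY)
  also have "\<dots> \<le> b * N (X - Y) + N (X - Y) * b"
    using b norm_nonneg[OF XY] N_adj_diff[OF XY] order_trans[OF norm_ge_zero b(1)]
    by (intro add_mono order_trans[OF N_mult_left[OF XY]] order_trans[OF N_mult_right[OF adjXY]]
        mult_mono) auto
  finally show "N (adj X * X - adj Y * Y) \<le> 2 * b * N (X - Y)" by simp
qed

text \<open>The common form into which the hypotheses for a > 0 and for a = 0 are brought, so that
  the flow can be treated uniformly.\<close>

definition modulus_lipschitz :: "real \<Rightarrow> real \<Rightarrow> (real \<Rightarrow> real) \<Rightarrow> bool" where
  "modulus_lipschitz a b f \<longleftrightarrow> (\<exists>C\<ge>0. \<forall>X Y. moduli_spectra_in X {a..b} \<longrightarrow> moduli_spectra_in Y {a..b} \<longrightarrow>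
     X - Y \<in> J \<longrightarrow> cfc f (abs_bop X) - cfc f (abs_bop Y) \<in> J \<and>
       N (cfc f (abs_bop X) - cfc f (abs_bop Y)) \<le> C * N (X - Y))"

text \<open>X is followed through \<open>adj X * X\<close> and the modulus to f of the modulus. The
  square root in the middle is Lipschitz only away from 0, whence the division by a.\<close>

lemma modulus_lipschitz_pos:
  assumes a: "0 < a" and f: "ideal_lipschitz_on J N {a..b} f"
  shows "modulus_lipschitz a b f"
proof -
  obtain C where C: "C > 0" "\<And>A B. selfadjoint A \<and> selfadjoint B \<and>
      spectrum A \<subseteq> complex_of_real ` {a..b} \<and> spectrum B \<subseteq> complex_of_real ` {a..b} \<and> A - B \<in> J \<Longrightarrow>
      cfc f A - cfc f B \<in> J \<and> N (cfc f A - cfc f B) \<le> C * N (A - B)"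
    using f unfolding ideal_lipschitz_on_def by blast
  \<comment> \<open>The absolute value of b keeps the constant nonnegative even when
    \<open>{a..b}\<close> is empty.\<close>
  have "cfc f (abs_bop X) - cfc f (abs_bop Y) \<in> J \<and>
      N (cfc f (abs_bop X) - cfc f (abs_bop Y)) \<le> (C * \<bar>b\<bar> / a) * N (X - Y)"
    if X: "moduli_spectra_in X {a..b}" and Y: "moduli_spectra_in Y {a..b}" and XY: "X - Y \<in> J" for X Y
  proof -
    have sp: "spectrum_within (abs_bop X) a b" "spectrum_within (abs_bop Y) a b"
      using X Y by (auto simp: moduli_spectra_in_def spectrum_within_def selfadjoint_abs)
    have nb: "norm X \<le> b" "norm Y \<le> b"
      using sp a by (auto simp: spectrum_within_abs_iff intro: norm_between_upper)
    note sq = adj_mult_diff_in_J[OF XY nb]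
    have J: "abs_bop X - abs_bop Y \<in> J"
      and le: "2 * a * N (abs_bop X - abs_bop Y) \<le> N (adj X * X - adj Y * Y)"
      using square_diff_in_J[OF a sp] sq(1) by (simp_all add: abs_mult_self)
    have "a * N (abs_bop X - abs_bop Y) \<le> \<bar>b\<bar> * N (X - Y)"
      using le sq(2) mult_right_mono[OF abs_ge_self norm_nonneg[OF XY], of b] by simp
    then have N: "N (abs_bop X - abs_bop Y) \<le> \<bar>b\<bar> / a * N (X - Y)"
      using a by (simp add: field_simps)
    have "cfc f (abs_bop X) - cfc f (abs_bop Y) \<in> J \<and>
        N (cfc f (abs_bop X) - cfc f (abs_bop Y)) \<le> C * N (abs_bop X - abs_bop Y)"
      using sp J by (intro C(2)) (simp add: spectrum_within_def)
    moreover have "C * N (abs_bop X - abs_bop Y) \<le> C * (\<bar>b\<bar> / a * N (X - Y))"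
      using N C(1) by (intro mult_left_mono) auto
    ultimately show ?thesis by (auto simp: mult_ac)
  qed
  moreover have "0 \<le> C * \<bar>b\<bar> / a" using C(1) a by simp
  ultimately show ?thesis unfolding modulus_lipschitz_def by blast
qed

text \<open>The operator \<open>V X W\<^sup>* + W X\<^sup>* V\<^sup>*\<close> plays the role of the self-adjoint matrix with off-diagonal
  entries \<open>X\<close> and \<open>X\<^sup>*\<close>.\<close>

lemma modulus_lipschitz_zero:
  assumes b: "0 \<le> b" and f: "ideal_lipschitz_on J N {-b..b} (\<lambda>x. f \<bar>x\<bar>)"
  shows "modulus_lipschitz 0 b f"
proof -
  let ?f = "\<lambda>x. f \<bar>x\<bar>"
  obtain C where C: "C > 0" "\<And>A B. selfadjoint A \<and> selfadjoint B \<and>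
      spectrum A \<subseteq> complex_of_real ` {-b..b} \<and> spectrum B \<subseteq> complex_of_real ` {-b..b} \<and> A - B \<in> J \<Longrightarrow>
      cfc ?f A - cfc ?f B \<in> J \<and> N (cfc ?f A - cfc ?f B) \<le> C * N (A - B)"
    using f unfolding ideal_lipschitz_on_def by blast
  have contf: "continuous_on {0..b} f"
  proof -
    have "continuous_on {0..b} ?f"
      using f b unfolding ideal_lipschitz_on_def by (auto intro: continuous_on_subset)
    then show ?thesis by (rule continuous_on_eq) simp
  qed
  \<comment> \<open>Both sides of \<open>corner\<close> become g of a square: f of the modulus of X
    is \<open>g (adj X * X)\<close>, and \<open>?f\<close> at \<open>H X\<close> is
    \<open>g (H X * H X)\<close>.\<close>
  define g where "g = (\<lambda>y. f (sqrt y))"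
  have sqrt_in: "sqrt y \<in> {0..b}" if "y \<in> {0..b\<^sup>2}" for y
    using that b by (simp add: real_le_lsqrt)
  have contg: "continuous_on {0..b\<^sup>2} g"
    unfolding g_def using sqrt_in
    by (intro continuous_on_compose2[OF contf] continuous_intros) auto
  obtain V W :: "'h bop" where VW: "norm V \<le> 1" "norm W \<le> 1" "adj V * V = 1" "adj W * W = 1"
      "adj V * W = 0" "adj W * V = 0"
    using orthogonal_isometries_exist by blast
  define H where "H X = V * X * adj W + W * adj X * adj V" for X
  have H_sa: "selfadjoint (H X)" for X
    by (simp add: selfadjoint_def H_def adj_add adj_mult mult.assoc add.commute)
  have HW: "H X * W = V * X" and HV: "H X * V = W * adj X" for X
    by (simp_all add: H_def distrib_right mult.assoc VW)
  have H_bound: "norm (H X) \<le> b" if X: "norm X \<le> b" for X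
  proof (rule norm_bop_le[OF b])
    fix x
    let ?v = "bop_apply (adj V) x" and ?w = "bop_apply (adj W) x"
    have iso: "norm (bop_apply V y) = norm y" "norm (bop_apply W y) = norm y" for y
      using VW(3,4) cinner_adj_left[of V "bop_apply V y" y] cinner_adj_left[of W "bop_apply W y" y]
      by (simp_all add: norm_eq_sqrt_cinner bop_apply_one flip: bop_apply_mult)
    have orth: "cinner (bop_apply V y) (bop_apply W z) = 0" for y z
      using VW(5) cinner_adj_right[of y V "bop_apply W z"]
      by (simp add: bop_apply.zero_left cinner.zero_right flip: bop_apply_mult)
    have "(norm (bop_apply (H X) x))\<^sup>2 =
        (norm (bop_apply X ?w))\<^sup>2 + (norm (bop_apply (adj X) ?v))\<^sup>2"
      by (simp add: H_def bop_apply_simps norm_add_sq orth iso)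
    also have "\<dots> \<le> (b * norm ?w)\<^sup>2 + (b * norm ?v)\<^sup>2"
      using X by (intro add_mono power_mono norm_ge_zero
          order_trans[OF norm_bop_apply mult_right_mono]) simp_all
    also have "\<dots> = b\<^sup>2 * ((norm ?v)\<^sup>2 + (norm ?w)\<^sup>2)" by (simp add: power_mult_distrib algebra_simps)
    \<comment> \<open>Bessel's inequality for the orthogonal ranges of V and W, where
      \<open>?p\<close> is the projection of x onto their sum.\<close>
    also have "(norm ?v)\<^sup>2 + (norm ?w)\<^sup>2 \<le> (norm x)\<^sup>2"
    proof -
      let ?p = "bop_apply V ?v + bop_apply W ?w"
      have p: "(norm ?p)\<^sup>2 = (norm ?v)\<^sup>2 + (norm ?w)\<^sup>2" by (simp add: norm_add_sq orth iso)
      have "cinner x ?p = of_real ((norm ?v)\<^sup>2) + of_real ((norm ?w)\<^sup>2)"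
        by (simp add: cinner.add_right cinner_self flip: cinner_adj_left del: of_real_power)
      then have "Re (cinner x ?p) = (norm ?v)\<^sup>2 + (norm ?w)\<^sup>2" by (simp del: of_real_power)
      then have "(norm (x - ?p))\<^sup>2 = (norm x)\<^sup>2 - ((norm ?v)\<^sup>2 + (norm ?w)\<^sup>2)"
        using p by (simp add: norm_diff_sq)
      then show ?thesis using zero_le_power2[of "norm (x - ?p)"] by linarith
    qed
    finally have "(norm (bop_apply (H X) x))\<^sup>2 \<le> (b * norm x)\<^sup>2"
      by (simp add: power_mult_distrib mult_left_mono)
    then show "norm (bop_apply (H X) x) \<le> b * norm x"
      by (rule power2_le_imp_le) (simp add: b)
  qed
  have H_within: "spectrum_within (H X) (- b) b" if X: "norm X \<le> b" for X
    using H_bound[OF X] by (simp add: spectrum_within_iff_norm H_sa)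
  \<comment> \<open>By \<open>HW\<close> and \<open>HV\<close> the square of \<open>H X\<close>
    satisfies \<open>H X * H X * W = W * (adj X * X)\<close>. Hence W intertwines the two functions,
    and \<open>adj W * W = 1\<close> extracts the corner.\<close>
  have corner: "adj W * cfc ?f (H X) * W = cfc f (abs_bop X)" if X: "norm X \<le> b" for X
  proof -
    interpret H: functional_calculus "H X" "- b" b by standard (rule H_within[OF X])
    interpret X: functional_calculus "adj X * X" 0 "b\<^sup>2" by standard (rule spectrum_within_adj_mult[OF X])
    have "cfc ?f (H X) = cfc (\<lambda>x. g (x * x)) (H X)"
      by (rule cfc_cong[OF H.within]) (simp add: g_def)
    also have "\<dots> = cfc g (cfc (\<lambda>x. x * x) (H X))"
    proof (rule H.cfc_compose[symmetric, OF _ _ contg])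
      show "x * x \<in> {0..b\<^sup>2}" if "x \<in> {- b..b}" for x
        using that abs_le_square_iff[of x b] b by (auto simp: power2_eq_square)
    qed (intro continuous_intros)
    also have "cfc (\<lambda>x. x * x) (H X) = H X * H X"
      by (simp add: H.cfc_mult H.cfc_id continuous_on_id)
    finally have cfH: "cfc ?f (H X) = cfc g (H X * H X)" .
    have cfX: "cfc g (adj X * X) = cfc f (abs_bop X)"
      unfolding abs_bop_def g_def
      by (rule X.cfc_compose[symmetric, OF _ _ contf])
        (use sqrt_in in \<open>auto intro!: continuous_intros\<close>)
    have HH: "spectrum_within (H X * H X) 0 (b\<^sup>2)"
      using spectrum_within_adj_mult[OF H_bound[OF X]] H_sa[of X] by (simp add: selfadjoint_def)
    have "H X * H X * W = W * adj X * X" by (simp only: mult.assoc HW) (simp only: HV mult.assoc[symmetric])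
    then have "W * (adj X * X) = H X * H X * W" by (simp add: mult.assoc)
    from X.cfc_intertwine[OF contg HH this]
    have "W * cfc f (abs_bop X) = cfc ?f (H X) * W" by (simp add: cfX cfH)
    then have "adj W * cfc ?f (H X) * W = adj W * W * cfc f (abs_bop X)" by (simp add: mult.assoc)
    then show ?thesis by (simp add: VW)
  qed
  have small: "norm (P * Q) \<le> 1" if "norm P \<le> 1" "norm Q \<le> 1" for P Q :: "'h bop"
    using order_trans[OF norm_mult_ineq mult_mono[OF that]] by simp
  have le1: "N (P * Z * Q) \<le> N Z" if P: "norm P \<le> 1" and Q: "norm Q \<le> 1" and Z: "Z \<in> J" for P Q Z
  proof -
    have "N (P * Z * Q) \<le> norm P * N Z * norm Q" by (rule norm_ideal[OF Z])
    also have "\<dots> \<le> 1 * N Z * 1" using P Q norm_nonneg[OF Z] by (intro mult_mono) auto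
    finally show ?thesis by simp
  qed
  have "cfc f (abs_bop X) - cfc f (abs_bop Y) \<in> J \<and>
      N (cfc f (abs_bop X) - cfc f (abs_bop Y)) \<le> (2 * C) * N (X - Y)"
    if X: "moduli_spectra_in X {0..b}" and Y: "moduli_spectra_in Y {0..b}" and XY: "X - Y \<in> J" for X Y
  proof -
    have nb: "norm X \<le> b" "norm Y \<le> b"
      using X Y by (auto simp: moduli_spectra_in_iff intro: norm_between_upper)
    have eq: "H X - H Y = V * (X - Y) * adj W + W * (adj X - adj Y) * adj V"
      by (simp add: H_def algebra_simps)
    have J1: "V * (X - Y) * adj W \<in> J" "W * (adj X - adj Y) * adj V \<in> J"
      using XY adj_diff_in_J[OF XY] by (auto intro: ideal)
    have HJ: "H X - H Y \<in> J" unfolding eq by (intro J_add J1)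
    have "N (H X - H Y) \<le> N (V * (X - Y) * adj W) + N (W * (adj X - adj Y) * adj V)"
      unfolding eq by (intro norm_triangle J1)
    also have "\<dots> \<le> N (X - Y) + N (adj X - adj Y)"
      using VW by (intro add_mono le1 XY adj_diff_in_J) auto
    finally have HN: "N (H X - H Y) \<le> 2 * N (X - Y)" using N_adj_diff[OF XY] by simp
    have CH: "cfc ?f (H X) - cfc ?f (H Y) \<in> J \<and> N (cfc ?f (H X) - cfc ?f (H Y)) \<le> C * N (H X - H Y)"
      using H_within nb HJ by (intro C(2)) (simp add: spectrum_within_def)
    have eq2: "cfc f (abs_bop X) - cfc f (abs_bop Y) = adj W * (cfc ?f (H X) - cfc ?f (H Y)) * W"
      using corner nb by (simp add: algebra_simps)
    have "N (adj W * (cfc ?f (H X) - cfc ?f (H Y)) * W) \<le> N (cfc ?f (H X) - cfc ?f (H Y))"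
      using VW CH by (intro le1) auto
    also have "\<dots> \<le> C * (2 * N (X - Y))"
      using CH HN C(1) by (meson mult_left_mono less_imp_le order_trans)
    finally show ?thesis unfolding eq2 using CH ideal by auto
  qed
  moreover have "0 \<le> 2 * C" using C(1) by simp
  ultimately show ?thesis unfolding modulus_lipschitz_def by blast
qed

text \<open>Two scalar operators differ by a multiple of 1, which need not lie in J. Instead y is
  compared with y + (x - y) P for a rank one projection P; the difference has ideal norm
  \<open>\<bar>x - y\<bar>\<close>.\<close>

lemma ideal_lipschitz_imp_lipschitz:
  assumes "ideal_lipschitz_on J N {c..d} f"
  shows "\<exists>L\<ge>0. \<forall>x\<in>{c..d}. \<forall>y\<in>{c..d}. \<bar>f x - f y\<bar> \<le> L * \<bar>x - y\<bar>"
proof -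
  obtain C where contf: "continuous_on {c..d} f" and C: "C > 0" "\<And>A B. selfadjoint A \<and> selfadjoint B \<and>
      spectrum A \<subseteq> complex_of_real ` {c..d} \<and> spectrum B \<subseteq> complex_of_real ` {c..d} \<and> A - B \<in> J \<Longrightarrow>
      cfc f A - cfc f B \<in> J \<and> N (cfc f A - cfc f B) \<le> C * N (A - B)"
    using assms unfolding ideal_lipschitz_on_def by blast
  obtain u :: 'h where u: "norm u = 1" using unit_vector_exists by blast
  obtain P where P: "rank_one P" "\<And>x. bop_apply P x = cinner u x *\<^sub>C u" "norm P = 1"
    using rank_one_projection[OF u] by metis
  have PJ: "P \<in> J" "N P = 1" using rank_one[OF P(1)] P(3) by auto
  have PP: "P * P = P"
    by (rule bop_eqI) (simp add: bop_apply_mult P(2) cinner_scaleC_right cinner_self u)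
  have Psa: "selfadjoint P"
    unfolding selfadjoint_def
    by (rule adj_eqI) (simp add: P(2) cinner_scaleC_left cinner_scaleC_right cinner_commute[of _ u])
  have scalar: "spectrum_within (x *\<^sub>R 1 :: 'h bop) x x" for x
    by (simp add: spectrum_within_iff_norm selfadjoint_simps)
  have cfc_scalar: "cfc f (x *\<^sub>R 1 :: 'h bop) = f x *\<^sub>R 1" for x
  proof -
    interpret functional_calculus "x *\<^sub>R 1 :: 'h bop" x x by standard (rule scalar)
    have "cfc f (x *\<^sub>R 1 :: 'h bop) = cfc (\<lambda>y. f x) (x *\<^sub>R 1 :: 'h bop)"
      by (rule cfc_cong[OF within]) simp
    then show ?thesis by (simp add: cfc_const)
  qed
  have "\<bar>f x - f y\<bar> \<le> C * \<bar>x - y\<bar>" if xy: "x \<in> {c..d}" "y \<in> {c..d}" for x y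
  proof -
    define A where "A = y *\<^sub>R 1 + (x - y) *\<^sub>R P"
    have Asa: "selfadjoint A" unfolding A_def by (intro selfadjoint_simps Psa)
    have "spectrum A \<subseteq> complex_of_real ` {c..d}"
    proof
      fix z assume z: "z \<in> spectrum A"
      have "z = of_real x \<or> z = of_real y"
      proof (rule ccontr)
        assume "\<not> ?thesis"
        define p q where "p = of_real x - z" and "q = of_real y - z"
        then have nz: "p \<noteq> 0" "q \<noteq> 0" using \<open>\<not> _\<close> by auto
        have orth: "P * (1 - P) = 0" "(1 - P) * P = 0" "(1 - P) * (1 - P) = 1 - P"
          by (simp_all add: left_diff_distrib right_diff_distrib PP)
        \<comment> \<open>On the range of P and on its orthogonal complement A - z acts as the
          nonzero scalars p and q, so its inverse is explicit.\<close>
        have A: "A - z *\<^sub>C 1 = p *\<^sub>C P + q *\<^sub>C (1 - P)"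
          by (simp add: A_def p_def q_def complex_vector.scale_left_diff_distrib
              complex_vector.scale_right_diff_distrib scaleC_of_real algebra_simps)
        have "(p *\<^sub>C P + q *\<^sub>C (1 - P)) * (inverse p *\<^sub>C P + inverse q *\<^sub>C (1 - P)) = 1"
          "(inverse p *\<^sub>C P + inverse q *\<^sub>C (1 - P)) * (p *\<^sub>C P + q *\<^sub>C (1 - P)) = 1"
          using nz by (simp_all add: distrib_left distrib_right scaleC_mult_left scaleC_mult_right
              scaleC_scaleC PP orth)
        then have "invertible_bop (A - z *\<^sub>C 1)" unfolding A by (rule invertible_bopI)
        then show False using z by (simp add: spectrum_def)
      qed
      then show "z \<in> complex_of_real ` {c..d}" using xy by blast
    qed
    then have Aw: "spectrum_within A c d" using Asa by (simp add: spectrum_within_def)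
    interpret A: functional_calculus A c d by standard (rule Aw)
    have Bw: "spectrum_within (r *\<^sub>R 1 :: 'h bop) c d" if "r \<in> {c..d}" for r
      using spectrum_within_mono[OF scalar] that by simp
    \<comment> \<open>P intertwines A with the scalar x, so P f(A) = f(x) P follows without
      diagonalising A.\<close>
    have "P * A = (x *\<^sub>R 1) * P" by (simp add: A_def distrib_left PP algebra_simps)
    from A.cfc_intertwine[OF contf Bw[OF xy(1)] this]
    have PA: "P * cfc f A = f x *\<^sub>R P" by (simp add: cfc_scalar)
    have AB: "A - y *\<^sub>R 1 = (x - y) *\<^sub>R P" by (simp add: A_def)
    have *: "cfc f A - cfc f (y *\<^sub>R 1) \<in> J \<and> N (cfc f A - cfc f (y *\<^sub>R 1)) \<le> C * N (A - y *\<^sub>R 1)"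
      using Aw Bw[OF xy(2)] AB PJ J_scaleR by (intro C(2)) (simp add: spectrum_within_def)
    have "P * (cfc f A - cfc f (y *\<^sub>R 1)) = (f x - f y) *\<^sub>R P"
      by (simp add: right_diff_distrib PA cfc_scalar scaleR_diff_left)
    then have "\<bar>f x - f y\<bar> = N (P * (cfc f A - cfc f (y *\<^sub>R 1)))"
      by (simp add: N_scaleR PJ)
    also have "\<dots> \<le> 1 * N (cfc f A - cfc f (y *\<^sub>R 1))"
      using N_mult_left[of "cfc f A - cfc f (y *\<^sub>R 1)" P] * P(3) by simp
    also have "\<dots> \<le> C * \<bar>x - y\<bar>" using * by (simp add: AB N_scaleR PJ)
    finally show ?thesis .
  qed
  then show ?thesis using C(1) by (intro exI[of _ C]) auto
qed

end

section \<open>One Euler step\<close>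

definition flow_field :: "(real \<Rightarrow> real) \<Rightarrow> (real \<Rightarrow> real) \<Rightarrow> 'a::chilbert_space bop \<Rightarrow> 'a bop" where
  "flow_field \<phi>1 \<phi>2 X = commutator (phi_bop \<phi>1 \<phi>2 X) X"

text \<open>The terms of first order cancel because p + q - (p + q) = 0. What remains is
  \<open>p * q - (p + q)^2\<close> at order h^2, bounded by K^2 + 4 K^2, and
  \<open>p * q * (p + q)\<close> at order h^3, bounded by 2 K^3.\<close>

lemma euler_product_bound:
  fixes p q K h M b :: real
  assumes p: "\<bar>p\<bar> \<le> K" and q: "\<bar>q\<bar> \<le> K" and h: "0 \<le> h" "h \<le> 1" and M: "0 \<le> M" "M \<le> b"
  shows "\<bar>(1 + h * p) * (M * (1 - h * (p + q))) * (1 + h * q) - M\<bar> \<le> b * (5 * K\<^sup>2 + 2 * K ^ 3) * h\<^sup>2"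
proof -
  have K: "0 \<le> K" using p by linarith
  have eq: "(1 + h * p) * (M * (1 - h * (p + q))) * (1 + h * q) - M =
      M * (h\<^sup>2 * ((p * q - (p + q) * (p + q)) - h * (p * q * (p + q))))"
    by (simp add: algebra_simps power2_eq_square)
  have pq: "\<bar>p * q\<bar> \<le> K * K" using p q K by (simp add: abs_mult mult_mono)
  have s: "\<bar>p + q\<bar> \<le> 2 * K" using p q by linarith
  have ss: "\<bar>(p + q) * (p + q)\<bar> \<le> (2 * K) * (2 * K)"
    unfolding abs_mult using s K by (intro mult_mono) auto
  have pqs: "\<bar>p * q * (p + q)\<bar> \<le> K * K * (2 * K)"
    unfolding abs_mult[of "p * q"] using pq s K by (intro mult_mono) auto
  have "\<bar>h * (p * q * (p + q))\<bar> \<le> 1 * (K * K * (2 * K))"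
    unfolding abs_mult[of h] using h pqs K by (intro mult_mono) auto
  then have hpqs: "\<bar>h * (p * q * (p + q))\<bar> \<le> 2 * K ^ 3" by (simp add: power3_eq_cube)
  have "\<bar>u - v - w\<bar> \<le> \<bar>u\<bar> + \<bar>v\<bar> + \<bar>w\<bar>" for u v w :: real by linarith
  from this[of "p * q" "(p + q) * (p + q)" "h * (p * q * (p + q))"]
  have "\<bar>(p * q - (p + q) * (p + q)) - h * (p * q * (p + q))\<bar> \<le> K * K + (2 * K) * (2 * K) + 2 * K ^ 3"
    using pq ss hpqs by linarith
  then have "\<bar>(p * q - (p + q) * (p + q)) - h * (p * q * (p + q))\<bar> \<le> 5 * K\<^sup>2 + 2 * K ^ 3"
    by (simp add: power2_eq_square)
  then have "M * (h\<^sup>2 * \<bar>(p * q - (p + q) * (p + q)) - h * (p * q * (p + q))\<bar>) \<le>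
      b * (h\<^sup>2 * (5 * K\<^sup>2 + 2 * K ^ 3))"
    using M K by (intro mult_mono mult_left_mono) auto
  then show ?thesis unfolding eq using M h by (simp add: abs_mult mult_ac)
qed

lemma norm_mult_mono:
  fixes A B :: "'a::real_normed_algebra"
  assumes "norm A \<le> r" "norm B \<le> s"
  shows "norm (A * B) \<le> r * s"
  by (rule order_trans[OF norm_mult_ineq])
    (use assms order_trans[OF norm_ge_zero] in \<open>auto intro: mult_mono\<close>)

locale monotone_pair =
  fixes a b :: real and \<phi>1 \<phi>2 :: "real \<Rightarrow> real"
  assumes a_nonneg: "0 \<le> a" and a_le_b: "a \<le> b"
    and cont1: "continuous_on {a..b} \<phi>1" and cont2: "continuous_on {a..b} \<phi>2"
    and mono1: "mono_on {a..b} \<phi>1" and mono2: "mono_on {a..b} \<phi>2"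
begin

lemma swap: "monotone_pair a b \<phi>2 \<phi>1"
  by unfold_locales (rule a_nonneg a_le_b cont1 cont2 mono1 mono2)+

abbreviation \<psi> :: "real \<Rightarrow> real" where "\<psi> x \<equiv> \<phi>1 x + \<phi>2 x"

lemma moduli_within:
  fixes X :: "'h::separable_infinite_dim_chilbert_space bop"
  assumes "moduli_spectra_in X {a..b}"
  shows "spectrum_within (abs_bop X) a b" "spectrum_within (abs_bop (adj X)) a b"
  using assms by (auto simp: moduli_spectra_in_def spectrum_within_def selfadjoint_abs)

lemma selfadjoint_phi:
  fixes X :: "'h::separable_infinite_dim_chilbert_space bop"
  assumes X: "moduli_spectra_in X {a..b}"
  shows "selfadjoint (phi_bop \<phi>1 \<phi>2 X)"
  unfolding phi_bop_def using moduli_within[OF X] cont1 cont2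
  by (intro selfadjoint_simps(5) functional_calculus.selfadjoint_cfc[OF functional_calculus.intro])

text \<open>Passing to the adjoint and swapping the functions changes the sign of \<phi>(X), and a
  commutator with a self-adjoint operator changes sign under the adjoint too. So adjoints of Euler
  polygons are polygons of the swapped pair.\<close>

lemma flow_field_adj:
  fixes X :: "'h::separable_infinite_dim_chilbert_space bop"
  assumes X: "moduli_spectra_in X {a..b}"
  shows "flow_field \<phi>2 \<phi>1 (adj X) = adj (flow_field \<phi>1 \<phi>2 X)"
proof -
  have "phi_bop \<phi>2 \<phi>1 (adj X) = - phi_bop \<phi>1 \<phi>2 X" by (simp add: phi_bop_def)
  then show ?thesis
    using selfadjoint_phi[OF X]
    by (simp add: flow_field_def commutator_def adj_diff adj_mult selfadjoint_def)
qed

text \<open>In the commutator, \<phi>2 of the modulus of \<open>adj X\<close> standing to the left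
  of X is moved to the right, where it joins \<phi>1 to form \<open>\<psi>\<close>.\<close>

lemma flow_field_expand:
  fixes X :: "'h::separable_infinite_dim_chilbert_space bop"
  assumes X: "moduli_spectra_in X {a..b}"
  shows "flow_field \<phi>1 \<phi>2 X =
    cfc \<phi>1 (abs_bop X) * X + X * cfc \<phi>2 (abs_bop (adj X)) - X * cfc \<psi> (abs_bop X)"
proof -
  note w = moduli_within[OF X]
  interpret functional_calculus "abs_bop X" a b by standard (rule w)
  have "X * cfc \<phi>2 (abs_bop X) = cfc \<phi>2 (abs_bop (adj X)) * X"
    by (rule cfc_abs_intertwine[OF w cont2])
  then show ?thesis
    by (simp add: flow_field_def commutator_def phi_bop_def cfc_add[OF cont1 cont2] algebra_simps)
qed

text \<open>The step is compared with the product P, whose factors have bounds attained at m and M.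
  The constant is doubled because a defect C h^2 arises twice: in the scalar product at the end
  points and in the distance from P to the step.\<close>

lemma euler_step_norm_between:
  fixes X :: "'h::separable_infinite_dim_chilbert_space bop"
  assumes X: "norm_between m M X" "norm_between m M (adj X)" and mM: "a \<le> m" "M \<le> b"
    and K: "\<And>x. x \<in> {a..b} \<Longrightarrow> \<bar>\<phi>1 x\<bar> \<le> K \<and> \<bar>\<phi>2 x\<bar> \<le> K"
    and L: "\<And>x y. x \<in> {a..b} \<Longrightarrow> y \<in> {a..b} \<Longrightarrow> \<bar>x * \<psi> x - y * \<psi> y\<bar> \<le> L * \<bar>x - y\<bar>"
    and h: "0 \<le> h" "h \<le> 1" "2 * h * K \<le> 1" "h * L \<le> 1"
  shows "norm_between (m - 2 * b * (5 * K\<^sup>2 + 2 * K ^ 3) * h\<^sup>2) (M + 2 * b * (5 * K\<^sup>2 + 2 * K ^ 3) * h\<^sup>2)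
    (X + h *\<^sub>R flow_field \<phi>1 \<phi>2 X)"
proof -
  define C where "C = b * (5 * K\<^sup>2 + 2 * K ^ 3)"
  have K0: "0 \<le> K" using K[of a] a_le_b by auto
  have hK: "h * K \<le> 1" using h K0 by simp
  have m0: "0 \<le> m" using a_nonneg mM by linarith
  have m_le_M: "m \<le> M" by (rule norm_between_upper(3)[OF X(1)])
  have sub: "{m..M} \<subseteq> {a..b}" using mM by auto
  have mM_in: "m \<in> {a..b}" "M \<in> {a..b}" using mM m_le_M by auto
  have nX: "norm X \<le> b" using norm_between_upper(1)[OF X(1)] mM by linarith
  have b0: "0 \<le> b" using nX norm_ge_zero order_trans by blast
  have W: "spectrum_within (abs_bop X) m M" "spectrum_within (abs_bop (adj X)) m M"
    using X m0 by (simp_all add: spectrum_within_abs_iff)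
  have Xab: "moduli_spectra_in X {a..b}"
    using X mM norm_between_mono a_nonneg by (auto simp: moduli_spectra_in_iff)
  interpret A: functional_calculus "abs_bop X" m M by standard (rule W)
  interpret B: functional_calculus "abs_bop (adj X)" m M by standard (rule W)
  have c1: "continuous_on {m..M} \<phi>1" and c2: "continuous_on {m..M} \<phi>2"
    using cont1 cont2 sub by (auto intro: continuous_on_subset)
  define p1 p2 s where "p1 = cfc \<phi>1 (abs_bop X)" and "p2 = cfc \<phi>2 (abs_bop (adj X))"
    and "s = cfc \<psi> (abs_bop X)"
  have np: "norm p1 \<le> K" "norm p2 \<le> K" "norm s \<le> 2 * K"
  proof -
    show "norm p1 \<le> K" "norm p2 \<le> K"
      unfolding p1_def p2_def using sub K by (intro A.norm_cfc_le B.norm_cfc_le c1 c2; blast)+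
    show "norm s \<le> 2 * K" unfolding s_def
    proof (intro A.norm_cfc_le continuous_on_add c1 c2)
      fix x assume "x \<in> {m..M}"
      then show "\<bar>\<psi> x\<bar> \<le> 2 * K" using K[of x] sub by force
    qed
  qed
  have hp: "\<bar>h * r\<bar> \<le> 1" if "\<bar>r\<bar> \<le> K" for r
    using mult_left_mono[OF that h(1)] hK h(1) by (simp add: abs_mult)
  have hs: "h * \<psi> x \<le> 1" if x: "x \<in> {a..b}" for x
  proof -
    have "h * \<psi> x \<le> h * (2 * K)" using K[OF x] h(1) by (intro mult_left_mono) auto
    then show ?thesis using h(3) by simp
  qed
  define P where "P = (1 + h *\<^sub>R p1) * (X * (1 - h *\<^sub>R s)) * (1 + h *\<^sub>R p2)"
  have within1: "spectrum_within (1 + h *\<^sub>R p1) (1 + h * \<phi>1 m) (1 + h * \<phi>1 M)"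
  proof -
    have "spectrum_within (cfc (\<lambda>x. 1 + h * \<phi>1 x) (abs_bop X)) (1 + h * \<phi>1 m) (1 + h * \<phi>1 M)"
    proof (rule A.spectrum_within_cfc)
      fix x assume x: "x \<in> {m..M}"
      then have "\<phi>1 m \<le> \<phi>1 x" "\<phi>1 x \<le> \<phi>1 M"
        using mono1 mM_in sub by (auto intro!: mono_onD[OF mono1])
      then show "1 + h * \<phi>1 x \<in> {1 + h * \<phi>1 m..1 + h * \<phi>1 M}" using h by (simp add: mult_left_mono)
    qed (intro continuous_intros c1)
    also have "cfc (\<lambda>x. 1 + h * \<phi>1 x) (abs_bop X) = 1 + h *\<^sub>R p1"
      unfolding p1_def by (simp add: A.cfc_add A.cfc_const A.cfc_scaleR c1 continuous_on_mult)
    finally show ?thesis .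
  qed
  have within2: "spectrum_within (1 + h *\<^sub>R p2) (1 + h * \<phi>2 m) (1 + h * \<phi>2 M)"
  proof -
    have "spectrum_within (cfc (\<lambda>x. 1 + h * \<phi>2 x) (abs_bop (adj X))) (1 + h * \<phi>2 m) (1 + h * \<phi>2 M)"
    proof (rule B.spectrum_within_cfc)
      fix x assume x: "x \<in> {m..M}"
      then have "\<phi>2 m \<le> \<phi>2 x" "\<phi>2 x \<le> \<phi>2 M"
        using mono2 mM_in sub by (auto intro!: mono_onD[OF mono2])
      then show "1 + h * \<phi>2 x \<in> {1 + h * \<phi>2 m..1 + h * \<phi>2 M}" using h by (simp add: mult_left_mono)
    qed (intro continuous_intros c2)
    also have "cfc (\<lambda>x. 1 + h * \<phi>2 x) (abs_bop (adj X)) = 1 + h *\<^sub>R p2"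
      unfolding p2_def by (simp add: B.cfc_add B.cfc_const B.cfc_scaleR c2 continuous_on_mult)
    finally show ?thesis .
  qed
  have within3: "spectrum_within (abs_bop X * (1 - h *\<^sub>R s)) (m * (1 - h * \<psi> m)) (M * (1 - h * \<psi> M))"
  proof -
    \<comment> \<open>\<open>x * \<psi> x\<close> grows at a rate of at most L and
      \<open>h * L \<le> 1\<close>, so subtracting its h-fold from x preserves monotonicity.\<close>
    have incr: "x * (1 - h * \<psi> x) \<le> y * (1 - h * \<psi> y)" if xy: "x \<in> {a..b}" "y \<in> {a..b}" "x \<le> y" for x y
    proof -
      have "h * (y * \<psi> y - x * \<psi> x) \<le> h * (L * (y - x))"
        using L[OF xy(2,1)] xy(3) h(1) by (intro mult_left_mono) auto
      also have "\<dots> \<le> 1 * (y - x)"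
        unfolding mult.assoc[symmetric] using h(4) xy(3) by (intro mult_right_mono) auto
      finally show ?thesis by (simp add: algebra_simps)
    qed
    have "spectrum_within (cfc (\<lambda>x. x * (1 - h * \<psi> x)) (abs_bop X)) (m * (1 - h * \<psi> m)) (M * (1 - h * \<psi> M))"
    proof (rule A.spectrum_within_cfc)
      fix x assume "x \<in> {m..M}"
      then show "x * (1 - h * \<psi> x) \<in> {m * (1 - h * \<psi> m)..M * (1 - h * \<psi> M)}"
        using incr[of m x] incr[of x M] mM_in sub by auto
    qed (intro continuous_intros c1 c2)
    also have "cfc (\<lambda>x. x * (1 - h * \<psi> x)) (abs_bop X) = abs_bop X * (1 - h *\<^sub>R s)"
    proof -
      have "cfc (\<lambda>x. x * (1 - h * \<psi> x)) (abs_bop X) = abs_bop X * cfc (\<lambda>x. 1 - h * \<psi> x) (abs_bop X)"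
        by (subst A.cfc_mult) (auto intro!: continuous_intros c1 c2 simp: A.cfc_id)
      also have "cfc (\<lambda>x. 1 - h * \<psi> x) (abs_bop X) = 1 - h *\<^sub>R s"
        unfolding s_def
        by (subst A.cfc_diff) (auto intro!: continuous_intros c1 c2 simp: A.cfc_const
            A.cfc_scaleR[OF continuous_on_add[OF c1 c2]])
      finally show ?thesis .
    qed
    finally show ?thesis .
  qed
  have K_at: "\<bar>\<phi>1 m\<bar> \<le> K" "\<bar>\<phi>2 m\<bar> \<le> K" "\<bar>\<phi>1 M\<bar> \<le> K" "\<bar>\<phi>2 M\<bar> \<le> K"
    using K mM_in by auto
  \<comment> \<open>Nonnegative lower ends turn spectral inclusions into norm bounds and allow the
    inequalities of the factors to be multiplied.\<close>
  have nonneg: "0 \<le> 1 + h * \<phi>1 m" "0 \<le> 1 + h * \<phi>2 m" "0 \<le> m * (1 - h * \<psi> m)"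
    "0 \<le> 1 + h * \<phi>1 M" "0 \<le> 1 + h * \<phi>2 M" "0 \<le> M * (1 - h * \<psi> M)"
    using hp[OF K_at(1)] hp[OF K_at(2)] hp[OF K_at(3)] hp[OF K_at(4)] hs[OF mM_in(1)] hs[OF mM_in(2)]
      m0 m_le_M by (auto simp: abs_le_iff)
  have P_apply: "bop_apply P x = bop_apply (1 + h *\<^sub>R p1) (bop_apply X (bop_apply (1 - h *\<^sub>R s)
      (bop_apply (1 + h *\<^sub>R p2) x)))" for x
    by (simp only: P_def bop_apply_mult)
  \<comment> \<open>X may be exchanged for its modulus here, so the middle factor becomes a function
    of one self-adjoint operator.\<close>
  have norm_mid: "norm (bop_apply X (bop_apply (1 - h *\<^sub>R s) y)) =
      norm (bop_apply (abs_bop X * (1 - h *\<^sub>R s)) y)" for y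
    by (simp add: bop_apply_mult norm_abs_apply)
  have upper: "norm (bop_apply P x) \<le> (M + C * h\<^sup>2) * norm x" for x
  proof -
    let ?y = "bop_apply (1 + h *\<^sub>R p2) x" and ?z = "bop_apply X (bop_apply (1 - h *\<^sub>R s) (bop_apply (1 + h *\<^sub>R p2) x))"
    have "norm (bop_apply P x) \<le> (1 + h * \<phi>1 M) * norm ?z"
      unfolding P_apply
      by (rule order_trans[OF norm_bop_apply mult_right_mono[OF spectrum_within_upper[OF within1 nonneg(1)]]]) simp
    also have "norm ?z \<le> (M * (1 - h * \<psi> M)) * norm ?y"
      unfolding norm_mid
      by (rule order_trans[OF norm_bop_apply mult_right_mono[OF spectrum_within_upper[OF within3 nonneg(3)]]]) simp
    also have "norm ?y \<le> (1 + h * \<phi>2 M) * norm x"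
      by (rule order_trans[OF norm_bop_apply mult_right_mono[OF spectrum_within_upper[OF within2 nonneg(2)]]]) simp
    finally have "norm (bop_apply P x) \<le>
        (1 + h * \<phi>1 M) * ((M * (1 - h * \<psi> M)) * ((1 + h * \<phi>2 M) * norm x))"
      using nonneg by (simp add: mult_left_mono)
    also have "\<dots> = ((1 + h * \<phi>1 M) * (M * (1 - h * \<psi> M)) * (1 + h * \<phi>2 M)) * norm x"
      by (simp only: mult.assoc)
    also have "\<dots> \<le> (M + C * h\<^sup>2) * norm x"
      using euler_product_bound[OF K_at(3,4) h(1,2) order_trans[OF m0 m_le_M] mM(2)]
      by (intro mult_right_mono) (auto simp: C_def abs_le_iff)
    finally show ?thesis .
  qed
  have lower: "(m - C * h\<^sup>2) * norm x \<le> norm (bop_apply P x)" for x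
  proof -
    let ?y = "bop_apply (1 + h *\<^sub>R p2) x" and ?z = "bop_apply X (bop_apply (1 - h *\<^sub>R s) (bop_apply (1 + h *\<^sub>R p2) x))"
    have mb: "m \<le> b" using mM_in by simp
    have "(m - C * h\<^sup>2) * norm x \<le> ((1 + h * \<phi>1 m) * (m * (1 - h * \<psi> m)) * (1 + h * \<phi>2 m)) * norm x"
      using euler_product_bound[OF K_at(1,2) h(1,2) m0 mb]
      by (intro mult_right_mono) (auto simp: C_def abs_le_iff)
    also have "\<dots> = (1 + h * \<phi>1 m) * ((m * (1 - h * \<psi> m)) * ((1 + h * \<phi>2 m) * norm x))"
      by (simp only: mult.assoc)
    also have "\<dots> \<le> (1 + h * \<phi>1 m) * ((m * (1 - h * \<psi> m)) * norm ?y)"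
      by (intro mult_left_mono spectrum_within_lower[OF within2] nonneg)
    also have "\<dots> \<le> (1 + h * \<phi>1 m) * norm ?z"
      unfolding norm_mid by (intro mult_left_mono spectrum_within_lower[OF within3] nonneg)
    also have "\<dots> \<le> norm (bop_apply P x)"
      unfolding P_apply by (rule spectrum_within_lower[OF within1])
    finally show ?thesis .
  qed
  \<comment> \<open>The terms of order h in P are exactly the expanded field; the four remaining
    products add up to the same constant C.\<close>
  have diff: "P - (X + h *\<^sub>R flow_field \<phi>1 \<phi>2 X) =
      (h\<^sup>2) *\<^sub>R (p1 * X * p2 - p1 * X * s - X * s * p2 - h *\<^sub>R (p1 * X * s * p2))"
    unfolding flow_field_expand[OF Xab] p1_def[symmetric] p2_def[symmetric] s_def[symmetric] P_def
    by (simp add: algebra_simps power2_eq_square)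
  have "norm (p1 * X * p2 - p1 * X * s - X * s * p2 - h *\<^sub>R (p1 * X * s * p2)) \<le> C"
  proof -
    have n1: "norm (p1 * X * p2) \<le> K * b * K" "norm (p1 * X * s) \<le> K * b * (2 * K)"
      "norm (X * s * p2) \<le> b * (2 * K) * K" "norm (p1 * X * s * p2) \<le> K * b * (2 * K) * K"
      by (intro norm_mult_mono np nX)+
    have n2: "norm (h *\<^sub>R (p1 * X * s * p2)) \<le> 1 * (K * b * (2 * K) * K)"
      unfolding norm_scaleR using h n1(4) by (intro mult_mono) auto
    have "norm (p1 * X * p2 - p1 * X * s - X * s * p2 - h *\<^sub>R (p1 * X * s * p2)) \<le>
      norm (p1 * X * p2) + norm (p1 * X * s) + norm (X * s * p2) + norm (h *\<^sub>R (p1 * X * s * p2))"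
      by (meson add_mono_thms_linordered_semiring(3) norm_triangle_ineq4 order_trans)
    also have "\<dots> \<le> K * b * K + K * b * (2 * K) + b * (2 * K) * K + 1 * (K * b * (2 * K) * K)"
      by (intro add_mono n1(1-3) n2)
    also have "\<dots> = C" by (simp add: C_def algebra_simps power2_eq_square power3_eq_cube)
    finally show ?thesis .
  qed
  then have diff_le: "norm (P - (X + h *\<^sub>R flow_field \<phi>1 \<phi>2 X)) \<le> C * h\<^sup>2"
    unfolding diff norm_scaleR using mult_left_mono[of _ C "h\<^sup>2"] by (simp add: mult.commute[of C])
  have close: "norm (bop_apply P x - bop_apply (X + h *\<^sub>R flow_field \<phi>1 \<phi>2 X) x) \<le> C * h\<^sup>2 * norm x" for x
    unfolding bop_apply.diff_left[symmetric]
    by (rule order_trans[OF norm_bop_apply mult_right_mono[OF diff_le]]) simp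
  have C2: "2 * b * (5 * K\<^sup>2 + 2 * K ^ 3) * h\<^sup>2 = 2 * (C * h\<^sup>2)" by (simp add: C_def)
  show ?thesis
    unfolding norm_between_def C2
  proof (intro allI conjI)
    fix x
    let ?E = "bop_apply (X + h *\<^sub>R flow_field \<phi>1 \<phi>2 X) x"
    have "norm (bop_apply P x) \<le> norm ?E + norm (bop_apply P x - ?E)"
      using norm_triangle_ineq[of ?E "bop_apply P x - ?E"] by simp
    then show "(m - 2 * (C * h\<^sup>2)) * norm x \<le> norm ?E"
      using lower[of x] close[of x] by (simp add: algebra_simps)
    have "norm ?E \<le> norm (bop_apply P x) + norm (bop_apply P x - ?E)"
      using norm_triangle_ineq4[of "bop_apply P x" "bop_apply P x - ?E"] by simp
    then show "norm ?E \<le> (M + 2 * (C * h\<^sup>2)) * norm x"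
      using upper[of x] close[of x] by (simp add: algebra_simps)
  qed
qed

end

section \<open>Convergence of the Euler scheme in the ideal norm\<close>

text \<open>The explicit time admits equations such as g' = A(t) g, whose coefficient is not a
  function of the state.\<close>

primrec euler :: "(real \<Rightarrow> 'a \<Rightarrow> 'a) \<Rightarrow> 'a \<Rightarrow> real \<Rightarrow> nat \<Rightarrow> 'a::real_vector" where
  "euler F x0 h 0 = x0"
| "euler F x0 h (Suc k) = euler F x0 h k + h *\<^sub>R F (real k * h) (euler F x0 h k)"

definition dyadic_index :: "real \<Rightarrow> nat \<Rightarrow> nat" where
  "dyadic_index t n = nat \<lfloor>t * 2 ^ n\<rfloor>"

text \<open>Values are read off at grid points, without interpolation, and dyadic meshes make the
  grids nested. The limit is that of the operator norm, so the function depends neither on an ideal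
  nor on a time horizon.\<close>

definition euler_limit :: "(real \<Rightarrow> 'a \<Rightarrow> 'a) \<Rightarrow> 'a \<Rightarrow> real \<Rightarrow> 'a::real_normed_vector" where
  "euler_limit F x0 t = lim (\<lambda>n. euler F x0 ((1 / 2) ^ n) (dyadic_index t n))"

lemma dyadic_index_le: "0 \<le> t \<Longrightarrow> real (dyadic_index t n) * (1 / 2) ^ n \<le> t"
  by (simp add: dyadic_index_def power_divide field_simps)

lemma dyadic_index_gt: "t - (1 / 2) ^ n \<le> real (dyadic_index t n) * (1 / 2) ^ n"
proof -
  have "t * 2 ^ n - 1 \<le> real (dyadic_index t n)" unfolding dyadic_index_def by linarith
  then have "(t * 2 ^ n - 1) * (1 / 2) ^ n \<le> real (dyadic_index t n) * (1 / 2) ^ n"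
    by (intro mult_right_mono) auto
  then show ?thesis by (simp add: diff_divide_distrib power_one_over)
qed

lemma dyadic_index_mono: "s \<le> t \<Longrightarrow> dyadic_index s n \<le> dyadic_index t n"
  unfolding dyadic_index_def by (intro nat_mono floor_mono mult_right_mono) auto

lemma dyadic_index_0: "dyadic_index 0 n = 0"
  by (simp add: dyadic_index_def)

lemma dyadic_index_Suc:
  assumes "0 \<le> t"
  shows "dyadic_index t (Suc n) = 2 * dyadic_index t n \<or> dyadic_index t (Suc n) = 2 * dyadic_index t n + 1"
proof -
  have "0 \<le> t * 2 ^ n" using assms by simp
  then have "\<lfloor>2 * (t * 2 ^ n)\<rfloor> = 2 * \<lfloor>t * 2 ^ n\<rfloor> \<or> \<lfloor>2 * (t * 2 ^ n)\<rfloor> = 2 * \<lfloor>t * 2 ^ n\<rfloor> + 1"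
    "0 \<le> \<lfloor>t * 2 ^ n\<rfloor>" by linarith+
  then show ?thesis by (auto simp: dyadic_index_def mult.left_commute nat_mult_distrib nat_add_distrib)
qed

lemma dyadic_index_tendsto:
  assumes "0 \<le> t"
  shows "(\<lambda>n. real (dyadic_index t n) * (1 / 2) ^ n) \<longlonglongrightarrow> t"
proof (rule tendsto_sandwich)
  have "(\<lambda>n. t - (1 / 2) ^ n) \<longlonglongrightarrow> t - 0"
    by (intro tendsto_diff tendsto_const LIMSEQ_realpow_zero) auto
  then show "(\<lambda>n. t - (1 / 2) ^ n) \<longlonglongrightarrow> t" by simp
  show "(\<lambda>n. t) \<longlonglongrightarrow> t" by (rule tendsto_const)
qed (intro always_eventually allI dyadic_index_gt dyadic_index_le[OF assms])+

text \<open>D is a region in which F is Lipschitz and in which all sufficiently fine polygons remain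
  up to time \<tau>; \<open>n0\<close> says how fine. The flow and the linear equation are both
  instances.\<close>

locale euler_scheme = operator_ideal J N
  for J :: "'h::separable_infinite_dim_chilbert_space bop set" and N :: "'h bop \<Rightarrow> real" +
  fixes F :: "real \<Rightarrow> 'h bop \<Rightarrow> 'h bop" and x0 :: "'h bop" and \<tau> L :: real and D :: "'h bop set" and n0 :: nat
  assumes tau_nonneg: "0 \<le> \<tau>" and L_nonneg: "0 \<le> L"
    and in_D: "\<And>n k. n0 \<le> n \<Longrightarrow> real k * (1 / 2) ^ n \<le> \<tau> \<Longrightarrow> euler F x0 ((1 / 2) ^ n) k \<in> D"
    and D_J: "\<And>x. x \<in> D \<Longrightarrow> x - x0 \<in> J"
    and D_closed: "\<And>x l. (\<And>n. x n \<in> D) \<Longrightarrow> l - x0 \<in> J \<Longrightarrow> (\<lambda>n. N (x n - l)) \<longlonglongrightarrow> 0 \<Longrightarrow> l \<in> D"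
    and F_J: "\<And>t x. t \<in> {0..\<tau>} \<Longrightarrow> x \<in> D \<Longrightarrow> F t x \<in> J"
    and F_lip: "\<And>s t x y. s \<in> {0..\<tau>} \<Longrightarrow> t \<in> {0..\<tau>} \<Longrightarrow> x \<in> D \<Longrightarrow> y \<in> D \<Longrightarrow>
      N (F s x - F t y) \<le> L * (\<bar>s - t\<bar> + N (x - y))"
begin

abbreviation h :: "nat \<Rightarrow> real" where "h n \<equiv> (1 / 2) ^ n"
abbreviation E :: "nat \<Rightarrow> nat \<Rightarrow> 'h bop" where "E n k \<equiv> euler F x0 (h n) k"
abbreviation V :: "nat \<Rightarrow> nat \<Rightarrow> 'h bop" where "V n k \<equiv> F (real k * h n) (E n k)"

definition G :: real where "G = exp (L * \<tau>) * (N (F 0 x0) + 1)"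

lemma h_pos: "0 < h n" by simp

lemma D_diff_J: "x \<in> D \<Longrightarrow> y \<in> D \<Longrightarrow> x - y \<in> J"
  using J_diff[OF D_J D_J, of x y] by simp

lemma time_in: "real k * h n \<le> \<tau> \<Longrightarrow> real k * h n \<in> {0..\<tau>}"
  by simp

lemma time_le: "real k * h n \<le> \<tau> \<Longrightarrow> j \<le> k \<Longrightarrow> real j * h n \<le> \<tau>"
  by (rule order_trans[rotated], assumption) (intro mult_right_mono, auto)

lemma V_J: "n0 \<le> n \<Longrightarrow> real k * h n \<le> \<tau> \<Longrightarrow> V n k \<in> J"
  by (intro F_J time_in in_D)

lemma growth_le_exp:
  assumes "real k * h n \<le> \<tau>"
  shows "(1 + L * h n) ^ k \<le> exp (L * \<tau>)"
proof -
  have "(1 + L * h n) ^ k \<le> exp (L * h n) ^ k"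
    using L_nonneg by (intro power_mono) (auto intro: add_nonneg_nonneg simp: exp_ge_add_one_self)
  also have "\<dots> = exp (L * (real k * h n))" by (simp add: exp_of_nat_mult mult_ac flip: exp_of_nat_mult)
  also have "\<dots> \<le> exp (L * \<tau>)" using assms L_nonneg by (simp add: mult_left_mono)
  finally show ?thesis .
qed

lemma G_nonneg: "0 \<le> G"
proof -
  have "euler F x0 (h n0) 0 \<in> D" using tau_nonneg by (intro in_D) auto
  then have "F 0 x0 \<in> J" using tau_nonneg by (intro F_J) auto
  then show ?thesis unfolding G_def using norm_nonneg by (intro mult_nonneg_nonneg) auto
qed

text \<open>A discrete Gronwall inequality for \<open>N (V n k) + 1\<close>: one step moves the time
  by h and the state by \<open>h * N (V n k)\<close>, so F changes by at most L h times that sum.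
  The value of \<open>G\<close> comes from here.\<close>

lemma velocity_bound:
  assumes n: "n0 \<le> n" and k: "real k * h n \<le> \<tau>"
  shows "N (V n k) \<le> G"
proof -
  have "N (V n k) + 1 \<le> (1 + L * h n) ^ k * (N (F 0 x0) + 1)"
    using k
  proof (induction k)
    case (Suc k)
    have k: "real k * h n \<le> \<tau>" by (rule time_le[OF Suc.prems]) simp
    have "N (V n (Suc k) - V n k) \<le> L * (\<bar>real (Suc k) * h n - real k * h n\<bar> + N (E n (Suc k) - E n k))"
      by (intro F_lip time_in in_D n k Suc.prems)
    also have "N (E n (Suc k) - E n k) = h n * N (V n k)"
      using N_scaleR[OF V_J[OF n k], of "h n"] by simp
    also have "\<bar>real (Suc k) * h n - real k * h n\<bar> = h n" by (simp add: left_diff_distrib[symmetric])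
    finally have 1: "N (V n (Suc k) - V n k) \<le> L * h n * (N (V n k) + 1)" by (simp add: algebra_simps)
    have "N (V n (Suc k)) \<le> N (V n (Suc k) - V n k) + N (V n k)"
      using norm_triangle[OF J_diff[OF V_J[OF n Suc.prems] V_J[OF n k]] V_J[OF n k]] by simp
    then have "N (V n (Suc k)) + 1 \<le> (1 + L * h n) * (N (V n k) + 1)"
      using 1 by (simp add: algebra_simps)
    also have "\<dots> \<le> (1 + L * h n) * ((1 + L * h n) ^ k * (N (F 0 x0) + 1))"
      using L_nonneg Suc.IH[OF k] by (intro mult_left_mono) auto
    finally show ?case by (simp add: mult.assoc)
  qed simp
  also have "\<dots> \<le> G"
  proof -
    have "F 0 x0 \<in> J" using V_J[OF n, of 0] tau_nonneg by simp
    then show ?thesis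
      unfolding G_def using growth_le_exp[OF k] norm_nonneg by (intro mult_right_mono) auto
  qed
  finally show ?thesis by simp
qed

lemma scheme_lipschitz:
  assumes n: "n0 \<le> n" and l: "real (k + j) * h n \<le> \<tau>"
  shows "N (E n (k + j) - E n k) \<le> real j * h n * G"
  using l
proof (induction j)
  case (Suc j)
  have j: "real (k + j) * h n \<le> \<tau>" by (rule time_le[OF Suc.prems]) simp
  have k: "real k * h n \<le> \<tau>" by (rule time_le[OF Suc.prems]) simp
  have VJ: "V n (k + j) \<in> J" by (rule V_J[OF n j])
  have "N (E n (k + Suc j) - E n k) \<le> N (E n (k + j) - E n k) + N (h n *\<^sub>R V n (k + j))"
    using norm_triangle[OF D_diff_J[OF in_D[OF n j] in_D[OF n k]] J_scaleR[OF VJ, of "h n"]]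
    by (simp add: algebra_simps)
  also have "N (h n *\<^sub>R V n (k + j)) = h n * N (V n (k + j))" unfolding N_scaleR[OF VJ] by simp
  also have "\<dots> \<le> h n * G" by (intro mult_left_mono velocity_bound[OF n j]) simp
  finally show ?case using Suc.IH[OF j] by (simp add: algebra_simps)
qed (simp add: N_zero)

text \<open>A second-order estimate uniform in the mesh. Its limit yields differentiability without
  passing through integrals.\<close>

lemma scheme_quadratic:
  assumes n: "n0 \<le> n" and l: "real (k + j) * h n \<le> \<tau>"
  shows "N (E n (k + j) - E n k - (real j * h n) *\<^sub>R V n k) \<le> L * (1 + G) * (real j * h n)\<^sup>2"
  using l
proof (induction j)
  case (Suc j)
  have j: "real (k + j) * h n \<le> \<tau>" by (rule time_le[OF Suc.prems]) simp
  have k: "real k * h n \<le> \<tau>" by (rule time_le[OF Suc.prems]) simp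
  have VJ: "V n (k + j) \<in> J" "V n k \<in> J" by (rule V_J[OF n j], rule V_J[OF n k])
  have EJ: "E n (k + j) - E n k \<in> J" by (rule D_diff_J[OF in_D[OF n j] in_D[OF n k]])
  have eq: "E n (k + Suc j) - E n k - (real (Suc j) * h n) *\<^sub>R V n k =
      (E n (k + j) - E n k - (real j * h n) *\<^sub>R V n k) + h n *\<^sub>R (V n (k + j) - V n k)"
    by (simp add: algebra_simps)
  have "N (V n (k + j) - V n k) \<le> L * (\<bar>real (k + j) * h n - real k * h n\<bar> + N (E n (k + j) - E n k))"
    by (intro F_lip time_in in_D n j k)
  also have "\<dots> \<le> L * (real j * h n + real j * h n * G)"
    using scheme_lipschitz[OF n j] L_nonneg
    by (intro mult_left_mono add_mono) (auto simp: left_diff_distrib[symmetric])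
  finally have V: "N (V n (k + j) - V n k) \<le> L * (1 + G) * (real j * h n)" by (simp add: algebra_simps)
  have "N (E n (k + Suc j) - E n k - (real (Suc j) * h n) *\<^sub>R V n k) \<le>
      N (E n (k + j) - E n k - (real j * h n) *\<^sub>R V n k) + N (h n *\<^sub>R (V n (k + j) - V n k))"
    unfolding eq by (intro norm_triangle J_diff J_scaleR VJ EJ)
  also have "N (h n *\<^sub>R (V n (k + j) - V n k)) = h n * N (V n (k + j) - V n k)"
    unfolding N_scaleR[OF J_diff[OF VJ]] by simp
  also have "N (E n (k + j) - E n k - (real j * h n) *\<^sub>R V n k) + \<dots> \<le>
      L * (1 + G) * (real j * h n)\<^sup>2 + h n * (L * (1 + G) * (real j * h n))"
    using Suc.IH[OF j] V by (intro add_mono mult_left_mono) auto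
  also have "\<dots> = L * (1 + G) * ((real j * h n)\<^sup>2 + h n * (real j * h n))" by (simp add: algebra_simps)
  also have "\<dots> \<le> L * (1 + G) * (real (Suc j) * h n)\<^sup>2"
  proof (intro mult_left_mono mult_nonneg_nonneg)
    show "(real j * h n)\<^sup>2 + h n * (real j * h n) \<le> (real (Suc j) * h n)\<^sup>2"
      by (simp add: power2_eq_square algebra_simps)
  qed (use L_nonneg G_nonneg in auto)
  finally show ?case .
qed (simp add: N_zero)

section \<open>Comparison of consecutive meshes\<close>

definition C1 :: real where "C1 = \<tau> * (L * (1 + G)) * exp (L * \<tau>)"

text \<open>One full step is compared with two half steps. The second half step evaluates F later by
  h / 2 and at a point displaced by at most \<open>h / 2 * G\<close>, which causes the defect of
  order h^2.\<close>

lemma refine_one_step: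
  assumes n: "n0 \<le> n" and k: "real (Suc k) * h n \<le> \<tau>"
  shows "N (E n (Suc k) - E (Suc n) (2 * Suc k)) \<le>
    (1 + L * h n) * N (E n k - E (Suc n) (2 * k)) + (h n)\<^sup>2 * (L * (1 + G))"
proof -
  have kk: "real k * h n \<le> \<tau>" by (rule time_le[OF k]) simp
  have n': "n0 \<le> Suc n" using n by simp
  have half: "h (Suc n) = h n / 2" by simp
  have t2: "real (2 * k) * h (Suc n) = real k * h n" by simp
  have t1: "real (2 * k + 1) * h (Suc n) = real k * h n + h n / 2" by (simp add: algebra_simps)
  have le1: "real (2 * k + 1) * h (Suc n) \<le> \<tau>" 
    using k h_pos[of n] unfolding t1 of_nat_Suc distrib_right by linarith
  have le2: "real (2 * k) * h (Suc n) \<le> \<tau>" using kk unfolding t2 .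
  define x y z where "x = E n k" and "y = E (Suc n) (2 * k)" and "z = E (Suc n) (2 * k + 1)"
  have xD: "x \<in> D" "y \<in> D" "z \<in> D"
    unfolding x_def y_def z_def by (intro in_D n n' kk le1 le2)+
  define u v w where "u = F (real k * h n) x" and "v = F (real k * h n) y"
    and "w = F (real k * h n + h n / 2) z"
  have tin: "real k * h n \<in> {0..\<tau>}" "real k * h n + h n / 2 \<in> {0..\<tau>}"
    using time_in[OF kk] time_in[OF le1] unfolding t1 by auto
  have uJ: "u \<in> J" "v \<in> J" "w \<in> J"
    unfolding u_def v_def w_def by (intro F_J tin xD)+
  have xy: "x - y \<in> J" "x - z \<in> J" "y - z \<in> J" by (intro D_diff_J xD)+
  have Ex: "E n (Suc k) = x + h n *\<^sub>R u" by (simp add: x_def u_def)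
  have z: "z = y + (h n / 2) *\<^sub>R v" unfolding y_def z_def v_def by (simp add: mult.commute)
  have "E (Suc n) (2 * Suc k) = z + (h n / 2) *\<^sub>R w"
    unfolding z_def w_def t1[symmetric] by simp
  then have eq: "E n (Suc k) - E (Suc n) (2 * Suc k) =
      ((x - y) + (h n / 2) *\<^sub>R (u - v)) + (h n / 2) *\<^sub>R (u - w)"
    unfolding Ex z by (simp add: algebra_simps flip: scaleR_add_left)
  have "N (E n (Suc k) - E (Suc n) (2 * Suc k)) \<le> N (x - y) + N ((h n / 2) *\<^sub>R (u - v)) + N ((h n / 2) *\<^sub>R (u - w))"
    unfolding eq
    by (rule order_trans[OF norm_triangle add_right_mono[OF norm_triangle]]) (intro J_add J_diff J_scaleR uJ xy)+
  also have "\<dots> = N (x - y) + h n / 2 * N (u - v) + h n / 2 * N (u - w)"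
    using uJ by (simp add: N_scaleR J_diff)
  also have "\<dots> \<le> N (x - y) + h n / 2 * (L * N (x - y)) + h n / 2 * (L * (h n / 2 + (N (x - y) + h n / 2 * G)))"
  proof (intro add_mono mult_left_mono order_refl)
    show "N (u - v) \<le> L * N (x - y)"
      using F_lip[OF tin(1) tin(1) xD(1) xD(2)] by (simp add: u_def v_def)
    have "N (y - z) = h n / 2 * N v"
      using N_scaleR[OF uJ(2), of "h n / 2"] N_minus[OF J_scaleR[OF uJ(2), of "h n / 2"]] by (simp add: z)
    also have "N v \<le> G" unfolding v_def y_def t2[symmetric] by (rule velocity_bound[OF n' le2])
    finally have "N (x - z) \<le> N (x - y) + h n / 2 * G"
      using N_diff_triangle[OF xy(1,3)] by (simp add: mult_left_mono)
    then have "L * (h n / 2 + N (x - z)) \<le> L * (h n / 2 + (N (x - y) + h n / 2 * G))"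
      using L_nonneg by (intro mult_left_mono) auto
    then show "N (u - w) \<le> L * (h n / 2 + (N (x - y) + h n / 2 * G))"
      using F_lip[OF tin(1) tin(2) xD(1) xD(3)] by (simp add: u_def w_def)
  qed simp_all
  also have "\<dots> = (1 + L * h n) * N (x - y) + (h n)\<^sup>2 * (L * (1 + G)) / 4"
    by (simp add: power2_eq_square algebra_simps)
  also have "\<dots> \<le> (1 + L * h n) * N (x - y) + (h n)\<^sup>2 * (L * (1 + G))"
  proof -
    have "0 \<le> (h n)\<^sup>2 * (L * (1 + G))" using L_nonneg G_nonneg by simp
    then show ?thesis by linarith
  qed
  finally show ?thesis unfolding x_def y_def .
qed

text \<open>At most \<tau> / h defects \<open>(h n)^2 * (L * (1 + G))\<close> accumulate, each
  amplified by at most \<open>exp (L * \<tau>)\<close>; the total is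
  \<open>C1 * h n\<close>.\<close>

lemma refine_bound:
  assumes n: "n0 \<le> n" and k: "real k * h n \<le> \<tau>"
  shows "N (E n k - E (Suc n) (2 * k)) \<le> C1 * h n"
proof -
  let ?c = "(h n)\<^sup>2 * (L * (1 + G))"
  have c: "0 \<le> ?c" using L_nonneg G_nonneg by simp
  have g: "1 \<le> 1 + L * h n" using L_nonneg by simp
  have "N (E n k - E (Suc n) (2 * k)) \<le> real k * ?c * (1 + L * h n) ^ k"
    using k
  proof (induction k)
    case (Suc k)
    have "N (E n (Suc k) - E (Suc n) (2 * Suc k)) \<le> (1 + L * h n) * N (E n k - E (Suc n) (2 * k)) + ?c"
      by (rule refine_one_step[OF n Suc.prems])
    also have "\<dots> \<le> (1 + L * h n) * (real k * ?c * (1 + L * h n) ^ k) + ?c * (1 + L * h n) ^ Suc k"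
    proof (intro add_mono mult_left_mono Suc.IH)
      show "real k * h n \<le> \<tau>" by (rule time_le[OF Suc.prems]) simp
      show "?c \<le> ?c * (1 + L * h n) ^ Suc k"
        using mult_left_mono[OF one_le_power[OF g, of "Suc k"] c] by simp
    qed (use g in auto)
    also have "\<dots> = real (Suc k) * ?c * (1 + L * h n) ^ Suc k" by (simp add: algebra_simps)
    finally show ?case .
  qed (simp add: N_zero)
  also have "\<dots> = (real k * h n) * (L * (1 + G)) * (1 + L * h n) ^ k * h n"
    by (simp add: power2_eq_square)
  also have "\<dots> \<le> \<tau> * (L * (1 + G)) * exp (L * \<tau>) * h n"
    using k L_nonneg G_nonneg g growth_le_exp[OF k] tau_nonneg
    by (intro mult_right_mono mult_mono) (auto intro!: mult_nonneg_nonneg zero_le_power)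
  finally show ?thesis by (simp add: C1_def)
qed

section \<open>The limit of the polygons\<close>

abbreviation X :: "real \<Rightarrow> 'h bop" where "X \<equiv> euler_limit F x0"
abbreviation Y :: "nat \<Rightarrow> real \<Rightarrow> 'h bop" where "Y n t \<equiv> E n (dyadic_index t n)"

lemma index_time: "t \<in> {0..\<tau>} \<Longrightarrow> real (dyadic_index t n) * h n \<le> \<tau>"
  using dyadic_index_le[of t n] by simp

lemma Y_in_D: "n0 \<le> n \<Longrightarrow> t \<in> {0..\<tau>} \<Longrightarrow> Y n t \<in> D"
  by (intro in_D index_time)

lemma euler_limit_converges:
  assumes t: "t \<in> {0..\<tau>}"
  shows "X t - x0 \<in> J" and "(\<lambda>n. N (Y n t - X t)) \<longlonglongrightarrow> 0"
proof -
  define x where "x n = Y (n0 + n) t - x0" for n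
  have xJ: "x n \<in> J" for n unfolding x_def by (intro D_J Y_in_D t) simp
  have step: "N (x (Suc n) - x n) \<le> (C1 + G) * h n0 * (1 / 2) ^ n" for n
  proof -
    let ?m = "n0 + n" and ?k = "dyadic_index t (n0 + n)"
    have le: "real (2 * ?k) * h (Suc ?m) \<le> \<tau>" using index_time[OF t, of ?m] by simp
    have m: "n0 \<le> ?m" "n0 \<le> Suc ?m" by auto
    \<comment> \<open>In the even case both meshes read off the same time; in the odd case the finer
      one has made one further step, which costs at most \<open>h (Suc ?m) * G\<close>.\<close>
    have "dyadic_index t (Suc ?m) = 2 * ?k \<or> dyadic_index t (Suc ?m) = 2 * ?k + 1"
      using t by (intro dyadic_index_Suc) simp
    then have "N (Y (Suc ?m) t - E (Suc ?m) (2 * ?k)) \<le> h ?m * G"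
    proof (elim disjE)
      assume "dyadic_index t (Suc ?m) = 2 * ?k + 1"
      then have "N (Y (Suc ?m) t - E (Suc ?m) (2 * ?k)) \<le> real 1 * h (Suc ?m) * G"
        using scheme_lipschitz[OF m(2), of "2 * ?k" 1] index_time[OF t, of "Suc ?m"] by simp
      also have "\<dots> \<le> h ?m * G" using G_nonneg by (simp add: field_simps)
      finally show ?thesis .
    qed (use G_nonneg in \<open>auto simp: N_zero\<close>)
    moreover have "N (Y ?m t - E (Suc ?m) (2 * ?k)) \<le> C1 * h ?m"
      by (rule refine_bound[OF m(1) index_time[OF t]])
    moreover have "N (Y (Suc ?m) t - Y ?m t) \<le>
        N (Y (Suc ?m) t - E (Suc ?m) (2 * ?k)) + N (E (Suc ?m) (2 * ?k) - Y ?m t)"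
      by (intro N_diff_triangle D_diff_J Y_in_D in_D m t le)
    moreover have "N (E (Suc ?m) (2 * ?k) - Y ?m t) = N (Y ?m t - E (Suc ?m) (2 * ?k))"
      by (intro N_diff_commute D_diff_J Y_in_D in_D m t le)
    ultimately have "N (Y (Suc ?m) t - Y ?m t) \<le> (C1 + G) * h ?m" by (simp add: algebra_simps)
    then show ?thesis by (simp add: x_def power_add mult.assoc)
  qed
  obtain l where l: "l \<in> J" "(\<lambda>n. N (x n - l)) \<longlonglongrightarrow> 0"
    using J_geometric_converges[OF xJ step] by auto
  have "(\<lambda>n. N (Y (n + n0) t - (l + x0))) \<longlonglongrightarrow> 0"
    using l(2) by (simp add: x_def algebra_simps)
  then have N: "(\<lambda>n. N (Y n t - (l + x0))) \<longlonglongrightarrow> 0"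
    by (rule LIMSEQ_offset)
  have "\<forall>\<^sub>F n in sequentially. norm (Y n t - (l + x0)) \<le> N (Y n t - (l + x0))"
    using eventually_ge_at_top[of n0]
  proof eventually_elim
    case (elim n)
    have "Y n t - (l + x0) = (Y n t - x0) - l" by simp
    also have "\<dots> \<in> J" by (intro J_diff D_J Y_in_D elim t l)
    finally show ?case by (rule norm_le_N)
  qed
  \<comment> \<open>N dominates the operator norm, so the limit in N is the one that
    \<open>euler_limit\<close> picks.\<close>
  then have "(\<lambda>n. Y n t - (l + x0)) \<longlonglongrightarrow> 0" by (rule Lim_null_comparison[OF _ N])
  then have "(\<lambda>n. Y n t) \<longlonglongrightarrow> l + x0" by (simp add: LIM_zero_iff)
  then have "X t = l + x0" unfolding euler_limit_def by (rule limI)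
  then show "X t - x0 \<in> J" "(\<lambda>n. N (Y n t - X t)) \<longlonglongrightarrow> 0" using l(1) N by simp_all
qed

lemma euler_limit_in_D:
  assumes t: "t \<in> {0..\<tau>}"
  shows "X t \<in> D"
proof (rule D_closed)
  show "Y (n + n0) t \<in> D" for n by (intro Y_in_D t) simp
  show "X t - x0 \<in> J" by (rule euler_limit_converges(1)[OF t])
  show "(\<lambda>n. N (Y (n + n0) t - X t)) \<longlonglongrightarrow> 0"
    using euler_limit_converges(2)[OF t] by (rule LIMSEQ_ignore_initial_segment)
qed

lemma euler_limit_lipschitz:
  assumes s: "s \<in> {0..\<tau>}" and t: "t \<in> {0..\<tau>}" and ts: "t \<le> s"
  shows "N (X s - X t) \<le> G * (s - t)"
proof -
  let ?d = "\<lambda>n. real (dyadic_index s n) * h n - real (dyadic_index t n) * h n"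
  have "(\<lambda>n. N (Y n s - X s) + ?d n * G + N (Y n t - X t)) \<longlonglongrightarrow> 0 + (s - t) * G + 0"
    by (intro tendsto_add tendsto_mult_right tendsto_diff[OF dyadic_index_tendsto dyadic_index_tendsto]
        euler_limit_converges s t) (use s t in auto)
  moreover have "N (X s - X t) \<le> N (Y n s - X s) + ?d n * G + N (Y n t - X t)" if n: "n0 \<le> n" for n
  proof -
    let ?j = "dyadic_index s n - dyadic_index t n"
    have j: "dyadic_index t n + ?j = dyadic_index s n"
      by (rule le_add_diff_inverse[OF dyadic_index_mono[OF ts]])
    have d: "?d n = real ?j * h n" 
      by (simp add: of_nat_diff[OF dyadic_index_mono[OF ts]] left_diff_distrib)
    note YD = Y_in_D[OF n s] Y_in_D[OF n t] and XD = euler_limit_in_D[OF s] euler_limit_in_D[OF t]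
    have "N (Y n s - Y n t) \<le> ?d n * G"
      unfolding d using scheme_lipschitz[OF n, of "dyadic_index t n" ?j] index_time[OF s, of n] by (simp only: j)
    moreover have "N (X s - X t) \<le> N (X s - Y n s) + N (Y n s - X t)"
      by (intro N_diff_triangle D_diff_J YD XD)
    moreover have "N (Y n s - X t) \<le> N (Y n s - Y n t) + N (Y n t - X t)"
      by (intro N_diff_triangle D_diff_J YD XD)
    moreover have "N (X s - Y n s) = N (Y n s - X s)" by (intro N_diff_commute D_diff_J YD XD)
    ultimately show ?thesis by linarith
  qed
  ultimately have "N (X s - X t) \<le> 0 + (s - t) * G + 0"
    by (intro tendsto_lowerbound[of _ _ sequentially]) (auto simp: eventually_sequentially)
  then show ?thesis by (simp add: mult.commute)
qed

text \<open>\<open>scheme_quadratic\<close> in the limit. \<open>?R\<close> also collects the errors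
  of replacing grid times by s and t and polygon values by limits; all of these tend to 0.\<close>

lemma euler_limit_quadratic_forward:
  assumes s: "s \<in> {0..\<tau>}" and t: "t \<in> {0..\<tau>}" and ts: "t \<le> s"
  shows "N (X s - X t - (s - t) *\<^sub>R F t (X t)) \<le> L * (1 + G) * (s - t)\<^sup>2"
proof -
  let ?t = "\<lambda>n. real (dyadic_index t n) * h n"
  let ?d = "\<lambda>n. real (dyadic_index s n) * h n - ?t n"
  let ?W = "F t (X t)"
  let ?R = "\<lambda>n. L * (1 + G) * (?d n)\<^sup>2 + N (Y n s - X s) + N (Y n t - X t) +
      \<bar>?d n - (s - t)\<bar> * N ?W + \<bar>?d n\<bar> * (L * (\<bar>?t n - t\<bar> + N (Y n t - X t)))"
  have lim_combine: "(\<lambda>n. L * (1 + G) * (d n)\<^sup>2 + p n + q n + \<bar>d n - (s - t)\<bar> * N ?W +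
        \<bar>d n\<bar> * (L * (\<bar>r n - t\<bar> + q n)))
      \<longlonglongrightarrow> L * (1 + G) * (s - t)\<^sup>2 + 0 + 0 + \<bar>(s - t) - (s - t)\<bar> * N ?W + \<bar>s - t\<bar> * (L * (\<bar>t - t\<bar> + 0))"
    if "d \<longlonglongrightarrow> s - t" "p \<longlonglongrightarrow> 0" "q \<longlonglongrightarrow> 0" "r \<longlonglongrightarrow> t" for d p q r :: "nat \<Rightarrow> real"
    by (intro tendsto_intros that)
  have times: "(\<lambda>n. real (dyadic_index s n) * h n) \<longlonglongrightarrow> s" "?t \<longlonglongrightarrow> t"
    using s t by (simp_all add: dyadic_index_tendsto)
  have "?R \<longlonglongrightarrow> L * (1 + G) * (s - t)\<^sup>2 + 0 + 0 + \<bar>(s - t) - (s - t)\<bar> * N ?W + \<bar>s - t\<bar> * (L * (\<bar>t - t\<bar> + 0))"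
    by (rule lim_combine[OF tendsto_diff[OF times] euler_limit_converges(2)[OF s]
          euler_limit_converges(2)[OF t] times(2)])
  then have lim: "?R \<longlonglongrightarrow> L * (1 + G) * (s - t)\<^sup>2" by simp
  have "N (X s - X t - (s - t) *\<^sub>R ?W) \<le> ?R n" if n: "n0 \<le> n" for n
  proof -
    let ?j = "dyadic_index s n - dyadic_index t n"
    have j: "dyadic_index t n + ?j = dyadic_index s n"
      by (rule le_add_diff_inverse[OF dyadic_index_mono[OF ts]])
    have d: "?d n = real ?j * h n" 
      by (simp add: of_nat_diff[OF dyadic_index_mono[OF ts]] left_diff_distrib)
    define ys yt xs xt W v \<delta> where "ys = Y n s" and "yt = Y n t" and "xs = X s" and "xt = X t"
      and "W = ?W" and "v = V n (dyadic_index t n)" and "\<delta> = ?d n"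
    have D: "ys \<in> D" "yt \<in> D" "xs \<in> D" "xt \<in> D"
      unfolding ys_def yt_def xs_def xt_def by (intro Y_in_D euler_limit_in_D n s t)+
    have WJ: "W \<in> J" "v \<in> J"
      unfolding W_def v_def by (intro F_J t euler_limit_in_D V_J n index_time)+
    have q: "N (ys - yt - \<delta> *\<^sub>R v) \<le> L * (1 + G) * \<delta>\<^sup>2"
      unfolding \<delta>_def ys_def yt_def v_def d
      using scheme_quadratic[OF n, of "dyadic_index t n" ?j] index_time[OF s, of n] by (simp only: j)
    have vW: "N (v - W) \<le> L * (\<bar>?t n - t\<bar> + N (yt - xt))"
      unfolding v_def W_def yt_def xt_def
      by (intro F_lip time_in index_time t Y_in_D n euler_limit_in_D)
    have eq: "xs - xt - (s - t) *\<^sub>R W =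
        (ys - yt - \<delta> *\<^sub>R v) - (ys - xs) + (yt - xt) + (\<delta> - (s - t)) *\<^sub>R W + \<delta> *\<^sub>R (v - W)"
      by (simp add: algebra_simps)
    have tri: "N (A - B + C + P + Q) \<le> N A + N B + N C + N P + N Q"
      if "A \<in> J" "B \<in> J" "C \<in> J" "P \<in> J" "Q \<in> J" for A B C P Q
      using norm_triangle[OF J_add[OF J_add[OF J_diff[OF that(1,2)] that(3)] that(4)] that(5)]
        norm_triangle[OF J_add[OF J_diff[OF that(1,2)] that(3)] that(4)]
        norm_triangle[OF J_diff[OF that(1,2)] that(3)] N_diff_le[OF that(1,2)] by linarith
    have "N (xs - xt - (s - t) *\<^sub>R W) \<le> N (ys - yt - \<delta> *\<^sub>R v) + N (ys - xs) + N (yt - xt) +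
        N ((\<delta> - (s - t)) *\<^sub>R W) + N (\<delta> *\<^sub>R (v - W))"
      unfolding eq by (intro tri J_diff J_scaleR WJ D_diff_J D)
    also have "\<dots> = N (ys - yt - \<delta> *\<^sub>R v) + N (ys - xs) + N (yt - xt) +
        \<bar>\<delta> - (s - t)\<bar> * N W + \<bar>\<delta>\<bar> * N (v - W)"
      by (simp add: N_scaleR WJ J_diff)
    also have "\<dots> \<le> L * (1 + G) * \<delta>\<^sup>2 + N (ys - xs) + N (yt - xt) +
        \<bar>\<delta> - (s - t)\<bar> * N W + \<bar>\<delta>\<bar> * (L * (\<bar>?t n - t\<bar> + N (yt - xt)))"
      by (intro add_mono order_refl q mult_left_mono vW) simp
    finally show ?thesis unfolding xs_def xt_def W_def ys_def yt_def \<delta>_def .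
  qed
  then show ?thesis
    by (intro tendsto_lowerbound[OF lim]) (auto simp: eventually_sequentially)
qed

text \<open>For s < t the forward estimate is applied at s, and exchanging F at s for F at t costs
  the same amount again; hence the factor 2.\<close>

lemma euler_limit_quadratic:
  assumes s: "s \<in> {0..\<tau>}" and t: "t \<in> {0..\<tau>}"
  shows "N (X s - X t - (s - t) *\<^sub>R F t (X t)) \<le> 2 * L * (1 + G) * (s - t)\<^sup>2"
proof (cases "t \<le> s")
  case True
  have "0 \<le> L * (1 + G) * (s - t)\<^sup>2" using L_nonneg G_nonneg by simp
  then show ?thesis using euler_limit_quadratic_forward[OF s t True] by linarith
next
  case False
  then have st: "s \<le> t" by simp
  note D = euler_limit_in_D[OF s] euler_limit_in_D[OF t]
  have FJ: "F s (X s) \<in> J" "F t (X t) \<in> J" by (intro F_J s t D)+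
  have XJ: "X t - X s \<in> J" by (intro D_diff_J D)
  have eq: "X s - X t - (s - t) *\<^sub>R F t (X t) =
      (t - s) *\<^sub>R (F t (X t) - F s (X s)) - (X t - X s - (t - s) *\<^sub>R F s (X s))"
    by (simp add: algebra_simps)
  have "N (X s - X t - (s - t) *\<^sub>R F t (X t)) \<le>
      N ((t - s) *\<^sub>R (F t (X t) - F s (X s))) + N (X t - X s - (t - s) *\<^sub>R F s (X s))"
    unfolding eq by (intro N_diff_le J_scaleR J_diff FJ XJ)
  also have "N ((t - s) *\<^sub>R (F t (X t) - F s (X s))) = (t - s) * N (F t (X t) - F s (X s))"
    using st by (simp add: N_scaleR[OF J_diff[OF FJ(2,1)]])
  also have "\<dots> \<le> (t - s) * (L * (\<bar>t - s\<bar> + N (X t - X s)))"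
    using st by (intro mult_left_mono F_lip s t D) auto
  also have "\<dots> \<le> (t - s) * (L * (\<bar>t - s\<bar> + G * (t - s)))"
    using st L_nonneg euler_limit_lipschitz[OF t s st] by (intro mult_left_mono add_mono) auto
  also have "\<dots> = L * (1 + G) * (t - s)\<^sup>2"
    using st by (simp add: power2_eq_square algebra_simps)
  finally have "N (X s - X t - (s - t) *\<^sub>R F t (X t)) \<le>
      L * (1 + G) * (t - s)\<^sup>2 + N (X t - X s - (t - s) *\<^sub>R F s (X s))" by simp
  also have "\<dots> \<le> L * (1 + G) * (t - s)\<^sup>2 + L * (1 + G) * (t - s)\<^sup>2"
    by (intro add_left_mono euler_limit_quadratic_forward[OF t s st])
  also have "\<dots> = 2 * L * (1 + G) * (t - s)\<^sup>2" by (simp add: algebra_simps)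
  finally show ?thesis unfolding power2_commute[of s t] .
qed

end

section \<open>Differentiability in the ideal norm\<close>

text \<open>A norm need not be differentiable, so only a one-sided Dini bound is assumed. The
  comparison function \<open>E\<close> grows at rate L + 1 instead of L; as \<open>E\<close> is at
  least \<open>\<eta>\<close>, this slack absorbs the error term whenever u lies below
  \<open>E\<close>.\<close>

lemma gronwall_zero:
  fixes u :: "real \<Rightarrow> real"
  assumes cont: "continuous_on {0..\<tau>} u" and u0: "u 0 = 0" and L: "0 \<le> L"
    and dini: "\<And>t e. 0 \<le> t \<Longrightarrow> t < \<tau> \<Longrightarrow> 0 < e \<Longrightarrow>
      \<exists>d>0. \<forall>s. t < s \<and> s < t + d \<and> s \<le> \<tau> \<longrightarrow> u s \<le> u t + (s - t) * (L * u t + e)"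
    and t: "t \<in> {0..\<tau>}"
  shows "u t \<le> 0"
proof (rule field_le_epsilon)
  fix e :: real assume e: "0 < e"
  define \<eta> where "\<eta> = e * exp (- ((L + 1) * \<tau>))"
  define E where "E s = \<eta> * exp ((L + 1) * s)" for s
  have \<eta>: "0 < \<eta>" using e by (simp add: \<eta>_def)
  define w where "w s = u s - E s" for s
  have contw: "continuous_on {0..\<tau>} w"
    unfolding w_def E_def by (intro continuous_intros cont)
  have "w s \<le> 0" if s: "s \<in> {0..\<tau>}" for s
  proof (rule ccontr)
    assume ws: "\<not> w s \<le> 0"
    define B where "B = {r \<in> {0..\<tau>}. 0 < w r}"
    have sB: "s \<in> B" using s ws by (simp add: B_def)
    have bdd: "bdd_below B" by (rule bdd_belowI[of _ 0]) (simp add: B_def)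
    \<comment> \<open>By continuity w is still nonpositive at \<open>t0\<close>, and the Dini bound
      keeps it so on an interval beyond, against the choice of the infimum.\<close>
    define t0 where "t0 = Inf B"
    have t0: "0 \<le> t0" "t0 \<le> s"
      unfolding t0_def using sB bdd by (auto intro!: cInf_greatest cInf_lower simp: B_def)
    have before: "w r \<le> 0" if r: "0 \<le> r" "r < t0" for r
    proof (rule ccontr)
      assume "\<not> w r \<le> 0"
      then have "r \<in> B" using r t0 s by (simp add: B_def)
      then have "t0 \<le> r" unfolding t0_def by (rule cInf_lower[OF _ bdd])
      then show False using r by simp
    qed
    have wt0: "w t0 \<le> 0"
    proof (cases "t0 = 0")
      case True
      then show ?thesis using u0 \<eta> by (simp add: w_def E_def)
    next
      case False
      then have "0 < t0" using t0 by simp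
      have "closed {r \<in> {0..\<tau>}. w r \<le> 0}"
        by (rule continuous_on_closed_Collect_le[OF contw continuous_on_const closed_atLeastAtMost])
      moreover have "{0..<t0} \<subseteq> {r \<in> {0..\<tau>}. w r \<le> 0}" using before t0 s by auto
      ultimately have "closure {0..<t0} \<subseteq> {r \<in> {0..\<tau>}. w r \<le> 0}" by (intro closure_minimal)
      moreover have "t0 \<in> closure {0..<t0}" using \<open>0 < t0\<close> by (simp add: closure_atLeastLessThan)
      ultimately show ?thesis by blast
    qed
    have "t0 \<noteq> s" using wt0 ws by auto
    then have t0\<tau>: "t0 < \<tau>" using t0 s by auto
    obtain d where d: "0 < d" "\<And>r. t0 < r \<Longrightarrow> r < t0 + d \<Longrightarrow> r \<le> \<tau> \<Longrightarrow>
        u r \<le> u t0 + (r - t0) * (L * u t0 + \<eta>)"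
      using dini[OF t0(1) t0\<tau> \<eta>] by blast
    have after: "w r \<le> 0" if r: "t0 < r" "r < t0 + d" "r \<le> \<tau>" for r
    proof -
      have ut: "u t0 \<le> E t0" using wt0 by (simp add: w_def)
      have \<eta>E: "\<eta> \<le> E t0" using \<eta> L t0(1) by (simp add: E_def)
      have "L * u t0 + \<eta> \<le> L * E t0 + E t0" using L ut \<eta>E by (intro add_mono mult_left_mono)
      then have "(r - t0) * (L * u t0 + \<eta>) \<le> (r - t0) * (L * E t0 + E t0)"
        using r by (intro mult_left_mono) auto
      then have "u r \<le> E t0 + (r - t0) * (L * E t0 + E t0)" using d(2)[OF r] ut by linarith
      also have "\<dots> = E t0 * (1 + (L + 1) * (r - t0))" by (simp add: algebra_simps)
      also have "\<dots> \<le> E t0 * exp ((L + 1) * (r - t0))"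
        using \<eta>E \<eta> by (intro mult_left_mono exp_ge_add_one_self) auto
      also have "\<dots> = E r" by (simp add: E_def algebra_simps flip: exp_add)
      finally show ?thesis by (simp add: w_def)
    qed
    have "t0 + d \<le> r" if r: "r \<in> B" for r
    proof (rule ccontr)
      assume lt: "\<not> t0 + d \<le> r"
      have "t0 \<le> r" unfolding t0_def by (rule cInf_lower[OF r bdd])
      then have "w r \<le> 0" using wt0 after[of r] lt r by (cases "r = t0") (auto simp: B_def)
      then show False using r by (simp add: B_def)
    qed
    then have "t0 + d \<le> Inf B" using sB by (intro cInf_greatest) auto
    then show False using d(1) by (simp add: t0_def)
  qed
  then have "u t \<le> E t" using t by (simp add: w_def)
  also have "E t \<le> \<eta> * exp ((L + 1) * \<tau>)"
    unfolding E_def using \<eta> L t by (intro mult_left_mono) (auto intro: mult_left_mono)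
  also have "\<dots> = e" by (simp add: \<eta>_def mult.assoc flip: exp_add)
  finally show "u t \<le> 0 + e" by simp
qed

section \<open>Derivatives measured in the ideal norm\<close>

context operator_ideal
begin

text \<open>Only increments occur, because X itself need not take values in J. The inequality is
  multiplied by \<open>\<bar>s - t\<bar>\<close>, which avoids quotients.\<close>

definition J_deriv :: "(real \<Rightarrow> 'h bop) \<Rightarrow> (real \<Rightarrow> 'h bop) \<Rightarrow> bool" where
  "J_deriv X X' \<longleftrightarrow> (\<forall>t\<ge>0. X' t \<in> J \<and> (\<forall>s\<ge>0. X s - X t \<in> J) \<and>
     (\<forall>e>0. \<exists>d>0. \<forall>s\<ge>0. \<bar>s - t\<bar> < d \<longrightarrow> N (X s - X t - (s - t) *\<^sub>R X' t) \<le> e * \<bar>s - t\<bar>))"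

text \<open>What the Euler scheme provides: a second-order remainder, uniform on bounded time
  intervals. Continuity of the derivative in N is a consequence.\<close>

definition J_deriv_lipschitz :: "(real \<Rightarrow> 'h bop) \<Rightarrow> (real \<Rightarrow> 'h bop) \<Rightarrow> bool" where
  "J_deriv_lipschitz X X' \<longleftrightarrow> (\<forall>\<tau>\<ge>0. \<exists>C\<ge>0. \<forall>s\<in>{0..\<tau>}. \<forall>t\<in>{0..\<tau>}. X s - X t \<in> J \<and> X' t \<in> J \<and>
     N (X s - X t) \<le> C * \<bar>s - t\<bar> \<and> N (X s - X t - (s - t) *\<^sub>R X' t) \<le> C * (s - t)\<^sup>2)"

lemma J_deriv_lipschitz_imp_J_deriv:
  assumes X: "J_deriv_lipschitz X X'"
  shows "J_deriv X X'"
  unfolding J_deriv_def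
proof (intro allI impI conjI)
  fix t :: real assume t: "0 \<le> t"
  obtain C where C: "C \<ge> 0" "\<And>r s. r \<in> {0..t + 1} \<Longrightarrow> s \<in> {0..t + 1} \<Longrightarrow> X r - X s \<in> J \<and> X' s \<in> J \<and>
      N (X r - X s) \<le> C * \<bar>r - s\<bar> \<and> N (X r - X s - (r - s) *\<^sub>R X' s) \<le> C * (r - s)\<^sup>2"
    using X t unfolding J_deriv_lipschitz_def by (metis add_nonneg_nonneg zero_le_one)
  show "X' t \<in> J" using C(2)[of t t] t by simp
  fix s :: real assume s: "0 \<le> s"
  have "max s t \<ge> 0" using s by simp
  then obtain C' where "\<And>p q. p \<in> {0..max s t} \<Longrightarrow> q \<in> {0..max s t} \<Longrightarrow> X p - X q \<in> J"
    using X unfolding J_deriv_lipschitz_def by metis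
  then show "X s - X t \<in> J" using s t by simp
next
  fix t e :: real assume t: "0 \<le> t" and e: "0 < e"
  obtain C where C: "C \<ge> 0" "\<And>r s. r \<in> {0..t + 1} \<Longrightarrow> s \<in> {0..t + 1} \<Longrightarrow>
      N (X r - X s - (r - s) *\<^sub>R X' s) \<le> C * (r - s)\<^sup>2"
    using X t unfolding J_deriv_lipschitz_def by (metis add_nonneg_nonneg zero_le_one)
  show "\<exists>d>0. \<forall>s\<ge>0. \<bar>s - t\<bar> < d \<longrightarrow> N (X s - X t - (s - t) *\<^sub>R X' t) \<le> e * \<bar>s - t\<bar>"
  proof (intro exI conjI allI impI)
    show "0 < min 1 (e / (C + 1))" using e C(1) by simp
    fix s assume s: "0 \<le> s" "\<bar>s - t\<bar> < min 1 (e / (C + 1))"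
    have "C * \<bar>s - t\<bar> \<le> (C + 1) * (e / (C + 1))" using s C(1) by (intro mult_mono) auto
    also have "\<dots> = e" using C(1) by simp
    finally have "C * \<bar>s - t\<bar> * \<bar>s - t\<bar> \<le> e * \<bar>s - t\<bar>" by (intro mult_right_mono) auto
    moreover have "N (X s - X t - (s - t) *\<^sub>R X' t) \<le> C * (s - t)\<^sup>2" using s t by (intro C(2)) auto
    moreover have "C * (s - t)\<^sup>2 = C * \<bar>s - t\<bar> * \<bar>s - t\<bar>"
      by (simp add: power2_eq_square mult.assoc flip: abs_mult)
    ultimately show "N (X s - X t - (s - t) *\<^sub>R X' t) \<le> e * \<bar>s - t\<bar>" by linarith
  qed
qed

lemma J_deriv_imp_has_vector_derivative:
  assumes X: "J_deriv X X'" and t: "0 \<le> t"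
  shows "(X has_vector_derivative X' t) (at t within {0..})"
  unfolding has_vector_derivative_def has_derivative_within_alt
proof (intro conjI allI impI)
  fix e :: real assume "0 < e"
  then obtain d where d: "d > 0" "\<And>s. 0 \<le> s \<Longrightarrow> \<bar>s - t\<bar> < d \<Longrightarrow> N (X s - X t - (s - t) *\<^sub>R X' t) \<le> e * \<bar>s - t\<bar>"
    using X t unfolding J_deriv_def by metis
  have "norm (X s - X t - (s - t) *\<^sub>R X' t) \<le> e * norm (s - t)" if s: "0 \<le> s" "\<bar>s - t\<bar> < d" for s
  proof -
    have "X s - X t \<in> J" "X' t \<in> J" using X t s unfolding J_deriv_def by blast+
    then have "X s - X t - (s - t) *\<^sub>R X' t \<in> J" by (intro J_diff[OF _ J_scaleR])
    from norm_le_N[OF this] d(2)[OF s] show ?thesis by simp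
  qed
  then show "\<exists>d>0. \<forall>s\<in>{0..}. norm (s - t) < d \<longrightarrow> norm (X s - X t - (s - t) *\<^sub>R X' t) \<le> e * norm (s - t)"
    using d(1) by (intro exI[of _ d]) auto
qed (rule bounded_linear_scaleR_left)

lemma J_deriv_diff:
  assumes X: "J_deriv X X'" and Y: "J_deriv Y Y'"
  shows "J_deriv (\<lambda>t. X t - Y t) (\<lambda>t. X' t - Y' t)"
  unfolding J_deriv_def
proof (intro allI impI conjI)
  fix t :: real assume t: "0 \<le> t"
  note XJ = X[unfolded J_deriv_def, rule_format, OF t, THEN conjunct1]
    X[unfolded J_deriv_def, rule_format, OF t, THEN conjunct2, THEN conjunct1, rule_format]
  note YJ = Y[unfolded J_deriv_def, rule_format, OF t, THEN conjunct1]
    Y[unfolded J_deriv_def, rule_format, OF t, THEN conjunct2, THEN conjunct1, rule_format]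
  show "X' t - Y' t \<in> J" by (intro J_diff XJ YJ)
  have eq: "X s - Y s - (X t - Y t) = (X s - X t) - (Y s - Y t)" for s by simp
  show "X s - Y s - (X t - Y t) \<in> J" if "0 \<le> s" for s
    unfolding eq by (intro J_diff XJ YJ that)
  fix e :: real assume e: "0 < e"
  obtain d1 where d1: "d1 > 0" "\<And>s. 0 \<le> s \<Longrightarrow> \<bar>s - t\<bar> < d1 \<Longrightarrow> N (X s - X t - (s - t) *\<^sub>R X' t) \<le> e / 2 * \<bar>s - t\<bar>"
    using X t e unfolding J_deriv_def by (metis half_gt_zero)
  obtain d2 where d2: "d2 > 0" "\<And>s. 0 \<le> s \<Longrightarrow> \<bar>s - t\<bar> < d2 \<Longrightarrow> N (Y s - Y t - (s - t) *\<^sub>R Y' t) \<le> e / 2 * \<bar>s - t\<bar>"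
    using Y t e unfolding J_deriv_def by (metis half_gt_zero)
  show "\<exists>d>0. \<forall>s\<ge>0. \<bar>s - t\<bar> < d \<longrightarrow>
      N (X s - Y s - (X t - Y t) - (s - t) *\<^sub>R (X' t - Y' t)) \<le> e * \<bar>s - t\<bar>"
  proof (intro exI conjI allI impI)
    show "0 < min d1 d2" using d1 d2 by simp
    fix s assume s: "0 \<le> s" "\<bar>s - t\<bar> < min d1 d2"
    have "X s - Y s - (X t - Y t) - (s - t) *\<^sub>R (X' t - Y' t) =
        (X s - X t - (s - t) *\<^sub>R X' t) - (Y s - Y t - (s - t) *\<^sub>R Y' t)" by (simp add: algebra_simps)
    then have "N (X s - Y s - (X t - Y t) - (s - t) *\<^sub>R (X' t - Y' t)) \<le>
        N (X s - X t - (s - t) *\<^sub>R X' t) + N (Y s - Y t - (s - t) *\<^sub>R Y' t)"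
      by (simp only:) (intro N_diff_le J_diff J_scaleR XJ YJ s)
    then show "N (X s - Y s - (X t - Y t) - (s - t) *\<^sub>R (X' t - Y' t)) \<le> e * \<bar>s - t\<bar>"
      using d1(2)[of s] d2(2)[of s] s by (simp add: field_simps)
  qed
qed

lemma J_deriv_zero_unique:
  assumes D: "J_deriv D D'" and D0: "D 0 = 0" and L: "0 \<le> L"
    and bound: "\<And>t. 0 \<le> t \<Longrightarrow> N (D' t) \<le> L * N (D t)" and t: "0 \<le> t"
  shows "D t = 0"
proof -
  have DJ: "D s - D r \<in> J" if "0 \<le> s" "0 \<le> r" for s r using D that unfolding J_deriv_def by blast
  have DJ0: "D s \<in> J" if "0 \<le> s" for s using DJ[OF that, of 0] D0 by simp
  have D'J: "D' s \<in> J" if "0 \<le> s" for s using D that unfolding J_deriv_def by blast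
  have step: "\<exists>d>0. \<forall>s\<ge>0. \<bar>s - r\<bar> < d \<longrightarrow> N (D s - D r) \<le> \<bar>s - r\<bar> * (L * N (D r) + e)"
    if r: "0 \<le> r" and e: "0 < e" for r e
  proof -
    obtain d where d: "d > 0" "\<And>s. 0 \<le> s \<Longrightarrow> \<bar>s - r\<bar> < d \<Longrightarrow> N (D s - D r - (s - r) *\<^sub>R D' r) \<le> e * \<bar>s - r\<bar>"
      using D r e unfolding J_deriv_def by metis
    have "N (D s - D r) \<le> \<bar>s - r\<bar> * (L * N (D r) + e)" if s: "0 \<le> s" "\<bar>s - r\<bar> < d" for s
    proof -
      have "N (D s - D r) \<le> N (D s - D r - (s - r) *\<^sub>R D' r) + N ((s - r) *\<^sub>R D' r)"
        using norm_triangle[OF J_diff[OF DJ[OF s(1) r] J_scaleR[OF D'J[OF r]]] J_scaleR[OF D'J[OF r]],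
            of "s - r" "s - r"] by simp
      also have "\<dots> \<le> e * \<bar>s - r\<bar> + \<bar>s - r\<bar> * (L * N (D r))"
        unfolding N_scaleR[OF D'J[OF r]] by (intro add_mono d(2) s mult_left_mono bound r) simp
      finally show ?thesis by (simp add: algebra_simps)
    qed
    then show ?thesis using d(1) by blast
  qed
  have Nle: "N (D s) \<le> N (D r) + N (D s - D r)" if "0 \<le> s" "0 \<le> r" for s r
    using norm_triangle[OF DJ0[OF that(2)] DJ[OF that]] by simp
  have "N (D t) \<le> 0"
  proof (rule gronwall_zero[where u = "\<lambda>t. N (D t)" and L = L and \<tau> = t])
    show "continuous_on {0..t} (\<lambda>t. N (D t))"
    proof (rule continuous_onI)
      fix r e :: real assume r: "r \<in> {0..t}" and e: "0 < e"
      obtain d where d: "d > 0" "\<And>s. 0 \<le> s \<Longrightarrow> \<bar>s - r\<bar> < d \<Longrightarrow> N (D s - D r) \<le> \<bar>s - r\<bar> * (L * N (D r) + 1)"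
        using step[of r 1] r by auto
      define A where "A = L * N (D r) + 1"
      have A: "0 < A" using L norm_nonneg[OF DJ0] r by (auto simp: A_def add_nonneg_pos)
      show "\<exists>d>0. \<forall>s\<in>{0..t}. dist s r < d \<longrightarrow> dist (N (D s)) (N (D r)) \<le> e"
      proof (intro exI conjI ballI impI)
        show "0 < min d (e / A)" using d e A by simp
        fix s assume s: "s \<in> {0..t}" "dist s r < min d (e / A)"
        have "N (D s - D r) \<le> \<bar>s - r\<bar> * A" unfolding A_def using s by (intro d(2)) (auto simp: dist_real_def)
        also have "\<dots> \<le> e / A * A" using s A by (intro mult_right_mono) (auto simp: dist_real_def)
        finally have "N (D s - D r) \<le> e" using A by simp
        moreover have "N (D r - D s) = N (D s - D r)" using s r by (intro N_diff_commute DJ) auto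
        ultimately show "dist (N (D s)) (N (D r)) \<le> e"
          using Nle[of s r] Nle[of r s] s r by (auto simp: dist_real_def abs_le_iff)
      qed
    qed
    show "N (D 0) = 0" by (simp add: D0 N_zero)
    show "\<exists>d>0. \<forall>s. r < s \<and> s < r + d \<and> s \<le> t \<longrightarrow> N (D s) \<le> N (D r) + (s - r) * (L * N (D r) + e)"
      if r: "0 \<le> r" and e: "0 < e" for r e
    proof -
      obtain d where d: "d > 0" "\<And>s. 0 \<le> s \<Longrightarrow> \<bar>s - r\<bar> < d \<Longrightarrow> N (D s - D r) \<le> \<bar>s - r\<bar> * (L * N (D r) + e)"
        using step[OF r e] by auto
      have "N (D s) \<le> N (D r) + (s - r) * (L * N (D r) + e)" if "r < s" "s < r + d" for s
        using Nle[of s r] d(2)[of s] that r by simp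
      then show ?thesis using d(1) by blast
    qed
  qed (use t L in auto)
  then show ?thesis using norm_nonneg[OF DJ0[OF t]] norm_eq_0_iff[OF DJ0[OF t]] by simp
qed

lemma C1_ideal_imp_J_deriv:
  assumes Y: "C1_ideal J N (\<lambda>t. Y t - T)"
  shows "\<exists>Y'. J_deriv Y Y'"
proof -
  obtain Y' where YJ: "\<And>t. 0 \<le> t \<Longrightarrow> Y t - T \<in> J"
    and lim: "\<And>t. 0 \<le> t \<Longrightarrow> limitin mtopology (\<lambda>s. ((Y s - T) - (Y t - T)) /\<^sub>R (s - t)) (Y' t) (at t within {0..})"
    using Y unfolding C1_ideal_def by blast
  have "J_deriv Y Y'"
    unfolding J_deriv_def
  proof (intro allI impI conjI)
    fix t :: real assume t: "0 \<le> t"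
    show Y'J: "Y' t \<in> J" using lim[OF t] by (simp add: limitin_metric)
    show YYJ: "Y s - Y t \<in> J" if "0 \<le> s" for s using J_diff[OF YJ[OF that] YJ[OF t]] by simp
    fix e :: real assume e: "0 < e"
    then have "\<forall>\<^sub>F s in at t within {0..}. (Y s - Y t) /\<^sub>R (s - t) \<in> J \<and>
        ideal_dist J N ((Y s - Y t) /\<^sub>R (s - t)) (Y' t) < e"
      using lim[OF t] by (simp add: limitin_metric)
    then obtain d where d: "d > 0" "\<And>s. 0 \<le> s \<Longrightarrow> s \<noteq> t \<Longrightarrow> dist s t < d \<Longrightarrow>
        ideal_dist J N ((Y s - Y t) /\<^sub>R (s - t)) (Y' t) < e"
      unfolding eventually_at by auto
    have "N (Y s - Y t - (s - t) *\<^sub>R Y' t) \<le> e * \<bar>s - t\<bar>" if s: "0 \<le> s" "\<bar>s - t\<bar> < d" for s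
    proof (cases "s = t")
      case False
      have qJ: "(Y s - Y t) /\<^sub>R (s - t) - Y' t \<in> J" by (intro J_diff J_scaleR YYJ s Y'J)
      have "N ((Y s - Y t) /\<^sub>R (s - t) - Y' t) < e"
        using d(2)[OF s(1) False] s(2) J_scaleR[OF YYJ[OF s(1)]] Y'J by (simp add: ideal_dist_def dist_real_def)
      then have "\<bar>s - t\<bar> * N ((Y s - Y t) /\<^sub>R (s - t) - Y' t) \<le> \<bar>s - t\<bar> * e"
        by (intro mult_left_mono) auto
      moreover have "(s - t) *\<^sub>R ((Y s - Y t) /\<^sub>R (s - t) - Y' t) = Y s - Y t - (s - t) *\<^sub>R Y' t"
        using False by (simp add: scaleR_diff_right)
      ultimately show ?thesis using N_scaleR[OF qJ, of "s - t"] by (simp add: mult.commute)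
    qed (simp add: N_zero)
    then show "\<exists>d>0. \<forall>s\<ge>0. \<bar>s - t\<bar> < d \<longrightarrow> N (Y s - Y t - (s - t) *\<^sub>R Y' t) \<le> e * \<bar>s - t\<bar>"
      using d(1) by blast
  qed
  then show ?thesis by blast
qed

text \<open>In the sum of the expansions at s and at t the increments of X cancel and
  \<open>(s - t) *\<^sub>R (X' s - X' t)\<close> remains.\<close>

lemma J_deriv_lipschitz_derivative:
  assumes C: "C \<ge> 0" "\<And>s t. s \<in> {0..\<tau>} \<Longrightarrow> t \<in> {0..\<tau>} \<Longrightarrow> X s - X t \<in> J \<and> X' t \<in> J \<and>
      N (X s - X t - (s - t) *\<^sub>R X' t) \<le> C * (s - t)\<^sup>2"
    and s: "s \<in> {0..\<tau>}" and t: "t \<in> {0..\<tau>}"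
  shows "N (X' s - X' t) \<le> 2 * C * \<bar>s - t\<bar>"
proof (cases "s = t")
  case False
  note st = C(2)[OF s t] and ts = C(2)[OF t s]
  have J: "X' s - X' t \<in> J" using st ts by (intro J_diff) auto
  have "(s - t) *\<^sub>R (X' s - X' t) = (X s - X t - (s - t) *\<^sub>R X' t) + (X t - X s - (t - s) *\<^sub>R X' s)"
    by (simp add: algebra_simps)
  then have "N ((s - t) *\<^sub>R (X' s - X' t)) \<le> N (X s - X t - (s - t) *\<^sub>R X' t) + N (X t - X s - (t - s) *\<^sub>R X' s)"
    using st ts by (simp only:) (intro norm_triangle J_diff[OF _ J_scaleR]; simp)
  also have "\<dots> \<le> C * (s - t)\<^sup>2 + C * (t - s)\<^sup>2" using st ts by (intro add_mono) auto
  also have "\<dots> = 2 * C * (\<bar>s - t\<bar> * \<bar>s - t\<bar>)"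
    unfolding power2_commute[of t s] by (simp add: power2_eq_square)
  also have "\<dots> = \<bar>s - t\<bar> * (2 * C * \<bar>s - t\<bar>)" by simp
  finally have "\<bar>s - t\<bar> * N (X' s - X' t) \<le> \<bar>s - t\<bar> * (2 * C * \<bar>s - t\<bar>)"
    unfolding N_scaleR[OF J] .
  then show ?thesis by (rule mult_left_le_imp_le) (use False in simp)
qed (simp add: N_zero)

lemma J_deriv_lipschitz_imp_C1:
  assumes X: "J_deriv_lipschitz X X'" and X0: "X 0 = T"
  shows "C1_ideal J N (\<lambda>t. X t - T)"
proof -
  note XD = J_deriv_lipschitz_imp_J_deriv[OF X]
  have XJ: "X s - X t \<in> J" "X' t \<in> J" if "0 \<le> s" "0 \<le> t" for s t
    using XD that unfolding J_deriv_def by blast+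
  have "limitin mtopology (\<lambda>s. ((X s - T) - (X t - T)) /\<^sub>R (s - t)) (X' t) (at t within {0..})" if t: "0 \<le> t" for t
    unfolding limitin_metric
  proof (intro conjI allI impI)
    show "X' t \<in> J" by (rule XJ[OF t t])
    fix e :: real assume e: "0 < e"
    then obtain d where d: "d > 0" "\<And>s. 0 \<le> s \<Longrightarrow> \<bar>s - t\<bar> < d \<Longrightarrow> N (X s - X t - (s - t) *\<^sub>R X' t) \<le> e / 2 * \<bar>s - t\<bar>"
      using XD t unfolding J_deriv_def by (metis half_gt_zero)
    have "(X s - X t) /\<^sub>R (s - t) \<in> J \<and> ideal_dist J N ((X s - X t) /\<^sub>R (s - t)) (X' t) < e"
      if s: "0 \<le> s" "s \<noteq> t" "dist s t < d" for s
    proof -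
      have qJ: "(X s - X t) /\<^sub>R (s - t) \<in> J" by (intro J_scaleR XJ s t)
      have rJ: "X s - X t - (s - t) *\<^sub>R X' t \<in> J"
        by (rule J_diff[OF XJ(1)[OF s(1) t] J_scaleR[OF XJ(2)[OF t t]]])
      have "(X s - X t) /\<^sub>R (s - t) - X' t = inverse (s - t) *\<^sub>R (X s - X t - (s - t) *\<^sub>R X' t)"
        using s by (simp add: scaleR_diff_right)
      then have "N ((X s - X t) /\<^sub>R (s - t) - X' t) = inverse \<bar>s - t\<bar> * N (X s - X t - (s - t) *\<^sub>R X' t)"
        using N_scaleR[OF rJ, of "inverse (s - t)"] by (simp add: abs_inverse)
      also have "\<dots> \<le> inverse \<bar>s - t\<bar> * (e / 2 * \<bar>s - t\<bar>)"
        using s by (intro mult_left_mono d(2)) (auto simp: dist_real_def)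
      also have "\<dots> < e" using s e by simp
      finally show ?thesis using qJ XJ[OF t t] by (simp add: ideal_dist_def)
    qed
    then show "\<forall>\<^sub>F s in at t within {0..}. ((X s - T) - (X t - T)) /\<^sub>R (s - t) \<in> J \<and>
        ideal_dist J N (((X s - T) - (X t - T)) /\<^sub>R (s - t)) (X' t) < e"
      unfolding eventually_at using d(1) by (intro exI[of _ d]) simp
  qed
  moreover have "continuous_map (top_of_set {0..}) mtopology X'"
    unfolding continuous_map_to_metric
  proof (intro ballI allI impI)
    fix t e :: real assume t0: "t \<in> topspace (top_of_set {0..})" and e: "0 < e"
    then have t: "0 \<le> t" by simp
    obtain C where C: "C \<ge> 0" "\<And>r s. r \<in> {0..t + 1} \<Longrightarrow> s \<in> {0..t + 1} \<Longrightarrow> X r - X s \<in> J \<and> X' s \<in> J \<and>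
        N (X r - X s - (r - s) *\<^sub>R X' s) \<le> C * (r - s)\<^sup>2"
      using X t unfolding J_deriv_lipschitz_def by (metis add_nonneg_nonneg zero_le_one)
    define d where "d = min 1 (e / (2 * C + 1))"
    have d: "0 < d" "d \<le> 1" using e C(1) by (auto simp: d_def)
    show "\<exists>U. openin (top_of_set {0..}) U \<and> t \<in> U \<and> (\<forall>s\<in>U. X' s \<in> mball (X' t) e)"
    proof (intro exI conjI ballI)
      show "openin (top_of_set {0..}) ({0..} \<inter> ball t d)" by (rule openin_open_Int) simp
      show "t \<in> {0..} \<inter> ball t d" using t d by simp
      fix s assume "s \<in> {0..} \<inter> ball t d"
      then have s: "0 \<le> s" "\<bar>s - t\<bar> < d" by (auto simp: dist_real_def abs_minus_commute)
      then have s1: "s \<in> {0..t + 1}" using d by auto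
      have "N (X' s - X' t) \<le> 2 * C * \<bar>s - t\<bar>"
        by (rule J_deriv_lipschitz_derivative[OF C s1]) (use t in auto)
      also have "\<dots> \<le> 2 * C * (e / (2 * C + 1))" using s C(1) by (intro mult_left_mono) (auto simp: d_def)
      also have "\<dots> < e" using e C(1) by (simp add: field_simps)
      finally have "N (X' s - X' t) < e" .
      then have "N (X' t - X' s) < e" using N_diff_commute[OF J_diff[OF XJ(2)[OF t s(1)] XJ(2)[OF t t]]]
        by simp
      then show "X' s \<in> mball (X' t) e" using XJ(2)[OF t s(1)] XJ(2)[OF t t] by (simp add: ideal_dist_def)
    qed
  qed
  ultimately show ?thesis
    unfolding C1_ideal_def using XJ(1)[of _ 0] X0 by (intro conjI exI[of _ X']) auto
qed

text \<open>The schemes for different \<tau> estimate one and the same function, so no local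
  solutions have to be glued.\<close>

lemma euler_limit_J_deriv_lipschitz:
  assumes scheme: "\<And>\<tau>. 0 \<le> \<tau> \<Longrightarrow> \<exists>L D n0. euler_scheme J N F x0 \<tau> L D n0"
  shows "J_deriv_lipschitz (euler_limit F x0) (\<lambda>t. F t (euler_limit F x0 t))"
  unfolding J_deriv_lipschitz_def
proof (intro allI impI)
  fix \<tau> :: real assume "0 \<le> \<tau>"
  then obtain L D n0 where "euler_scheme J N F x0 \<tau> L D n0" using scheme by blast
  then interpret euler_scheme J N F x0 \<tau> L D n0 .
  define C where "C = max G (2 * L * (1 + G))"
  have C: "0 \<le> C" using G_nonneg by (simp add: C_def)
  have "N (X s - X t) \<le> G * \<bar>s - t\<bar>" if st: "s \<in> {0..\<tau>}" "t \<in> {0..\<tau>}" for s t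
  proof (cases "t \<le> s")
    case False
    have "N (X s - X t) = N (X t - X s)" by (intro N_diff_commute D_diff_J euler_limit_in_D st)
    then show ?thesis using euler_limit_lipschitz[OF st(2,1)] False by simp
  qed (use euler_limit_lipschitz[OF st] in simp)
  moreover have "G * \<bar>s - t\<bar> \<le> C * \<bar>s - t\<bar>" for s t by (intro mult_right_mono) (auto simp: C_def)
  moreover have "2 * L * (1 + G) * (s - t)\<^sup>2 \<le> C * (s - t)\<^sup>2" for s t
    by (intro mult_right_mono) (auto simp: C_def)
  ultimately show "\<exists>C\<ge>0. \<forall>s\<in>{0..\<tau>}. \<forall>t\<in>{0..\<tau>}. X s - X t \<in> J \<and> F t (X t) \<in> J \<and>
      N (X s - X t) \<le> C * \<bar>s - t\<bar> \<and> N (X s - X t - (s - t) *\<^sub>R F t (X t)) \<le> C * (s - t)\<^sup>2"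
    using C euler_limit_quadratic D_diff_J F_J euler_limit_in_D by (meson order_trans)
qed

end

lemma has_vector_derivative_imp_J_deriv:
  fixes X :: "real \<Rightarrow> 'h::separable_infinite_dim_chilbert_space bop"
  assumes "\<And>t. 0 \<le> t \<Longrightarrow> (X has_vector_derivative X' t) (at t within {0..})"
  shows "operator_ideal.J_deriv UNIV norm X X'"
proof -
  interpret operator_ideal "UNIV :: 'h bop set" norm by (rule operator_ideal_UNIV)
  show ?thesis
    unfolding J_deriv_def
  proof (intro allI impI conjI)
    fix t e :: real assume "0 \<le> t" "0 < e"
    then obtain d where "d > 0" "\<forall>s\<in>{0..}. norm (s - t) < d \<longrightarrow>
        norm (X s - X t - (s - t) *\<^sub>R X' t) \<le> e * norm (s - t)"
      using assms[of t] unfolding has_vector_derivative_def has_derivative_within_alt by blast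
    then show "\<exists>d>0. \<forall>s\<ge>0. \<bar>s - t\<bar> < d \<longrightarrow> norm (X s - X t - (s - t) *\<^sub>R X' t) \<le> e * \<bar>s - t\<bar>"
      by (intro exI[of _ d]) auto
  qed auto
qed

section \<open>Linear equations\<close>

context operator_ideal
begin

text \<open>The scheme started at 1 stays in 1 + J because every increment A(t) x lies in J. The
  field is Lipschitz in N on operators of bounded norm.\<close>

lemma linear_ode_solution:
  fixes A :: "real \<Rightarrow> 'h bop"
  assumes AJ: "\<And>t. 0 \<le> t \<Longrightarrow> A t \<in> J" and K: "\<And>t. 0 \<le> t \<Longrightarrow> norm (A t) \<le> K"
    and lip: "\<And>\<tau>. 0 \<le> \<tau> \<Longrightarrow> \<exists>L\<ge>0. \<forall>s\<in>{0..\<tau>}. \<forall>t\<in>{0..\<tau>}. N (A s - A t) \<le> L * \<bar>s - t\<bar>"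
  shows "\<exists>g. g 0 = 1 \<and> (\<forall>t\<ge>0. g t - 1 \<in> J) \<and>
    (\<forall>t\<ge>0. (g has_vector_derivative A t * g t) (at t within {0..}))"
proof -
  let ?F = "\<lambda>t x. A t * x"
  have K0: "0 \<le> K" using K[of 0] norm_ge_zero order_trans by blast
  have scheme: "\<exists>L D n0. euler_scheme J N ?F 1 \<tau> L D n0" if \<tau>: "0 \<le> \<tau>" for \<tau>
  proof -
    obtain L where L: "L \<ge> 0" "\<And>s t. s \<in> {0..\<tau>} \<Longrightarrow> t \<in> {0..\<tau>} \<Longrightarrow> N (A s - A t) \<le> L * \<bar>s - t\<bar>"
      using lip[OF \<tau>] by blast
    define R where "R = exp (K * \<tau>)"
    \<comment> \<open>The norm bound controls \<open>(A s - A t) * x\<close>; the polygons satisfy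
      it since \<open>(1 + h K)^k\<close> is at most \<open>exp (K * \<tau>)\<close>.\<close>
    define D where "D = {x. x - 1 \<in> J \<and> norm x \<le> R}"
    have R: "0 \<le> R" by (simp add: R_def)
    have "euler_scheme J N ?F 1 \<tau> (L * R + K) D 0"
    proof unfold_locales
      show "0 \<le> \<tau>" by (rule \<tau>)
      show "0 \<le> L * R + K" using L(1) R K0 by simp
    next
      fix n k assume k: "real k * (1 / 2) ^ n \<le> \<tau>"
      let ?h = "(1 / 2) ^ n :: real"
      have inJ: "euler ?F 1 ?h k - 1 \<in> J" for k
      proof (induction k)
        case (Suc k)
        have "(euler ?F 1 ?h k - 1) + ?h *\<^sub>R (A (real k * ?h) * euler ?F 1 ?h k) \<in> J"
          by (intro J_add Suc J_scaleR J_mult_right AJ) simp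
        then show ?case by (simp add: algebra_simps)
      qed (simp add: J_zero)
      have "norm (euler ?F 1 ?h k) \<le> (1 + ?h * K) ^ k" for k
      proof (induction k)
        case (Suc k)
        have "norm (?h *\<^sub>R (A (real k * ?h) * euler ?F 1 ?h k)) \<le> ?h * (K * norm (euler ?F 1 ?h k))"
          using norm_mult_mono[OF K order_refl, of "real k * ?h" "euler ?F 1 ?h k"]
          unfolding norm_scaleR by (intro mult_mono) simp_all
        then have "norm (euler ?F 1 ?h (Suc k)) \<le> norm (euler ?F 1 ?h k) + ?h * (K * norm (euler ?F 1 ?h k))"
          unfolding euler.simps by (rule order_trans[OF norm_triangle_ineq add_left_mono])
        also have "\<dots> = (1 + ?h * K) * norm (euler ?F 1 ?h k)" by (simp add: algebra_simps)
        also have "\<dots> \<le> (1 + ?h * K) * (1 + ?h * K) ^ k" using K0 by (intro mult_left_mono Suc) auto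
        finally show ?case by simp
      qed simp
      also have "(1 + ?h * K) ^ k \<le> exp (?h * K) ^ k"
        using K0 by (intro power_mono) (auto simp: exp_ge_add_one_self intro!: add_nonneg_nonneg)
      also have "\<dots> = exp (K * (real k * ?h))" by (simp add: mult_ac flip: exp_of_nat_mult)
      also have "\<dots> \<le> R" unfolding R_def using k K0 by (simp add: mult_left_mono)
      finally show "euler ?F 1 ?h k \<in> D" using inJ by (simp add: D_def)
    next
      show "x - 1 \<in> J" if "x \<in> D" for x using that by (simp add: D_def)
    next
      fix x l assume x: "\<And>n. x n \<in> D" and l: "l - 1 \<in> J" and lim: "(\<lambda>n. N (x n - l)) \<longlonglongrightarrow> 0"
      have "norm (x n - l) \<le> N (x n - l)" for n
        using J_diff[of "x n - 1" "l - 1"] x[of n] l by (intro norm_le_N) (simp add: D_def)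
      then have "(\<lambda>n. x n - l) \<longlonglongrightarrow> 0"
        by (intro Lim_null_comparison[OF _ lim] always_eventually allI)
      then have "x \<longlonglongrightarrow> l" by (simp add: LIM_zero_iff)
      from tendsto_upperbound[OF tendsto_norm[OF this]] have "norm l \<le> R" using x by (simp add: D_def)
      then show "l \<in> D" using l by (simp add: D_def)
    next
      show "A t * x \<in> J" if "t \<in> {0..\<tau>}" for t x using that by (intro J_mult_right AJ) simp
    next
      fix s t x y assume st: "s \<in> {0..\<tau>}" "t \<in> {0..\<tau>}" and xy: "x \<in> D" "y \<in> D"
      have AstJ: "A s - A t \<in> J" using st by (intro J_diff AJ) auto
      have xyJ: "x - y \<in> J" using J_diff[of "x - 1" "y - 1"] xy by (simp add: D_def)
      have "A s * x - A t * y = (A s - A t) * x + A t * (x - y)" by (simp add: algebra_simps)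
      then have "N (A s * x - A t * y) \<le> N ((A s - A t) * x) + N (A t * (x - y))"
        by (simp only:) (intro norm_triangle J_mult_right AstJ J_mult_left xyJ)
      also have "N ((A s - A t) * x) \<le> (L * \<bar>s - t\<bar>) * R"
        using xy norm_nonneg[OF AstJ] L st
        by (intro order_trans[OF N_mult_right[OF AstJ]] mult_mono) (auto simp: D_def)
      also have "N (A t * (x - y)) \<le> K * N (x - y)"
        using st norm_nonneg[OF xyJ] K by (intro order_trans[OF N_mult_left[OF xyJ]] mult_right_mono) auto
      also have "L * \<bar>s - t\<bar> * R + K * N (x - y) \<le> (L * R + K) * (\<bar>s - t\<bar> + N (x - y))"
      proof -
        have "0 \<le> K * \<bar>s - t\<bar>" "0 \<le> L * R * N (x - y)" using K0 L(1) R norm_nonneg[OF xyJ] by auto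
        then show ?thesis by (simp add: algebra_simps)
      qed
      finally show "N (A s * x - A t * y) \<le> (L * R + K) * (\<bar>s - t\<bar> + N (x - y))" by simp
    qed
    then show ?thesis by blast
  qed
  define g where "g = euler_limit ?F 1"
  have gd: "J_deriv g (\<lambda>t. A t * g t)"
    unfolding g_def by (intro J_deriv_lipschitz_imp_J_deriv euler_limit_J_deriv_lipschitz scheme)
  have g0: "g 0 = 1"
    unfolding g_def euler_limit_def by (simp add: dyadic_index_0)
  have "g t - 1 \<in> J" if "0 \<le> t" for t
    using gd that g0 unfolding J_deriv_def by (metis order_refl)
  then show ?thesis using g0 J_deriv_imp_has_vector_derivative[OF gd] by blast
qed

end

text \<open>Conjugation by the fundamental solution \<open>g' = A g\<close>; its inverse \<open>w\<close> solves \<open>w' = - w A\<close>.\<close>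

lemma lax_pair_conjugation:
  fixes A X :: "real \<Rightarrow> 'h::separable_infinite_dim_chilbert_space bop"
  assumes X: "\<And>t. 0 \<le> t \<Longrightarrow> (X has_vector_derivative A t * X t - X t * A t) (at t within {0..})"
    and sa: "\<And>t. 0 \<le> t \<Longrightarrow> selfadjoint (A t)" and K: "\<And>t. 0 \<le> t \<Longrightarrow> norm (A t) \<le> K"
    and lip: "\<And>\<tau>. 0 \<le> \<tau> \<Longrightarrow> \<exists>L\<ge>0. \<forall>s\<in>{0..\<tau>}. \<forall>t\<in>{0..\<tau>}. norm (A s - A t) \<le> L * \<bar>s - t\<bar>"
    and g0: "g 0 = 1"
    and g: "\<And>t. 0 \<le> t \<Longrightarrow> (g has_vector_derivative A t * g t) (at t within {0..})"
    and t: "0 \<le> t"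
  shows "invertible_bop (g t) \<and> X t = g t * X 0 * inverse_bop (g t)"
proof -
  interpret U: operator_ideal "UNIV :: 'h bop set" norm by (rule operator_ideal_UNIV)
  obtain v where v0: "v 0 = 1"
    and v: "\<And>t. 0 \<le> t \<Longrightarrow> (v has_vector_derivative - A t * v t) (at t within {0..})"
  proof -
    have "\<exists>g. g 0 = 1 \<and> (\<forall>t\<ge>0. g t - 1 \<in> UNIV) \<and>
        (\<forall>t\<ge>0. (g has_vector_derivative - A t * g t) (at t within {0..}))"
    proof (rule U.linear_ode_solution)
      show "\<exists>L\<ge>0. \<forall>s\<in>{0..\<tau>}. \<forall>t\<in>{0..\<tau>}. norm (- A s - - A t) \<le> L * \<bar>s - t\<bar>" if "0 \<le> \<tau>" for \<tau>
        using lip[OF that] by (simp add: norm_minus_commute)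
    qed (use K in auto)
    then show thesis using that by blast
  qed
  \<comment> \<open>Self-adjointness of A turns v' = - A v into w' = - w A.\<close>
  define w where "w t = adj (v t)" for t
  have w0: "w 0 = 1" by (simp add: w_def v0)
  have w: "(w has_vector_derivative - (w t * A t)) (at t within {0..})" if t: "0 \<le> t" for t
    using bounded_linear.has_vector_derivative[OF bounded_linear_adj v[OF t]] sa[OF t]
    by (simp add: w_def[abs_def] adj_mult adj_minus selfadjoint_def)
  have const: "f t = f 0" if f: "\<And>t. 0 \<le> t \<Longrightarrow> (f has_vector_derivative 0) (at t within {0..})" for f :: "real \<Rightarrow> 'h bop"
  proof -
    obtain c where "\<And>x. x \<in> {0..} \<Longrightarrow> f x = c"
      using has_vector_derivative_zero_constant[OF convex_real_interval(1), of 0 f] f by auto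
    then show ?thesis using t by simp
  qed
  have wg: "w t * g t = 1"
  proof -
    have "((\<lambda>t. w t * g t) has_vector_derivative 0) (at t within {0..})" if t: "0 \<le> t" for t
      using has_vector_derivative_mult[OF w[OF t] g[OF t]] by (simp add: mult.assoc)
    from const[OF this] show ?thesis by (simp add: w0 g0)
  qed
  \<comment> \<open>In infinite dimension a left inverse need not be a right inverse, and the
    derivative of g w is the commutator of A with g w, not visibly 0. But g w - 1 solves this linear
    equation with initial value 0.\<close>
  have gw: "g t * w t = 1"
  proof -
    let ?e = "\<lambda>t. g t * w t - 1"
    have "U.J_deriv ?e (\<lambda>t. A t * ?e t - ?e t * A t)"
    proof (rule has_vector_derivative_imp_J_deriv)
      fix t :: real assume t: "0 \<le> t"
      show "(?e has_vector_derivative A t * ?e t - ?e t * A t) (at t within {0..})"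
        using has_vector_derivative_diff[OF has_vector_derivative_mult[OF g[OF t] w[OF t]]
            has_vector_derivative_const[of 1]]
        by (simp add: algebra_simps)
    qed
    then have "?e t = 0"
    proof (rule U.J_deriv_zero_unique)
      show "norm (A t * ?e t - ?e t * A t) \<le> (2 * K) * norm (?e t)" if "0 \<le> t" for t
      proof -
        have "norm (A t * ?e t - ?e t * A t) \<le> norm (A t * ?e t) + norm (?e t * A t)"
          by (rule norm_triangle_ineq4)
        also have "\<dots> \<le> K * norm (?e t) + norm (?e t) * K"
          by (intro add_mono norm_mult_mono K that order_refl)
        finally show ?thesis by simp
      qed
      show "0 \<le> 2 * K" using K[of 0] norm_ge_zero[of "A 0"] by linarith
    qed (use g0 w0 t in auto)
    then show ?thesis by simp
  qed
  have wXg: "w t * X t * g t = X 0"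
  proof -
    have "((\<lambda>t. w t * X t * g t) has_vector_derivative 0) (at t within {0..})" if t: "0 \<le> t" for t
      using has_vector_derivative_mult[OF has_vector_derivative_mult[OF w[OF t] X[OF t]] g[OF t]]
      by (simp add: algebra_simps)
    from const[OF this] show ?thesis by (simp add: w0 g0)
  qed
  have inv: "inverse_bop (g t) = w t" by (rule inverse_bop_eqI[OF gw wg])
  have "g t * X 0 * w t = (g t * w t) * X t * (g t * w t)" by (simp add: mult.assoc flip: wXg)
  then show ?thesis using gw wg by (auto simp: inv invertible_bop_def)
qed


section \<open>The flow\<close>

lemma norm_between_limit:
  assumes "\<And>n. norm_between m M (x n)" "x \<longlonglongrightarrow> l"
  shows "norm_between m M l"
  unfolding norm_between_def
proof (intro allI conjI)
  fix v
  have "(\<lambda>n. norm (bop_apply (x n) v)) \<longlonglongrightarrow> norm (bop_apply l v)"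
    by (intro tendsto_norm bop_apply.tendsto assms(2) tendsto_const)
  then show "m * norm v \<le> norm (bop_apply l v)" "norm (bop_apply l v) \<le> M * norm v"
    using assms(1) unfolding norm_between_def
    by (auto intro: tendsto_lowerbound tendsto_upperbound)
qed

text \<open>m and M are bounds for the moduli of T at a positive distance from the end points; for a
  = 0 the lower bound is 0 itself.\<close>

locale ideal_flow = operator_ideal J N + monotone_pair a b \<phi>1 \<phi>2
  for J :: "'h::separable_infinite_dim_chilbert_space bop set" and N :: "'h bop \<Rightarrow> real"
    and a b :: real and \<phi>1 \<phi>2 :: "real \<Rightarrow> real" +
  fixes T :: "'h bop" and m M :: real
  assumes mod_lip1: "modulus_lipschitz a b \<phi>1" and mod_lip2: "modulus_lipschitz a b \<phi>2"
    and scalar_lip1: "\<exists>L\<ge>0. \<forall>x\<in>{a..b}. \<forall>y\<in>{a..b}. \<bar>\<phi>1 x - \<phi>1 y\<bar> \<le> L * \<bar>x - y\<bar>"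
    and scalar_lip2: "\<exists>L\<ge>0. \<forall>x\<in>{a..b}. \<forall>y\<in>{a..b}. \<bar>\<phi>2 x - \<phi>2 y\<bar> \<le> L * \<bar>x - y\<bar>"
    and T_between: "norm_between m M T" "norm_between m M (adj T)"
    and m_a: "0 < a \<Longrightarrow> a < m" "a = 0 \<Longrightarrow> m = 0" and M_b: "M < b"
    and T_J: "flow_field \<phi>1 \<phi>2 T \<in> J"
begin

abbreviation \<Phi> :: "'h bop \<Rightarrow> 'h bop" where "\<Phi> \<equiv> phi_bop \<phi>1 \<phi>2"
abbreviation F :: "'h bop \<Rightarrow> 'h bop" where "F \<equiv> flow_field \<phi>1 \<phi>2"
abbreviation mod_in :: "'h bop \<Rightarrow> bool" where "mod_in X \<equiv> moduli_spectra_in X {a..b}"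

lemma a_le_m: "a \<le> m"
  using m_a a_nonneg by (cases "a = 0") auto

lemma mod_in_iff: "mod_in X \<longleftrightarrow> norm_between a b X \<and> norm_between a b (adj X)"
  by (rule moduli_spectra_in_iff[OF a_nonneg])

lemma mod_in_T: "mod_in T"
  unfolding mod_in_iff using T_between a_le_m M_b by (auto intro: norm_between_mono)

lemma mod_in_norm: "mod_in X \<Longrightarrow> norm X \<le> b"
  by (auto simp: mod_in_iff intro: norm_between_upper)

lemma phi_bounded: "\<exists>K\<ge>0. \<forall>x\<in>{a..b}. \<bar>\<phi>1 x\<bar> \<le> K \<and> \<bar>\<phi>2 x\<bar> \<le> K"
proof -
  have "bounded (\<phi>1 ` {a..b})" "bounded (\<phi>2 ` {a..b})"
    using cont1 cont2 by (auto intro!: compact_imp_bounded compact_continuous_image)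
  then obtain K1 K2 where "\<forall>x\<in>{a..b}. \<bar>\<phi>1 x\<bar> \<le> K1" "\<forall>x\<in>{a..b}. \<bar>\<phi>2 x\<bar> \<le> K2"
    by (auto simp: bounded_iff)
  then show ?thesis
    by (intro exI[of _ "max 0 (max K1 K2)"]) (auto simp: le_max_iff_disj)
qed

lemma Phi_bounded: "\<exists>K\<ge>0. \<forall>X. mod_in X \<longrightarrow> norm (\<Phi> X) \<le> K"
proof -
  obtain K where K: "K \<ge> 0" "\<And>x. x \<in> {a..b} \<Longrightarrow> \<bar>\<phi>1 x\<bar> \<le> K \<and> \<bar>\<phi>2 x\<bar> \<le> K" using phi_bounded by blast
  have "norm (\<Phi> X) \<le> 2 * K" if X: "mod_in X" for X
  proof -
    interpret A: functional_calculus "abs_bop X" a b by standard (rule moduli_within[OF X])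
    interpret B: functional_calculus "abs_bop (adj X)" a b by standard (rule moduli_within[OF X])
    have "norm (\<Phi> X) \<le> norm (cfc \<phi>1 (abs_bop X)) + norm (cfc \<phi>2 (abs_bop (adj X)))"
      unfolding phi_bop_def by (rule norm_triangle_ineq4)
    also have "\<dots> \<le> K + K"
      using K(2) by (intro add_mono A.norm_cfc_le B.norm_cfc_le cont1 cont2) auto
    finally show ?thesis by simp
  qed
  then show ?thesis using K(1) by (intro exI[of _ "2 * K"]) auto
qed

lemma Phi_lipschitz:
  "\<exists>C\<ge>0. \<forall>X Y. mod_in X \<longrightarrow> mod_in Y \<longrightarrow> X - Y \<in> J \<longrightarrow> \<Phi> X - \<Phi> Y \<in> J \<and> N (\<Phi> X - \<Phi> Y) \<le> C * N (X - Y)"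
proof -
  obtain C1 where C1: "C1 \<ge> 0" "\<And>X Y. mod_in X \<Longrightarrow> mod_in Y \<Longrightarrow> X - Y \<in> J \<Longrightarrow>
      cfc \<phi>1 (abs_bop X) - cfc \<phi>1 (abs_bop Y) \<in> J \<and>
      N (cfc \<phi>1 (abs_bop X) - cfc \<phi>1 (abs_bop Y)) \<le> C1 * N (X - Y)"
    using mod_lip1 unfolding modulus_lipschitz_def by blast
  obtain C2 where C2: "C2 \<ge> 0" "\<And>X Y. mod_in X \<Longrightarrow> mod_in Y \<Longrightarrow> X - Y \<in> J \<Longrightarrow>
      cfc \<phi>2 (abs_bop X) - cfc \<phi>2 (abs_bop Y) \<in> J \<and>
      N (cfc \<phi>2 (abs_bop X) - cfc \<phi>2 (abs_bop Y)) \<le> C2 * N (X - Y)"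
    using mod_lip2 unfolding modulus_lipschitz_def by blast
  have "\<Phi> X - \<Phi> Y \<in> J \<and> N (\<Phi> X - \<Phi> Y) \<le> (C1 + C2) * N (X - Y)"
    if X: "mod_in X" and Y: "mod_in Y" and XY: "X - Y \<in> J" for X Y
  proof -
    note 1 = C1(2)[OF X Y XY]
    have 2: "cfc \<phi>2 (abs_bop (adj X)) - cfc \<phi>2 (abs_bop (adj Y)) \<in> J"
      "N (cfc \<phi>2 (abs_bop (adj X)) - cfc \<phi>2 (abs_bop (adj Y))) \<le> C2 * N (X - Y)"
      using C2(2)[of "adj X" "adj Y"] X Y adj_diff_in_J[OF XY] N_adj_diff[OF XY]
      by (simp_all add: moduli_spectra_in_adj)
    have eq: "\<Phi> X - \<Phi> Y = (cfc \<phi>1 (abs_bop X) - cfc \<phi>1 (abs_bop Y)) -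
        (cfc \<phi>2 (abs_bop (adj X)) - cfc \<phi>2 (abs_bop (adj Y)))"
      by (simp add: phi_bop_def)
    have "\<Phi> X - \<Phi> Y \<in> J" unfolding eq by (rule J_diff) (use 1 2 in auto)
    moreover have "N (\<Phi> X - \<Phi> Y) \<le> C1 * N (X - Y) + C2 * N (X - Y)"
      unfolding eq by (rule order_trans[OF N_diff_le add_mono]) (use 1 2 in auto)
    ultimately show ?thesis by (simp add: distrib_right)
  qed
  then show ?thesis using C1(1) C2(1) by (intro exI[of _ "C1 + C2"]) auto
qed

lemma F_lipschitz:
  "\<exists>L\<ge>0. \<forall>X Y. mod_in X \<longrightarrow> mod_in Y \<longrightarrow> X - Y \<in> J \<longrightarrow> F X - F Y \<in> J \<and> N (F X - F Y) \<le> L * N (X - Y)"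
proof -
  obtain C where C: "C \<ge> 0" "\<And>X Y. mod_in X \<Longrightarrow> mod_in Y \<Longrightarrow> X - Y \<in> J \<Longrightarrow>
      \<Phi> X - \<Phi> Y \<in> J \<and> N (\<Phi> X - \<Phi> Y) \<le> C * N (X - Y)"
    using Phi_lipschitz by blast
  obtain K where K: "K \<ge> 0" "\<And>X. mod_in X \<Longrightarrow> norm (\<Phi> X) \<le> K" using Phi_bounded by blast
  have b: "0 \<le> b" using a_nonneg a_le_b by linarith
  have comm: "commutator P Q \<in> J \<and> N (commutator P Q) \<le> 2 * (N P * norm Q)" if P: "P \<in> J" for P Q
  proof -
    have "N (commutator P Q) \<le> N (P * Q) + N (Q * P)"
      unfolding commutator_def by (intro N_diff_le J_mult_left J_mult_right P)
    then show ?thesis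
      using N_mult_left[OF P, of Q] N_mult_right[OF P, of Q] J_diff[OF J_mult_right[OF P] J_mult_left[OF P]]
      by (simp add: commutator_def mult.commute)
  qed
  have "F X - F Y \<in> J \<and> N (F X - F Y) \<le> (2 * C * b + 2 * K) * N (X - Y)"
    if X: "mod_in X" and Y: "mod_in Y" and XY: "X - Y \<in> J" for X Y
  proof -
    note 1 = C(2)[OF X Y XY]
    \<comment> \<open>In each commutator one entry lies in J and the other is bounded in the
      operator norm.\<close>
    have eq: "F X - F Y = commutator (\<Phi> X - \<Phi> Y) X - commutator (X - Y) (\<Phi> Y)"
      by (simp add: flow_field_def commutator_def algebra_simps)
    note cP = comm[OF conjunct1[OF 1], of X] and cX = comm[OF XY, of "\<Phi> Y"]
    have "N (F X - F Y) \<le> 2 * (N (\<Phi> X - \<Phi> Y) * norm X) + 2 * (N (X - Y) * norm (\<Phi> Y))"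
      unfolding eq using cP cX by (intro order_trans[OF N_diff_le] add_mono) auto
    also have "\<dots> \<le> 2 * ((C * N (X - Y)) * b) + 2 * (N (X - Y) * K)"
      using 1 C(1) mod_in_norm[OF X] K(2)[OF Y] norm_nonneg[OF XY]
      by (intro add_mono mult_left_mono mult_mono mult_nonneg_nonneg) auto
    finally have "N (F X - F Y) \<le> (2 * C * b + 2 * K) * N (X - Y)" by (simp add: algebra_simps)
    moreover have "F X - F Y \<in> J" unfolding eq using cP cX by (intro J_diff) auto
    ultimately show ?thesis by simp
  qed
  moreover have "0 \<le> 2 * C * b + 2 * K" using C(1) K(1) b by simp
  ultimately show ?thesis by blast
qed

lemma F_in_J: "mod_in X \<Longrightarrow> X - T \<in> J \<Longrightarrow> F X \<in> J"
  using F_lipschitz mod_in_T J_add[OF _ T_J, of "F X - F T"] by auto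

text \<open>Supplies the constant \<open>L\<close> of \<open>euler_step_norm_between\<close>, which
  makes the middle factor monotone for small steps.\<close>

lemma product_lipschitz: "\<exists>L\<ge>0. \<forall>x\<in>{a..b}. \<forall>y\<in>{a..b}. \<bar>x * \<psi> x - y * \<psi> y\<bar> \<le> L * \<bar>x - y\<bar>"
proof -
  obtain L1 where L1: "L1 \<ge> 0" "\<And>x y. x \<in> {a..b} \<Longrightarrow> y \<in> {a..b} \<Longrightarrow> \<bar>\<phi>1 x - \<phi>1 y\<bar> \<le> L1 * \<bar>x - y\<bar>"
    using scalar_lip1 by blast
  obtain L2 where L2: "L2 \<ge> 0" "\<And>x y. x \<in> {a..b} \<Longrightarrow> y \<in> {a..b} \<Longrightarrow> \<bar>\<phi>2 x - \<phi>2 y\<bar> \<le> L2 * \<bar>x - y\<bar>"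
    using scalar_lip2 by blast
  obtain K where K: "K \<ge> 0" "\<And>x. x \<in> {a..b} \<Longrightarrow> \<bar>\<phi>1 x\<bar> \<le> K \<and> \<bar>\<phi>2 x\<bar> \<le> K" using phi_bounded by blast
  have b: "0 \<le> b" using a_nonneg a_le_b by linarith
  have "\<bar>x * \<psi> x - y * \<psi> y\<bar> \<le> (b * (L1 + L2) + 2 * K) * \<bar>x - y\<bar>" if x: "x \<in> {a..b}" and y: "y \<in> {a..b}" for x y
  proof -
    have eq: "x * \<psi> x - y * \<psi> y = x * (\<psi> x - \<psi> y) + (x - y) * \<psi> y" by (simp add: algebra_simps)
    have "\<bar>\<psi> x - \<psi> y\<bar> \<le> L1 * \<bar>x - y\<bar> + L2 * \<bar>x - y\<bar>" using L1(2)[OF x y] L2(2)[OF x y] by linarith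
    moreover have "\<bar>x\<bar> \<le> b" using x a_nonneg by auto
    ultimately have "\<bar>x * (\<psi> x - \<psi> y)\<bar> \<le> b * (L1 * \<bar>x - y\<bar> + L2 * \<bar>x - y\<bar>)"
      unfolding abs_mult using b by (intro mult_mono) auto
    moreover have "\<bar>\<psi> y\<bar> \<le> 2 * K" using K(2)[OF y] by linarith
    then have "\<bar>(x - y) * \<psi> y\<bar> \<le> \<bar>x - y\<bar> * (2 * K)"
      unfolding abs_mult by (intro mult_left_mono) auto
    ultimately have "\<bar>x * \<psi> x - y * \<psi> y\<bar> \<le> b * (L1 * \<bar>x - y\<bar> + L2 * \<bar>x - y\<bar>) + \<bar>x - y\<bar> * (2 * K)"
      unfolding eq by (intro order_trans[OF abs_triangle_ineq] add_mono)
    then show ?thesis by (simp add: algebra_simps)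
  qed
  moreover have "0 \<le> b * (L1 + L2) + 2 * K" using b L1(1) L2(1) K(1) by simp
  ultimately show ?thesis by blast
qed

text \<open>Each step widens the bounds by C h^2, and there are at most \<tau> / h of them, so the
  total C h \<tau> stays below \<open>gap\<close> for fine meshes.\<close>

lemma euler_scheme_flow:
  assumes \<tau>: "0 \<le> \<tau>"
  shows "\<exists>L n0. euler_scheme J N (\<lambda>t. F) T \<tau> L {X. X - T \<in> J \<and> mod_in X} n0"
proof -
  obtain L where L: "L \<ge> 0" "\<And>X Y. mod_in X \<Longrightarrow> mod_in Y \<Longrightarrow> X - Y \<in> J \<Longrightarrow> F X - F Y \<in> J \<and> N (F X - F Y) \<le> L * N (X - Y)"
    using F_lipschitz by blast
  obtain K where K: "K \<ge> 0" "\<And>x. x \<in> {a..b} \<Longrightarrow> \<bar>\<phi>1 x\<bar> \<le> K \<and> \<bar>\<phi>2 x\<bar> \<le> K" using phi_bounded by blast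
  obtain P where P: "P \<ge> 0" "\<And>x y. x \<in> {a..b} \<Longrightarrow> y \<in> {a..b} \<Longrightarrow> \<bar>x * \<psi> x - y * \<psi> y\<bar> \<le> P * \<bar>x - y\<bar>"
    using product_lipschitz by blast
  have b: "0 \<le> b" using a_nonneg a_le_b by linarith
  define C where "C = 2 * b * (5 * K\<^sup>2 + 2 * K ^ 3)"
  have C: "0 \<le> C" using b K(1) by (simp add: C_def)
  define gap where "gap = (if a = 0 then b - M else min (m - a) (b - M))"
  have gap: "0 < gap" "M + gap \<le> b" "a \<noteq> 0 \<Longrightarrow> a \<le> m - gap"
    using M_b m_a(1) a_nonneg by (auto simp: gap_def)
  \<comment> \<open>One threshold collects all smallness conditions on the step.\<close>
  have "(\<lambda>n. (1 / 2) ^ n * (2 * K + P + C * \<tau> + 1)) \<longlonglongrightarrow> (0::real)"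
    by (intro tendsto_mult_left_zero LIMSEQ_realpow_zero) auto
  then have "\<forall>\<^sub>F n in sequentially. (1 / 2) ^ n * (2 * K + P + C * \<tau> + 1) < min 1 gap"
    using gap(1) by (intro order_tendstoD(2)) auto
  then obtain n0 where n0: "\<And>n. n0 \<le> n \<Longrightarrow> (1 / 2) ^ n * (2 * K + P + C * \<tau> + 1) < min 1 gap"
    by (auto simp: eventually_sequentially)
  have "euler_scheme J N (\<lambda>t. F) T \<tau> L {X. X - T \<in> J \<and> mod_in X} n0"
  proof unfold_locales
    show "0 \<le> \<tau>" "0 \<le> L" by (rule \<tau>, rule L(1))
  next
    fix n k assume n: "n0 \<le> n" and k: "real k * (1 / 2) ^ n \<le> \<tau>"
    define h :: real where "h = (1 / 2) ^ n"
    have h: "0 \<le> h" "h \<le> 1" by (simp_all add: h_def power_le_one)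
    have split: "h * (2 * K + P + C * \<tau> + 1) = 2 * h * K + h * P + h * C * \<tau> + h"
      by (simp add: algebra_simps)
    have nn: "0 \<le> 2 * h * K" "0 \<le> h * P" "0 \<le> h * C * \<tau>"
      using h K(1) P(1) C \<tau> by simp_all
    have small: "2 * h * K \<le> 1" "h * P \<le> 1" "h * C * \<tau> \<le> gap"
      using n0[OF n] nn h unfolding h_def[symmetric] split by linarith+
    let ?E = "\<lambda>k. euler (\<lambda>t. F) T h k"
    \<comment> \<open>For a = 0 the lower bound is left at m = 0, since norms cannot fall below
      it.\<close>
    let ?l = "\<lambda>k::nat. m - (if a = 0 then 0 else real k * (C * h\<^sup>2))" and ?u = "\<lambda>k::nat. M + real k * (C * h\<^sup>2)"
    have error: "real k * (C * h\<^sup>2) \<le> gap" if "real k * h \<le> \<tau>" for k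
    proof -
      have "real k * (C * h\<^sup>2) = (h * C) * (real k * h)" by (simp add: power2_eq_square)
      also have "\<dots> \<le> (h * C) * \<tau>" using that h C by (intro mult_left_mono) auto
      finally show ?thesis using small(3) by linarith
    qed
    have in_ab: "a \<le> ?l k" "?u k \<le> b" if "real k * h \<le> \<tau>" for k
      using error[OF that] gap m_a by auto
    have *: "?E k - T \<in> J \<and> norm_between (?l k) (?u k) (?E k) \<and> norm_between (?l k) (?u k) (adj (?E k))"
      if "real k * h \<le> \<tau>" for k
      using that
    proof (induction k)
      case (Suc k)
      have kh: "real k * h \<le> \<tau>" using Suc.prems h(1) by (simp add: algebra_simps)
      note IH = Suc.IH[OF kh] and ab = in_ab[OF kh]
      have E: "mod_in (?E k)"
        unfolding mod_in_iff using IH ab by (auto intro: norm_between_mono)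
      have EJ: "?E (Suc k) - T \<in> J"
      proof -
        have "(?E k - T) + h *\<^sub>R F (?E k) \<in> J" using IH by (intro J_add J_scaleR F_in_J E) auto
        then show ?thesis by (simp add: algebra_simps)
      qed
      have step1: "norm_between (?l k - C * h\<^sup>2) (?u k + C * h\<^sup>2) (?E k + h *\<^sub>R F (?E k))"
        unfolding C_def
        by (rule euler_step_norm_between) (use IH ab K(2) P(2) h small in \<open>auto simp: C_def\<close>)
      \<comment> \<open>The adjoint is stepped by the swapped pair, and
        \<open>flow_field_adj\<close> identifies the outcome with the adjoint of the step.\<close>
      interpret sw: monotone_pair a b \<phi>2 \<phi>1 by (rule swap)
      have step2: "norm_between (?l k - C * h\<^sup>2) (?u k + C * h\<^sup>2)
          (adj (?E k) + h *\<^sub>R flow_field \<phi>2 \<phi>1 (adj (?E k)))"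
        unfolding C_def
        by (rule sw.euler_step_norm_between)
          (use IH ab K(2) P(2) h small in \<open>auto simp: C_def add.commute\<close>)
      then have step2': "norm_between (?l k - C * h\<^sup>2) (?u k + C * h\<^sup>2) (adj (?E (Suc k)))"
        by (simp add: flow_field_adj[OF E] adj_add adj_scaleR)
      have weaken: "norm_between (?l (Suc k)) (?u (Suc k)) Z"
        if Z: "norm_between (?l k - C * h\<^sup>2) (?u k + C * h\<^sup>2) Z" for Z :: "'h bop"
      proof (cases "a = 0")
        case True
        have "norm_between 0 (?u k + C * h\<^sup>2) Z"
          using Z unfolding norm_between_def by simp
        then show ?thesis using True m_a(2) by (simp add: algebra_simps)
      next
        case False
        then show ?thesis using Z by (simp add: algebra_simps)
      qed
      show ?case using EJ weaken[OF step1] weaken[OF step2'] by simp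
    qed (use T_between in \<open>simp add: J_zero\<close>)
    have "?E k - T \<in> J \<and> mod_in (?E k)"
      unfolding mod_in_iff using *[of k] in_ab[of k] k
      by (auto simp: h_def intro: norm_between_mono)
    then show "euler (\<lambda>t. F) T ((1 / 2) ^ n) k \<in> {X. X - T \<in> J \<and> mod_in X}" by (simp add: h_def)
  next
    show "X - T \<in> J" if "X \<in> {X. X - T \<in> J \<and> mod_in X}" for X using that by simp
  next
    fix x l assume x: "\<And>n. x n \<in> {X. X - T \<in> J \<and> mod_in X}" and l: "l - T \<in> J"
      and lim: "(\<lambda>n. N (x n - l)) \<longlonglongrightarrow> 0"
    have "norm (x n - l) \<le> N (x n - l)" for n
      using J_diff[of "x n - T" "l - T"] x[of n] l by (intro norm_le_N) simp
    then have "(\<lambda>n. x n - l) \<longlonglongrightarrow> 0"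
      by (intro Lim_null_comparison[OF _ lim] always_eventually allI)
    then have xl: "x \<longlonglongrightarrow> l" by (simp add: LIM_zero_iff)
    then have adj_l: "(\<lambda>n. adj (x n)) \<longlonglongrightarrow> adj l" by (rule bounded_linear.tendsto[OF bounded_linear_adj])
    have "norm_between a b (x n)" "norm_between a b (adj (x n))" for n
      using x[of n] by (simp_all add: mod_in_iff)
    then have "mod_in l"
      unfolding mod_in_iff by (intro conjI norm_between_limit[OF _ xl] norm_between_limit[OF _ adj_l])
    then show "l \<in> {X. X - T \<in> J \<and> mod_in X}" using l by simp
  next
    show "F X \<in> J" if "X \<in> {X. X - T \<in> J \<and> mod_in X}" for X using that by (simp add: F_in_J)
  next
    fix s t :: real and X Y assume XY: "X \<in> {X. X - T \<in> J \<and> mod_in X}" "Y \<in> {X. X - T \<in> J \<and> mod_in X}"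
    then have J: "X - Y \<in> J" using J_diff[of "X - T" "Y - T"] by simp
    then have "N (F X - F Y) \<le> L * N (X - Y)" using L(2) XY by simp
    also have "\<dots> \<le> L * (\<bar>s - t\<bar> + N (X - Y))" using L(1) by (intro mult_left_mono) auto
    finally show "N (F X - F Y) \<le> L * (\<bar>s - t\<bar> + N (X - Y))" .
  qed
  then show ?thesis by blast
qed

section \<open>The solution, its uniqueness and its similarity orbit\<close>

definition flow :: "real \<Rightarrow> 'h bop" where
  "flow = euler_limit (\<lambda>t. F) T"

lemma flow_deriv: "J_deriv_lipschitz flow (\<lambda>t. F (flow t))"
  unfolding flow_def by (rule euler_limit_J_deriv_lipschitz) (use euler_scheme_flow in blast)

lemma flow_0: "flow 0 = T"
  by (simp add: flow_def euler_limit_def dyadic_index_0)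

lemma flow_mod_in: "0 \<le> t \<Longrightarrow> flow t - T \<in> J \<and> mod_in (flow t)"
proof -
  assume t: "0 \<le> t"
  obtain L n0 where "euler_scheme J N (\<lambda>t. F) T t L {X. X - T \<in> J \<and> mod_in X} n0"
    using euler_scheme_flow[OF t] by blast
  from euler_scheme.euler_limit_in_D[OF this, of t] show ?thesis using t by (simp add: flow_def)
qed

lemma flow_solves: "flow_solution \<phi>1 \<phi>2 a b T flow"
  unfolding flow_solution_def
  using flow_0 flow_mod_in J_deriv_imp_has_vector_derivative[OF J_deriv_lipschitz_imp_J_deriv[OF flow_deriv]]
  by (simp add: flow_field_def)

text \<open>The C1 condition gives a derivative in N, the equation one in the operator norm. Since N
  dominates, they coincide, so the difference of the solutions satisfies a Gronwall inequality in
  N.\<close>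

lemma flow_unique:
  assumes Y: "flow_solution \<phi>1 \<phi>2 a b T Y" and C1: "C1_ideal J N (\<lambda>t. Y t - T)" and t: "0 \<le> t"
  shows "Y t = flow t"
proof -
  obtain Y' where Y': "J_deriv Y Y'" using C1_ideal_imp_J_deriv[OF C1] by blast
  have Y'F: "Y' t = F (Y t)" if t: "0 \<le> t" for t
  proof (rule vector_derivative_unique_within)
    have "at_right t \<le> at t within {0..}" using t by (intro at_le) auto
    then show "at t within {0..} \<noteq> bot" using trivial_limit_at_right_real[of t] by (auto simp: bot_unique)
    show "(Y has_vector_derivative Y' t) (at t within {0..})"
      by (rule J_deriv_imp_has_vector_derivative[OF Y' t])
    show "(Y has_vector_derivative F (Y t)) (at t within {0..})"
      using Y t by (simp add: flow_solution_def flow_field_def)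
  qed
  have YJ: "Y t - T \<in> J" "mod_in (Y t)" if "0 \<le> t" for t
    using Y C1 that by (auto simp: flow_solution_def C1_ideal_def)
  obtain L where L: "L \<ge> 0" "\<And>X Y. mod_in X \<Longrightarrow> mod_in Y \<Longrightarrow> X - Y \<in> J \<Longrightarrow> F X - F Y \<in> J \<and> N (F X - F Y) \<le> L * N (X - Y)"
    using F_lipschitz by blast
  have "Y t - flow t = 0"
  proof (rule J_deriv_zero_unique[OF J_deriv_diff[OF Y' J_deriv_lipschitz_imp_J_deriv[OF flow_deriv]] _ L(1) _ t])
    show "Y 0 - flow 0 = 0" using Y by (simp add: flow_solution_def flow_0)
    fix t :: real assume t: "0 \<le> t"
    have "Y t - flow t \<in> J" using J_diff[OF YJ(1)[OF t], of "flow t - T"] flow_mod_in[OF t] by simp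
    then show "N (Y' t - F (flow t)) \<le> L * N (Y t - flow t)"
      unfolding Y'F[OF t] using L(2) YJ(2)[OF t] flow_mod_in[OF t] by blast
  qed
  then show ?thesis by simp
qed

lemma Phi_flow_lipschitz:
  assumes "0 \<le> \<tau>"
  shows "\<exists>L\<ge>0. \<forall>s\<in>{0..\<tau>}. \<forall>t\<in>{0..\<tau>}. \<Phi> (flow s) - \<Phi> (flow t) \<in> J \<and>
    N (\<Phi> (flow s) - \<Phi> (flow t)) \<le> L * \<bar>s - t\<bar>"
proof -
  obtain C where C: "C \<ge> 0" "\<And>X Y. mod_in X \<Longrightarrow> mod_in Y \<Longrightarrow> X - Y \<in> J \<Longrightarrow>
      \<Phi> X - \<Phi> Y \<in> J \<and> N (\<Phi> X - \<Phi> Y) \<le> C * N (X - Y)"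
    using Phi_lipschitz by blast
  obtain B where B: "B \<ge> 0" "\<And>s t. s \<in> {0..\<tau>} \<Longrightarrow> t \<in> {0..\<tau>} \<Longrightarrow>
      flow s - flow t \<in> J \<and> N (flow s - flow t) \<le> B * \<bar>s - t\<bar>"
    using flow_deriv assms unfolding J_deriv_lipschitz_def by metis
  have "\<Phi> (flow s) - \<Phi> (flow t) \<in> J \<and> N (\<Phi> (flow s) - \<Phi> (flow t)) \<le> (C * B) * \<bar>s - t\<bar>"
    if st: "s \<in> {0..\<tau>}" "t \<in> {0..\<tau>}" for s t
  proof -
    have "\<Phi> (flow s) - \<Phi> (flow t) \<in> J \<and> N (\<Phi> (flow s) - \<Phi> (flow t)) \<le> C * N (flow s - flow t)"
      using B(2)[OF st] flow_mod_in st by (intro C(2)) auto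
    moreover have "C * N (flow s - flow t) \<le> C * (B * \<bar>s - t\<bar>)"
      using B(2)[OF st] C(1) by (intro mult_left_mono) auto
    ultimately show ?thesis by (auto simp: mult.assoc)
  qed
  then show ?thesis using C(1) B(1) by (intro exI[of _ "C * B"]) auto
qed

text \<open>The implication stands inside the existential so that a single family g serves both
  orbits. The linear equation is solved in J or in the whole algebra according to whether \<phi>(T)
  lies in J.\<close>

lemma flow_conjugation:
  "\<exists>g. \<forall>t\<ge>0. invertible_bop (g t) \<and> flow t = g t * T * inverse_bop (g t) \<and> (\<Phi> T \<in> J \<longrightarrow> g t - 1 \<in> J)"
proof -
  let ?A = "\<lambda>t. \<Phi> (flow t)"
  obtain K where K: "K \<ge> 0" "\<And>X. mod_in X \<Longrightarrow> norm (\<Phi> X) \<le> K" using Phi_bounded by blast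
  have AK: "norm (?A t) \<le> K" if "0 \<le> t" for t using K(2) flow_mod_in[OF that] by blast
  have lip: "\<exists>L\<ge>0. \<forall>s\<in>{0..\<tau>}. \<forall>t\<in>{0..\<tau>}. norm (?A s - ?A t) \<le> L * \<bar>s - t\<bar>" if "0 \<le> \<tau>" for \<tau>
    using Phi_flow_lipschitz[OF that] norm_le_N by (meson order_trans)
  have "\<exists>g. g 0 = 1 \<and> (\<forall>t\<ge>0. \<Phi> T \<in> J \<longrightarrow> g t - 1 \<in> J) \<and>
      (\<forall>t\<ge>0. (g has_vector_derivative ?A t * g t) (at t within {0..}))"
  proof (cases "\<Phi> T \<in> J")
    case True
    have AJ: "?A t \<in> J" if t: "0 \<le> t" for t
    proof -
      have "t \<in> {0..t}" "0 \<in> {0..t}" using t by simp_all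
      then have "?A t - ?A 0 \<in> J" using Phi_flow_lipschitz[OF t] by blast
      then show ?thesis using J_add[OF _ True, of "?A t - ?A 0"] by (simp add: flow_0)
    qed
    have lipJ: "\<exists>L\<ge>0. \<forall>s\<in>{0..\<tau>}. \<forall>t\<in>{0..\<tau>}. N (?A s - ?A t) \<le> L * \<bar>s - t\<bar>" if "0 \<le> \<tau>" for \<tau>
      using Phi_flow_lipschitz[OF that] by blast
    have "\<exists>g. g 0 = 1 \<and> (\<forall>t\<ge>0. g t - 1 \<in> J) \<and>
        (\<forall>t\<ge>0. (g has_vector_derivative ?A t * g t) (at t within {0..}))"
      by (rule linear_ode_solution[OF AJ AK lipJ])
    then show ?thesis by blast
  next
    case False
    have "\<exists>g. g 0 = 1 \<and> (\<forall>t\<ge>0. g t - 1 \<in> UNIV) \<and>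
        (\<forall>t\<ge>0. (g has_vector_derivative ?A t * g t) (at t within {0..}))"
      using AK lip by (intro operator_ideal.linear_ode_solution[OF operator_ideal_UNIV]) auto
    then show ?thesis using False by blast
  qed
  then obtain g where g0: "g 0 = 1" and gJ: "\<And>t. 0 \<le> t \<Longrightarrow> \<Phi> T \<in> J \<Longrightarrow> g t - 1 \<in> J"
    and g: "\<And>t. 0 \<le> t \<Longrightarrow> (g has_vector_derivative ?A t * g t) (at t within {0..})"
    by blast
  have "invertible_bop (g t) \<and> flow t = g t * flow 0 * inverse_bop (g t)" if t: "0 \<le> t" for t
  proof (rule lax_pair_conjugation[where A = ?A and K = K])
    show "(flow has_vector_derivative ?A t * flow t - flow t * ?A t) (at t within {0..})" if "0 \<le> t" for t
      using flow_solves that by (simp add: flow_solution_def commutator_def)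
    show "selfadjoint (?A t)" if "0 \<le> t" for t using flow_mod_in[OF that] by (intro selfadjoint_phi) simp
  qed (use AK lip g0 g t in auto)
  then show ?thesis using gJ by (intro exI[of _ g]) (simp add: flow_0)
qed

theorem ideal_flow_theorem:
  "\<exists>X. flow_solution \<phi>1 \<phi>2 a b T X \<and> C1_ideal J N (\<lambda>t. X t - T) \<and>
     (\<forall>Y. flow_solution \<phi>1 \<phi>2 a b T Y \<and> C1_ideal J N (\<lambda>t. Y t - T) \<longrightarrow> (\<forall>t\<ge>0. Y t = X t)) \<and>
     (\<forall>t\<ge>0. X t \<in> similarity_orbit T) \<and>
     (phi_bop \<phi>1 \<phi>2 T \<in> J \<longrightarrow> (\<forall>t\<ge>0. X t \<in> ideal_similarity_orbit J T))"
proof -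
  obtain g where g: "\<And>t. 0 \<le> t \<Longrightarrow> invertible_bop (g t) \<and> flow t = g t * T * inverse_bop (g t) \<and>
      (\<Phi> T \<in> J \<longrightarrow> g t - 1 \<in> J)"
    using flow_conjugation by blast
  show ?thesis
  proof (intro exI[of _ flow] conjI)
    show "flow_solution \<phi>1 \<phi>2 a b T flow" by (rule flow_solves)
    show "C1_ideal J N (\<lambda>t. flow t - T)" by (rule J_deriv_lipschitz_imp_C1[OF flow_deriv flow_0])
    show "\<forall>Y. flow_solution \<phi>1 \<phi>2 a b T Y \<and> C1_ideal J N (\<lambda>t. Y t - T) \<longrightarrow> (\<forall>t\<ge>0. Y t = flow t)"
      using flow_unique by blast
    show "\<forall>t\<ge>0. flow t \<in> similarity_orbit T" using g unfolding similarity_orbit_def by blast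
    show "\<Phi> T \<in> J \<longrightarrow> (\<forall>t\<ge>0. flow t \<in> ideal_similarity_orbit J T)"
      using g unfolding ideal_similarity_orbit_def by blast
  qed
qed

end

text \<open>The largest distance of the spectrum from the midpoint is attained, so it is strictly
  less than half the length, and \<delta> is the difference.\<close>

lemma spectrum_in_open_interval:
  fixes A :: "'h::separable_infinite_dim_chilbert_space bop"
  assumes A: "selfadjoint A" and sub: "spectrum A \<subseteq> complex_of_real ` {a<..<b}"
  shows "\<exists>\<delta>>0. spectrum_within A (a + \<delta>) (b - \<delta>)"
proof -
  let ?m = "(a + b) / 2"
  have "selfadjoint (A - ?m *\<^sub>R 1)" using A by (intro selfadjoint_simps)
  then obtain r where r: "\<bar>r\<bar> = norm (A - ?m *\<^sub>R 1)" "of_real r \<in> spectrum (A - ?m *\<^sub>R 1)"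
    by (rule selfadjoint_norm_in_spectrum)
  then have "complex_of_real (r + ?m) \<in> spectrum A" by (simp add: spectrum_shift)
  then obtain x where "x \<in> {a<..<b}" "complex_of_real (r + ?m) = of_real x" using sub by blast
  then have "r + ?m \<in> {a<..<b}" unfolding of_real_eq_iff by simp
  then have "\<bar>r\<bar> < (b - a) / 2" by (auto simp: abs_if field_simps)
  then have pos: "0 < (b - a) / 2 - \<bar>r\<bar>" by simp
  define \<delta> where "\<delta> = (b - a) / 2 - \<bar>r\<bar>"
  have "(a + \<delta> + (b - \<delta>)) / 2 = ?m" "(b - \<delta> - (a + \<delta>)) / 2 = \<bar>r\<bar>"
    by (simp_all add: \<delta>_def field_simps)
  then have "spectrum_within A (a + \<delta>) (b - \<delta>)"
    unfolding spectrum_within_iff_norm using A r by simp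
  then show ?thesis using pos unfolding \<delta>_def by blast
qed

text \<open>The norm of A is attained in modulus by a spectral point, which lies below b; \<delta>
  is \<open>b - norm A\<close>.\<close>

lemma spectrum_in_half_open_interval:
  fixes A :: "'h::separable_infinite_dim_chilbert_space bop"
  assumes A: "selfadjoint A" and sub: "spectrum A \<subseteq> complex_of_real ` {0..<b}"
  shows "\<exists>\<delta>>0. spectrum_within A 0 (b - \<delta>)"
proof -
  obtain r where r: "\<bar>r\<bar> = norm A" "of_real r \<in> spectrum A"
    using A by (rule selfadjoint_norm_in_spectrum)
  then obtain x where "x \<in> {0..<b}" "complex_of_real r = of_real x" using sub by blast
  then have lt: "norm A < b" using r(1) unfolding of_real_eq_iff by simp
  have "spectrum A \<subseteq> complex_of_real ` {0..norm A}"
  proof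
    fix z assume z: "z \<in> spectrum A"
    then obtain x where x: "x \<in> {0..<b}" "z = of_real x" using sub by blast
    then show "z \<in> complex_of_real ` {0..norm A}" using spectrum_norm[OF z] by simp
  qed
  then show ?thesis
    using A lt by (intro exI[of _ "b - norm A"]) (simp add: spectrum_within_def)
qed

theorem theorem4p6:
  fixes J :: "'h::separable_infinite_dim_chilbert_space bop set"
    and N :: "'h bop \<Rightarrow> real"
    and a b :: real
    and \<phi>1 \<phi>2 :: "real \<Rightarrow> real"
    and T :: "'h bop"
  assumes "normed_ideal J N"
    and "0 \<le> a" and "a \<le> b"
    and "continuous_on {a..b} \<phi>1" and "continuous_on {a..b} \<phi>2"
    and "mono_on {a..b} \<phi>1" and "mono_on {a..b} \<phi>2"
    and "strict_mono_on {a..b} (\<lambda>x. \<phi>1 x + \<phi>2 x)"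
    and "a > 0 \<Longrightarrow> ideal_lipschitz_on J N {a..b} \<phi>1 \<and> ideal_lipschitz_on J N {a..b} \<phi>2 \<and>
           moduli_spectra_in T {a<..<b}"
    and "a = 0 \<Longrightarrow> ideal_lipschitz_on J N {-b..b} (\<lambda>x. \<phi>1 \<bar>x\<bar>) \<and>
           ideal_lipschitz_on J N {-b..b} (\<lambda>x. \<phi>2 \<bar>x\<bar>) \<and> moduli_spectra_in T {0..<b}"
    and "commutator (phi_bop \<phi>1 \<phi>2 T) T \<in> J"
  shows "\<exists>X. flow_solution \<phi>1 \<phi>2 a b T X \<and> C1_ideal J N (\<lambda>t. X t - T) \<and>
           (\<forall>Y. flow_solution \<phi>1 \<phi>2 a b T Y \<and> C1_ideal J N (\<lambda>t. Y t - T) \<longrightarrow>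
             (\<forall>t\<ge>0. Y t = X t)) \<and>
           (\<forall>t\<ge>0. X t \<in> similarity_orbit T) \<and>
           (phi_bop \<phi>1 \<phi>2 T \<in> J \<longrightarrow> (\<forall>t\<ge>0. X t \<in> ideal_similarity_orbit J T))"
proof -
  interpret operator_ideal J N by (rule operator_ideal.intro) (rule assms(1))
  interpret monotone_pair a b \<phi>1 \<phi>2 by unfold_locales (rule assms)+
  have T_J: "flow_field \<phi>1 \<phi>2 T \<in> J" using assms(11) by (simp add: flow_field_def)
  note sa = selfadjoint_abs[of T] selfadjoint_abs[of "adj T"]
  have "\<exists>m M. ideal_flow J N a b \<phi>1 \<phi>2 T m M"
  proof (cases "a = 0")
    case False
    then have a: "0 < a" using assms(2) by simp
    have lip: "ideal_lipschitz_on J N {a..b} \<phi>1" "ideal_lipschitz_on J N {a..b} \<phi>2"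
      and T: "moduli_spectra_in T {a<..<b}" using assms(9)[OF a] by auto
    obtain \<delta>1 where \<delta>1: "\<delta>1 > 0" "spectrum_within (abs_bop T) (a + \<delta>1) (b - \<delta>1)"
      using spectrum_in_open_interval[OF sa(1) T[unfolded moduli_spectra_in_def, THEN conjunct1]] by blast
    obtain \<delta>2 where \<delta>2: "\<delta>2 > 0" "spectrum_within (abs_bop (adj T)) (a + \<delta>2) (b - \<delta>2)"
      using spectrum_in_open_interval[OF sa(2) T[unfolded moduli_spectra_in_def, THEN conjunct2]] by blast
    define \<delta> where "\<delta> = min \<delta>1 \<delta>2"
    have \<delta>: "\<delta> > 0" using \<delta>1 \<delta>2 by (simp add: \<delta>_def)
    have "norm_between (a + \<delta>1) (b - \<delta>1) T" "norm_between (a + \<delta>2) (b - \<delta>2) (adj T)"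
      using \<delta>1 \<delta>2 a by (simp_all add: spectrum_within_abs_iff)
    then have between: "norm_between (a + \<delta>) (b - \<delta>) T" "norm_between (a + \<delta>) (b - \<delta>) (adj T)"
      by (auto simp: \<delta>_def intro: norm_between_mono)
    have "ideal_flow J N a b \<phi>1 \<phi>2 T (a + \<delta>) (b - \<delta>)"
      by unfold_locales
        (use lip a \<delta> between T_J in \<open>auto intro: modulus_lipschitz_pos ideal_lipschitz_imp_lipschitz\<close>)
    then show ?thesis by blast
  next
    case True
    have b: "0 \<le> b" using assms(3) True by simp
    have lip: "ideal_lipschitz_on J N {-b..b} (\<lambda>x. \<phi>1 \<bar>x\<bar>)" "ideal_lipschitz_on J N {-b..b} (\<lambda>x. \<phi>2 \<bar>x\<bar>)"
      and T: "moduli_spectra_in T {0..<b}" using assms(10)[OF True] by auto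
    \<comment> \<open>On \<open>{0..b}\<close> the even extension agrees with the function itself,
      so its Lipschitz constant carries over.\<close>
    have scalar: "\<exists>L\<ge>0. \<forall>x\<in>{0..b}. \<forall>y\<in>{0..b}. \<bar>f x - f y\<bar> \<le> L * \<bar>x - y\<bar>"
      if f: "ideal_lipschitz_on J N {-b..b} (\<lambda>x. f \<bar>x\<bar>)" for f
    proof -
      obtain L where L: "L \<ge> 0" "\<forall>x\<in>{-b..b}. \<forall>y\<in>{-b..b}. \<bar>f \<bar>x\<bar> - f \<bar>y\<bar>\<bar> \<le> L * \<bar>x - y\<bar>"
        using ideal_lipschitz_imp_lipschitz[OF f] by blast
      have "\<bar>f x - f y\<bar> \<le> L * \<bar>x - y\<bar>" if "x \<in> {0..b}" "y \<in> {0..b}" for x y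
        using L(2)[rule_format, of x y] that by simp
      then show ?thesis using L(1) by blast
    qed
    obtain \<delta>1 where \<delta>1: "\<delta>1 > 0" "spectrum_within (abs_bop T) 0 (b - \<delta>1)"
      using spectrum_in_half_open_interval[OF sa(1) T[unfolded moduli_spectra_in_def, THEN conjunct1]] by blast
    obtain \<delta>2 where \<delta>2: "\<delta>2 > 0" "spectrum_within (abs_bop (adj T)) 0 (b - \<delta>2)"
      using spectrum_in_half_open_interval[OF sa(2) T[unfolded moduli_spectra_in_def, THEN conjunct2]] by blast
    define \<delta> where "\<delta> = min \<delta>1 \<delta>2"
    have \<delta>: "\<delta> > 0" using \<delta>1 \<delta>2 by (simp add: \<delta>_def)
    have "norm_between 0 (b - \<delta>1) T" "norm_between 0 (b - \<delta>2) (adj T)"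
      using \<delta>1 \<delta>2 by (simp_all add: spectrum_within_abs_iff)
    then have between: "norm_between 0 (b - \<delta>) T" "norm_between 0 (b - \<delta>) (adj T)"
      by (auto simp: \<delta>_def intro: norm_between_mono)
    have "ideal_flow J N a b \<phi>1 \<phi>2 T 0 (b - \<delta>)"
    proof unfold_locales
      show "modulus_lipschitz a b \<phi>1" "modulus_lipschitz a b \<phi>2"
        using modulus_lipschitz_zero[OF b lip(1)] modulus_lipschitz_zero[OF b lip(2)] True by simp_all
      show "\<exists>L\<ge>0. \<forall>x\<in>{a..b}. \<forall>y\<in>{a..b}. \<bar>\<phi>1 x - \<phi>1 y\<bar> \<le> L * \<bar>x - y\<bar>"
        "\<exists>L\<ge>0. \<forall>x\<in>{a..b}. \<forall>y\<in>{a..b}. \<bar>\<phi>2 x - \<phi>2 y\<bar> \<le> L * \<bar>x - y\<bar>"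
        using scalar[OF lip(1)] scalar[OF lip(2)] True by simp_all
    qed (use between T_J True \<delta> in auto)
    then show ?thesis by blast
  qed
  then obtain m M where "ideal_flow J N a b \<phi>1 \<phi>2 T m M" by blast
  then show ?thesis by (rule ideal_flow.ideal_flow_theorem)
qed

end
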